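(* Let $f(x)\in\mathbb{R}[x_1,\dots,x_n]$ be a multi-affine Gårding polynomial with nonnegative coefficients. Then: (1) $f$ is Rayleigh; equivalently, for all $x\in\overline{\Gamma_n^+}$ and all $i\neq j$, $\partial_if(x)\,\partial_jf(x)\ge f(x)\,\partial_i\partial_jf(x)$. (2) For any $a\in\overline{\Gamma_n^+}$, let $g(t):=f(ta)$. If $g\not\equiv0$, then the coefficient sequence $(a_k)_{k=0}^{d}$ of $g(t)=\sum_{k=0}^da_kt^k$, $d=\deg g$, is ultra log-concave. (3) If $f$ is also homogeneous, then $f$ is Lorentzian. Thus, when $f\not\equiv0$, $f$ is log-concave on $\Gamma_n^+$ (i.e. $\log f$ is concave there). Moreover, when $f\not\equiv 0$, the associated probability measure on $2^{[n]}$ is negatively associated.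
   Context: $\Gamma_n^+=\{x\in\mathbb{R}^n:x_i>0\ \forall i\}$, with closure $\overline{\Gamma_n^+}$. A polynomial is multi-affine if its degree in each variable is at most one. A subset $R\subset\mathbb{R}^n$ passes the positive ray test (PRT) if $R+\overline{\Gamma_n^+}\subset R$. A nonzero multi-affine polynomial $f$ is multi-affine Gårding if some (nonempty) connected component of $\{f>0\}$ passes PRT; the zero polynomial is also counted as Gårding. A multi-affine polynomial $f$ with nonnegative coefficients is Rayleigh if $f(x)\partial_i\partial_jf(x)-\partial_if(x)\partial_jf(x)\le0$ for all $x\in\Gamma_n^+$ and all $i<j$. A nonnegative sequence has no internal zeros if $r_1<r_2<r_3$ and $a_{r_1},a_{r_3}>0$ imply $a_{r_2}>0$; it is log-concave if it has no internal zeros and $a_k^2\ge a_{k-1}a_{k+1}$ for all interior $k$; a sequence $(a_k)_{k=0}^d$ is ultra log-concave if $(a_k/\binom dk)_{k=0}^d$ is log-concave. A homogeneous polynomial $f$ of degree $d\ge2$ with nonnegative coefficients is Lorentzian if (i) for all multi-indices $\alpha$ with $|\alpha|=d-2$, $\partial^\alpha f$ is real stable (i.e. identically zero, or nonvanishing at every $x\in\mathbb{C}^n$ with $\operatorname{Im}x_i>0$ for all $i$), and (ii) the support $J=\{\alpha: \text{coefficient of }x^\alpha\text{ is nonzero}\}$ is M-convex: for all $\alpha,\beta\in J$ and $i$ with $\alpha_i>\beta_i$ there is $j$ with $\alpha_j<\beta_j$ and $\alpha-e_i+e_j\in J$. In degrees $0$ and $1$, homogeneous polynomials with nonnegative coefficients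 are all counted as Lorentzian. For $f=\sum_{S\subset[n]}c_S\prod_{i\in S}x_i\not\equiv0$ with $c_S\ge0$, the associated measure on $2^{[n]}$ is $\mu(S)=c_S/f(1,\dots,1)$. A probability measure $\mu$ on $2^{[n]}$ is negatively associated if $\int FG\,d\mu\le\int F\,d\mu\int G\,d\mu$ for all functions $F,G:2^{[n]}\to\mathbb{R}$ that are increasing with respect to inclusion and depend on disjoint sets of coordinates. *)

theory Defs
  imports
    "HOL-Probability.Probability"
    "HOL-Library.Poly_Mapping"
    "HOL-Computational_Algebra.Polynomial"
begin

text \<open>The index set $[n]$ is a finite linearly ordered type, so $n \geq 1$ is arbitrary.  A
  polynomial maps exponent vectors to coefficients.\<close>

type_synonym 'n rpoly = "('n \<Rightarrow>\<^sub>0 nat) \<Rightarrow>\<^sub>0 real"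

definition peval :: "'n::finite rpoly \<Rightarrow> ('a::real_field)^'n \<Rightarrow> 'a" where
  "peval p x = (\<Sum>m\<in>Poly_Mapping.keys p.
     of_real (Poly_Mapping.lookup p m) * (\<Prod>i\<in>UNIV. x $ i ^ Poly_Mapping.lookup m i))"

text \<open>Formal partial derivative; the truncated subtraction only matters in terms
  whose coefficient is $0$.\<close>

definition mderiv :: "'n \<Rightarrow> 'n rpoly \<Rightarrow> 'n rpoly" where
  "mderiv i p = (\<Sum>m\<in>Poly_Mapping.keys p.
     Poly_Mapping.single (m - Poly_Mapping.single i 1)
       (real (Poly_Mapping.lookup m i) * Poly_Mapping.lookup p m))"

lemma lookup_mderiv:
  "Poly_Mapping.lookup (mderiv i p) m =
     real (Poly_Mapping.lookup m i + 1) * Poly_Mapping.lookup p (m + Poly_Mapping.single i 1)"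
proof -
  let ?e = "Poly_Mapping.single i (1::nat)"
  have summand: "Poly_Mapping.lookup (Poly_Mapping.single (k - ?e)
        (real (Poly_Mapping.lookup k i) * Poly_Mapping.lookup p k)) m
      = (if k = m + ?e then real (Poly_Mapping.lookup k i) * Poly_Mapping.lookup p k else 0)" for k
  proof (cases "Poly_Mapping.lookup k i = 0")
    case True
    then show ?thesis by (auto simp: lookup_single)
  next
    case False
    have "k - ?e = m \<longleftrightarrow> k = m + ?e"
    proof
      assume "k - ?e = m"
      then show "k = m + ?e" using False
        by (intro poly_mapping_eqI) (auto simp: lookup_add lookup_minus lookup_single when_def)
    qed simp
    then show ?thesis by (auto simp: lookup_single when_def)
  qed
  have "Poly_Mapping.lookup (mderiv i p) m = (\<Sum>k\<in>Poly_Mapping.keys p.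
      if k = m + ?e then real (Poly_Mapping.lookup k i) * Poly_Mapping.lookup p k else 0)"
    unfolding mderiv_def lookup_sum summand ..
  also have "\<dots> = real (Poly_Mapping.lookup (m + ?e) i) * Poly_Mapping.lookup p (m + ?e)"
    by (auto simp: sum.delta' in_keys_iff)
  finally show ?thesis by (simp add: lookup_add)
qed

definition mderivs :: "('n::{finite,linorder} \<Rightarrow>\<^sub>0 nat) \<Rightarrow> 'n rpoly \<Rightarrow> 'n rpoly" where
  "mderivs \<alpha> p =
     fold (\<lambda>i. mderiv i ^^ Poly_Mapping.lookup \<alpha> i) (sorted_list_of_set UNIV) p"

definition total_deg :: "('n::finite \<Rightarrow>\<^sub>0 nat) \<Rightarrow> nat" where
  "total_deg m = (\<Sum>i\<in>UNIV. Poly_Mapping.lookup m i)"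

definition homogeneous :: "nat \<Rightarrow> 'n::finite rpoly \<Rightarrow> bool" where
  "homogeneous d p \<longleftrightarrow> (\<forall>m\<in>Poly_Mapping.keys p. total_deg m = d)"

definition multi_affine :: "'n rpoly \<Rightarrow> bool" where
  "multi_affine p \<longleftrightarrow> (\<forall>m\<in>Poly_Mapping.keys p. \<forall>i. Poly_Mapping.lookup m i \<le> 1)"

definition nonneg_coeffs :: "'n rpoly \<Rightarrow> bool" where
  "nonneg_coeffs p \<longleftrightarrow> (\<forall>m. 0 \<le> Poly_Mapping.lookup p m)"

definition pos_orthant :: "(real^'n::finite) set" where
  "pos_orthant = {x. \<forall>i. 0 < x $ i}"

definition passes_PRT :: "(real^'n::finite) set \<Rightarrow> bool" where
  "passes_PRT R \<longleftrightarrow> (\<forall>x\<in>R. \<forall>y\<in>closure pos_orthant. x + y \<in> R)"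

text \<open>Members of \<^const>\<open>components\<close> are nonempty by definition.\<close>

definition garding :: "'n::finite rpoly \<Rightarrow> bool" where
  "garding f \<longleftrightarrow> multi_affine f \<and>
     (f = 0 \<or> (\<exists>C \<in> components {x :: real^'n. 0 < peval f x}. passes_PRT C))"

definition rayleigh :: "'n::{finite,linorder} rpoly \<Rightarrow> bool" where
  "rayleigh f \<longleftrightarrow> multi_affine f \<and> nonneg_coeffs f \<and>
     (\<forall>x \<in> pos_orthant. \<forall>i j. i < j \<longrightarrow>
        peval f x * peval (mderiv i (mderiv j f)) x
          - peval (mderiv i f) x * peval (mderiv j f) x \<le> 0)"

text \<open>In the following, a finite sequence $(a_k)_{k=0}^d$ is a function on
  \<^typ>\<open>nat\<close> of which only the values up to \<open>d\<close> are considered.\<close>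

definition no_internal_zeros :: "nat \<Rightarrow> (nat \<Rightarrow> real) \<Rightarrow> bool" where
  "no_internal_zeros d a \<longleftrightarrow>
     (\<forall>r1 r2 r3. r1 < r2 \<and> r2 < r3 \<and> r3 \<le> d \<and> 0 < a r1 \<and> 0 < a r3 \<longrightarrow> 0 < a r2)"

definition log_concave_seq :: "nat \<Rightarrow> (nat \<Rightarrow> real) \<Rightarrow> bool" where
  "log_concave_seq d a \<longleftrightarrow> (\<forall>k\<le>d. 0 \<le> a k) \<and> no_internal_zeros d a \<and>
     (\<forall>k. 0 < k \<and> k < d \<longrightarrow> a (k - 1) * a (k + 1) \<le> (a k)\<^sup>2)"

definition ultra_log_concave_seq :: "nat \<Rightarrow> (nat \<Rightarrow> real) \<Rightarrow> bool" where
  "ultra_log_concave_seq d a \<longleftrightarrow> log_concave_seq d (\<lambda>k. a k / real (d choose k))"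

text \<open>The univariate polynomial $t \mapsto f(ta)$.\<close>

definition ray_poly :: "'n::finite rpoly \<Rightarrow> real^'n \<Rightarrow> real poly" where
  "ray_poly f a = (\<Sum>m\<in>Poly_Mapping.keys f.
     smult (Poly_Mapping.lookup f m) (\<Prod>i\<in>UNIV. [:0, a $ i:] ^ Poly_Mapping.lookup m i))"

lemma poly_ray_poly: "poly (ray_poly f a) t = peval f (t *\<^sub>R a)"
  by (simp add: ray_poly_def peval_def poly_sum poly_prod)

definition real_stable :: "'n::finite rpoly \<Rightarrow> bool" where
  "real_stable f \<longleftrightarrow> f = 0 \<or> (\<forall>z :: complex^'n. (\<forall>i. 0 < Im (z $ i)) \<longrightarrow> peval f z \<noteq> 0)"

definition M_convex :: "('n \<Rightarrow>\<^sub>0 nat) set \<Rightarrow> bool" where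
  "M_convex J \<longleftrightarrow> (\<forall>\<alpha>\<in>J. \<forall>\<beta>\<in>J. \<forall>i. Poly_Mapping.lookup \<beta> i < Poly_Mapping.lookup \<alpha> i \<longrightarrow>
     (\<exists>j. Poly_Mapping.lookup \<alpha> j < Poly_Mapping.lookup \<beta> j \<and>
          \<alpha> - Poly_Mapping.single i 1 + Poly_Mapping.single j 1 \<in> J))"

text \<open>The degree is a parameter because the zero polynomial is homogeneous of every
  degree.\<close>

definition lorentzian :: "nat \<Rightarrow> 'n::{finite,linorder} rpoly \<Rightarrow> bool" where
  "lorentzian d f \<longleftrightarrow> homogeneous d f \<and> nonneg_coeffs f \<and>
     (2 \<le> d \<longrightarrow>
        (\<forall>\<alpha>. total_deg \<alpha> = d - 2 \<longrightarrow> real_stable (mderivs \<alpha> f)) \<and>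
        M_convex (Poly_Mapping.keys f))"

definition exp_of_set :: "'n::finite set \<Rightarrow> 'n \<Rightarrow>\<^sub>0 nat" where
  "exp_of_set S = (\<Sum>i\<in>S. Poly_Mapping.single i 1)"

text \<open>The measure $\mu(S) = c_S / f(1,\dots,1)$, where $c_S$ is the coefficient of
  $\prod_{i \in S} x_i$.  It is meaningful for nonzero multi-affine polynomials with
  nonnegative coefficients; see \<open>pmf_assoc_pmf\<close> below.\<close>

definition assoc_pmf :: "'n::finite rpoly \<Rightarrow> 'n set pmf" where
  "assoc_pmf f = embed_pmf (\<lambda>S. Poly_Mapping.lookup f (exp_of_set S) / peval f (\<chi> i. 1))"

lemma lookup_exp_of_set:
  "Poly_Mapping.lookup (exp_of_set S) i = (if i \<in> S then 1 else 0)"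
proof -
  have "finite S" by simp
  then show ?thesis unfolding exp_of_set_def
    by (induction S rule: finite_induct) (auto simp: lookup_add lookup_single when_def)
qed

lemma pmf_assoc_pmf:
  fixes f :: "'n::finite rpoly"
  assumes ma: "multi_affine f" and nn: "nonneg_coeffs f" and nz: "f \<noteq> 0"
  shows "pmf (assoc_pmf f) S = Poly_Mapping.lookup f (exp_of_set S) / peval f (\<chi> i. 1)"
proof -
  let ?L = "Poly_Mapping.lookup f" and ?K = "Poly_Mapping.keys f"
  have val: "peval f (\<chi> i. (1::real)) = (\<Sum>m\<in>?K. ?L m)"
    by (simp add: peval_def)
  have K: "?K \<subseteq> range exp_of_set"
  proof
    fix m assume "m \<in> ?K"
    then have "\<And>i. Poly_Mapping.lookup m i \<le> 1" using ma by (auto simp: multi_affine_def)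
    then have "m = exp_of_set {i. Poly_Mapping.lookup m i = 1}"
      by (intro poly_mapping_eqI) (auto simp: lookup_exp_of_set le_Suc_eq)
    then show "m \<in> range exp_of_set" by blast
  qed
  have inj: "inj (exp_of_set :: 'n set \<Rightarrow> _)"
  proof (rule injI)
    fix S T :: "'n set" assume "exp_of_set S = exp_of_set T"
    then have "Poly_Mapping.lookup (exp_of_set S) i = Poly_Mapping.lookup (exp_of_set T) i" for i
      by simp
    then have "i \<in> S \<longleftrightarrow> i \<in> T" for i
      by (metis lookup_exp_of_set zero_neq_one)
    then show "S = T" by blast
  qed
  have "(\<Sum>S\<in>UNIV. ?L (exp_of_set S)) = (\<Sum>m\<in>range exp_of_set. ?L m)"
    using inj by (simp add: sum.reindex)
  also have "\<dots> = (\<Sum>m\<in>?K. ?L m)"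
    using K by (intro sum.mono_neutral_right) (auto simp: in_keys_iff)
  finally have tot: "(\<Sum>S\<in>UNIV. ?L (exp_of_set S)) = peval f (\<chi> i. 1)"
    using val by simp
  have pos: "0 < peval f (\<chi> i. (1::real))"
    unfolding val
  proof (rule sum_pos)
    show "?K \<noteq> {}" using nz by simp
    show "0 < ?L m" if "m \<in> ?K" for m
      using that nn by (simp add: nonneg_coeffs_def in_keys_iff order_less_le)
  qed simp
  have nonneg: "0 \<le> ?L (exp_of_set S) / peval f (\<chi> i. 1)" for S
    using nn pos by (simp add: nonneg_coeffs_def)
  have "(\<integral>\<^sup>+ S. ennreal (?L (exp_of_set S) / peval f (\<chi> i. 1)) \<partial>count_space UNIV)
      = ennreal (\<Sum>S\<in>UNIV. ?L (exp_of_set S) / peval f (\<chi> i. 1))"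
    using nonneg by (simp add: nn_integral_count_space_finite)
  also have "\<dots> = 1"
    using tot pos by (simp flip: sum_divide_distrib)
  finally show ?thesis
    unfolding assoc_pmf_def using nonneg by (subst pmf_embed_pmf) auto
qed

definition depends_on :: "'n set \<Rightarrow> ('n set \<Rightarrow> real) \<Rightarrow> bool" where
  "depends_on A F \<longleftrightarrow> (\<forall>S T. S \<inter> A = T \<inter> A \<longrightarrow> F S = F T)"

definition negatively_associated :: "'n::finite set pmf \<Rightarrow> bool" where
  "negatively_associated \<mu> \<longleftrightarrow>
     (\<forall>F G :: 'n set \<Rightarrow> real. \<forall>A B. mono F \<and> mono G \<and> A \<inter> B = {} \<and>
        depends_on A F \<and> depends_on B G \<longrightarrow>
        measure_pmf.expectation \<mu> (\<lambda>S. F S * G S)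
          \<le> measure_pmf.expectation \<mu> F * measure_pmf.expectation \<mu> G)"

end

theory Submission
  imports Defs "HOL-Combinatorics.Transposition"
begin

text \<open>A multi-affine polynomial \<open>f\<close> is affine along each coordinate axis.  For nonnegative coefficients, the
  component of \<open>{f > 0}\<close> that passes the positive ray test is the one containing the positive orthant, and
  the test says that all partial derivatives are nonnegative on it.  Everything is deduced from
  walking inside this component \<open>C\<close>.

  The Rayleigh inequality holds because a violation at a point of \<open>C\<close> would open a path in the plane of the
  two variables that stays in \<open>C\<close> and leads to a point with a negative derivative
  (\<open>rayleigh_on_chamber\<close>).  Derivatives of \<open>f\<close> are again of the same kind, and their components contain \<open>C\<close>
  (\<open>gard_pd\<close>, \<open>chamber_subset_chamber_pd\<close>).

  For ultra-log-concavity, scaling the variables reduces \<open>f (t a)\<close> to the diagonal \<open>f (t, \<dots>, t)\<close>.  The class is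
  closed under limits and under averaging over a transposition of two variables, so one may pass to
  a fully symmetric polynomial with the same diagonal (\<open>gard_sym2\<close>, \<open>symmetric_representative\<close>).  There the
  derivatives of the diagonal are diagonals of partial derivatives, and growth of components means
  that the largest real roots of the successive derivatives decrease.  Together with positivity to the
  right of the roots this suffices for the Newton inequalities
  \<open>m h h'' \<le> (m - 1) h'\<^sup>2\<close> of a polynomial of degree \<open>m\<close>, by induction on the degree
  (\<open>newton_inequality_from_derivative\<close>, \<open>newton_symmetric\<close>).

  In the homogeneous case, the exchange property of the support follows by evaluating a linear derivative,
  which is positive on \<open>C\<close>, at the indicator vector of a set in the support (\<open>support_exchange\<close>).  A zero of a
  quadratic derivative in the upper half-plane would produce a line inside its component that
  forces the origin into the component (\<open>quadratic_real_stable\<close>).  Log-concavity follows from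
  ultra-log-concavity of \<open>t \<mapsto> f (x + t y)\<close> (\<open>hom_log_concave\<close>).  Negative association is the theorem of Feder and
  Mihail, which only uses pairwise negative correlation under all conditionings, that is, the Rayleigh
  inequality for derivatives at \<open>0\<close>-\<open>1\<close> points, and the constant size of the random set
  (\<open>feder_mihail\<close>, \<open>gard_pairwise_nc\<close>).\<close>

section \<open>Multi-affine polynomials as coefficient vectors\<close>

definition maeval :: "real^('n::finite set) \<Rightarrow> real^'n \<Rightarrow> real" where
  "maeval c x = (\<Sum>S\<in>UNIV. c $ S * (\<Prod>i\<in>S. x $ i))"

text \<open>The coefficient of a product of variables over \<open>S\<close> is the entry at \<open>S\<close>.  Differentiation
  in \<open>x\<^sub>i\<close> then only relabels entries, because the polynomial has degree at most one in \<open>x\<^sub>i\<close>.\<close>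

definition pd :: "'n::finite \<Rightarrow> real^('n set) \<Rightarrow> real^('n set)" where
  "pd i c = (\<chi> S. if i \<in> S then 0 else c $ (insert i S))"

definition nonneg :: "real^('n::finite set) \<Rightarrow> bool" where
  "nonneg c \<longleftrightarrow> (\<forall>S. 0 \<le> c $ S)"

lemma sum_sets_split:
  fixes h :: "'n::finite set \<Rightarrow> 'a::comm_monoid_add"
  shows "(\<Sum>S\<in>UNIV. h S) = (\<Sum>S | i \<notin> S. h S + h (insert i S))"
proof -
  have U: "(UNIV :: 'n set set) = {S. i \<notin> S} \<union> insert i ` {S. i \<notin> S}"
  proof -
    have "S \<in> insert i ` {S. i \<notin> S}" if "i \<in> S" for S :: "'n set"
      using that by (intro image_eqI[where x = "S - {i}"]) auto
    then show ?thesis by blast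
  qed
  have inj: "inj_on (insert i) {S. i \<notin> S}"
    by (auto simp: inj_on_def)
  have "(\<Sum>S\<in>UNIV. h S) = (\<Sum>S | i \<notin> S. h S) + (\<Sum>S\<in>insert i ` {S. i \<notin> S}. h S)"
    by (subst U, rule sum.union_disjoint) auto
  also have "(\<Sum>S\<in>insert i ` {S. i \<notin> S}. h S) = (\<Sum>S | i \<notin> S. h (insert i S))"
    using inj by (simp add: sum.reindex)
  finally show ?thesis by (simp add: sum.distrib)
qed

lemma maeval_split:
  "maeval c x = (\<Sum>S | i \<notin> S. (c $ S + x $ i * c $ insert i S) * (\<Prod>k\<in>S. x $ k))"
  unfolding maeval_def sum_sets_split[of _ i] by (intro sum.cong) (auto simp: algebra_simps)

lemma maeval_pd: "maeval (pd i c) x = (\<Sum>S | i \<notin> S. c $ insert i S * (\<Prod>k\<in>S. x $ k))"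
  unfolding maeval_split[of _ _ i] by (intro sum.cong) (auto simp: pd_def)

text \<open>Every argument below moves along coordinate directions, where the polynomial is affine; this
  identity is the only form of Taylor's formula that is needed.\<close>

lemma maeval_add_axis:
  "maeval c (x + s *\<^sub>R axis i 1) = maeval c x + s * maeval (pd i c) x"
proof -
  have "maeval c (x + s *\<^sub>R axis i 1) =
      (\<Sum>S | i \<notin> S. (c $ S + (x $ i + s) * c $ insert i S) * (\<Prod>k\<in>S. x $ k))"
    unfolding maeval_split[of c "x + s *\<^sub>R axis i 1" i]
  proof (intro sum.cong arg_cong2[where f = "(*)"] refl)
    fix S :: "'a set" assume S: "S \<in> {S. i \<notin> S}"
    show "(\<Prod>k\<in>S. (x + s *\<^sub>R axis i 1) $ k) = (\<Prod>k\<in>S. x $ k)"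
      using S by (intro prod.cong) (auto simp: axis_def)
  qed (simp add: axis_def)
  also have "\<dots> = maeval c x + s * maeval (pd i c) x"
    unfolding maeval_pd maeval_split[of c x i] sum_distrib_left sum.distrib[symmetric]
    by (intro sum.cong) (auto simp: algebra_simps)
  finally show ?thesis .
qed

lemma pd_commute: "pd i (pd j c) = pd j (pd i c)"
  by (auto simp: pd_def vec_eq_iff insert_commute)

lemma pd_same [simp]: "pd i (pd i c) = 0"
  by (auto simp: pd_def vec_eq_iff)

lemma pd_zero [simp]: "pd i 0 = 0"
  by (auto simp: pd_def vec_eq_iff)

lemma maeval_zero [simp]: "maeval 0 x = 0"
  by (simp add: maeval_def)

lemma maeval_pd_add_axis_same [simp]: "maeval (pd i c) (x + s *\<^sub>R axis i 1) = maeval (pd i c) x"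
  by (simp add: maeval_add_axis)

lemma maeval_add_two_axes:
  "maeval c (x + s *\<^sub>R axis i 1 + t *\<^sub>R axis j 1) =
     maeval c x + s * maeval (pd i c) x + t * maeval (pd j c) x + s * t * maeval (pd i (pd j c)) x"
  unfolding maeval_add_axis by (simp add: algebra_simps)

lemma maeval_add: "maeval (c + d) x = maeval c x + maeval d x"
  by (simp add: maeval_def sum.distrib algebra_simps)

lemma maeval_scaleR: "maeval (r *\<^sub>R c) x = r * maeval c x"
  by (simp add: maeval_def sum_distrib_left mult_ac)

lemma pd_add: "pd i (c + d) = pd i c + pd i d"
  by (auto simp: pd_def vec_eq_iff)

lemma pd_scaleR: "pd i (r *\<^sub>R c) = r *\<^sub>R pd i c"
  by (auto simp: pd_def vec_eq_iff)

lemma nonneg_pd: "nonneg c \<Longrightarrow> nonneg (pd i c)"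
  by (simp add: nonneg_def pd_def)

lemma tendsto_maeval [tendsto_intros]:
  assumes "(f \<longlongrightarrow> c) F" "(g \<longlongrightarrow> x) F"
  shows "((\<lambda>k. maeval (f k) (g k)) \<longlongrightarrow> maeval c x) F"
  using assms unfolding maeval_def by (intro tendsto_intros)

lemma continuous_on_maeval [continuous_intros]:
  assumes "continuous_on A f" "continuous_on A g"
  shows "continuous_on A (\<lambda>k. maeval (f k) (g k))"
  using assms unfolding maeval_def by (intro continuous_intros)

lemma tendsto_pd [tendsto_intros]:
  "(f \<longlongrightarrow> c) F \<Longrightarrow> ((\<lambda>k. pd i (f k)) \<longlongrightarrow> pd i c) F"
  unfolding pd_def by (intro vec_tendstoI) (auto intro: tendsto_intros)

lemma open_maeval_pos: "open {x. 0 < maeval c x}"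
  by (intro open_Collect_less continuous_intros)

lemma maeval_pos:
  assumes "nonneg c" "c \<noteq> 0" "\<And>i. 0 < x $ i"
  shows "0 < maeval c x"
proof -
  obtain S where S: "c $ S \<noteq> 0" using assms(2) by (auto simp: vec_eq_iff)
  show ?thesis
    unfolding maeval_def
  proof (rule sum_pos2[where i = S])
    show "0 < c $ S * (\<Prod>i\<in>S. x $ i)"
      using S assms by (intro mult_pos_pos prod_pos) (auto simp: nonneg_def less_le)
    show "0 \<le> c $ T * (\<Prod>i\<in>T. x $ i)" for T
      using assms by (intro mult_nonneg_nonneg prod_nonneg) (auto simp: nonneg_def less_imp_le)
  qed auto
qed

section \<open>The distinguished component of positivity\<close>

text \<open>A component of the set of positivity that passes the positive ray test meets the open positive
  orthant.  For nonnegative coefficients (not all zero) the polynomial is positive there, so the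
  component contains the whole orthant and is the one through the all-ones vector.\<close>

definition chamber :: "real^('n::finite set) \<Rightarrow> (real^'n) set" where
  "chamber c = connected_component_set {x. 0 < maeval c x} 1"

text \<open>The positive ray test in infinitesimal form: the component can be left in direction \<open>e\<^sub>i\<close> only if
  the \<open>i\<close>-th partial derivative is negative somewhere on it, and since the polynomial is affine
  along \<open>e\<^sub>i\<close>, a negative derivative at one point does make it negative further out.\<close>

definition gard :: "real^('n::finite set) \<Rightarrow> bool" where
  "gard c \<longleftrightarrow> nonneg c \<and> (\<forall>x\<in>chamber c. \<forall>i. 0 \<le> maeval (pd i c) x)"

lemma gard_nonneg: "gard c \<Longrightarrow> nonneg c"
  by (simp add: gard_def)

lemma chamber_pos: "x \<in> chamber c \<Longrightarrow> 0 < maeval c x"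
  unfolding chamber_def using connected_component_subset by blast

lemma open_chamber: "open (chamber c)"
  unfolding chamber_def by (intro open_connected_component open_maeval_pos)

lemma connected_chamber: "connected (chamber c)"
  unfolding chamber_def by simp

lemma one_in_chamber: "nonneg c \<Longrightarrow> c \<noteq> 0 \<Longrightarrow> 1 \<in> chamber c"
  unfolding chamber_def by (simp add: maeval_pos)

lemma chamber_connected:
  assumes "x \<in> chamber c" "connected T" "x \<in> T" "\<And>y. y \<in> T \<Longrightarrow> 0 < maeval c y"
  shows "T \<subseteq> chamber c"
proof -
  have "T \<subseteq> connected_component_set {x. 0 < maeval c x} x"
    using assms by (intro connected_component_maximal) auto
  then show ?thesis
    using assms(1) connected_component_eq unfolding chamber_def by blast
qed

lemma chamber_segment:
  assumes "x \<in> chamber c" "\<And>u. 0 \<le> u \<Longrightarrow> u \<le> 1 \<Longrightarrow> 0 < maeval c (x + u *\<^sub>R (y - x))"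
  shows "y \<in> chamber c"
proof -
  have "closed_segment x y \<subseteq> chamber c"
  proof (rule chamber_connected[OF assms(1)])
    fix z assume "z \<in> closed_segment x y"
    then obtain u where u: "0 \<le> u" "u \<le> 1" "z = (1 - u) *\<^sub>R x + u *\<^sub>R y"
      by (auto simp: closed_segment_def)
    then have "z = x + u *\<^sub>R (y - x)" by (simp add: algebra_simps)
    then show "0 < maeval c z" using assms(2)[of u] u by simp
  qed auto
  then show ?thesis by auto
qed

lemma nonneg_point_in_chamber:
  assumes "nonneg c" "\<And>i. 0 \<le> x $ i" "0 < maeval c x"
  shows "x \<in> chamber c"
proof (rule chamber_segment[where x = 1])
  have "c \<noteq> 0" using assms(3) by auto
  then show "1 \<in> chamber c" using assms by (simp add: one_in_chamber)
  fix u :: real assume u: "0 \<le> u" "u \<le> 1"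
  show "0 < maeval c (1 + u *\<^sub>R (x - 1))"
  proof (cases "u = 1")
    case False
    have *: "(1 + u *\<^sub>R (x - 1)) $ i = (1 - u) + u * x $ i" for i
      by (simp add: algebra_simps)
    have "0 < (1 - u) + u * x $ i" for i
      using u False assms(2)[of i] by (intro add_pos_nonneg) auto
    then show ?thesis by (intro maeval_pos assms(1) \<open>c \<noteq> 0\<close>) (simp only: *)
  qed (use assms in simp)
qed

text \<open>The component is relatively closed in the set of positivity: around a positive limit there is a
  ball on which the polynomial is positive, and it contains a point of the sequence.\<close>

lemma chamber_closed_in_pos:
  assumes "\<And>k. X k \<in> chamber c" "X \<longlonglongrightarrow> x" "0 < maeval c x"
  shows "x \<in> chamber c"
proof -
  obtain r where r: "r > 0" "ball x r \<subseteq> {x. 0 < maeval c x}"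
    using open_maeval_pos[of c] assms(3) open_contains_ball by blast
  obtain k where k: "X k \<in> ball x r"
    using assms(2) r(1) by (auto simp: lim_sequentially dist_commute)
  have "ball x r \<subseteq> chamber c"
    using k r by (intro chamber_connected[OF assms(1)]) auto
  then show ?thesis using r by auto
qed

text \<open>The standard way to control the component of a transformed polynomial: exhibit a set \<open>W\<close>
  containing the all-ones vector that is open and relatively closed in the set of positivity, and on
  which the required derivative estimates can be read off.\<close>

lemma chamber_subset_clopen:
  assumes "1 \<in> W" "open W"
    and cl: "\<And>X x. (\<And>k. X k \<in> W) \<Longrightarrow> X \<longlonglongrightarrow> x \<Longrightarrow> 0 < maeval c x \<Longrightarrow> x \<in> W"
  shows "chamber c \<subseteq> W"
proof (cases "chamber c = {}")
  case False
  then have one: "1 \<in> chamber c"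
    unfolding chamber_def by (metis connected_component_eq_empty connected_component_refl_eq mem_Collect_eq)
  define K where "K = chamber c \<inter> W"
  have 1: "openin (top_of_set (chamber c)) K"
    using assms(2) unfolding K_def by (simp add: openin_open_Int)
  have 2: "closedin (top_of_set (chamber c)) K"
    unfolding closedin_limpt
  proof (intro conjI allI impI)
    fix x assume "x islimpt K \<and> x \<in> chamber c"
    then obtain X where "\<And>k. X k \<in> K" "X \<longlonglongrightarrow> x" 
      unfolding islimpt_sequential by auto
    then show "x \<in> K"
      using cl[of X x] chamber_pos \<open>x islimpt K \<and> x \<in> chamber c\<close> unfolding K_def by auto
  qed (simp add: K_def)
  have "K = {} \<or> K = chamber c"
    using connected_chamber[of c] 1 2 unfolding connected_clopen by blast
  then show ?thesis using one assms(1) unfolding K_def by auto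
qed auto

lemma chamber_add_axis:
  assumes "gard c" "x \<in> chamber c" "0 \<le> t"
  shows "x + t *\<^sub>R axis i 1 \<in> chamber c"
proof (rule chamber_segment[OF assms(2)])
  fix u :: real assume "0 \<le> u" "u \<le> 1"
  have "0 \<le> u * t * maeval (pd i c) x"
    using assms \<open>0 \<le> u\<close> by (simp add: gard_def)
  then show "0 < maeval c (x + u *\<^sub>R (x + t *\<^sub>R axis i 1 - x))"
    using chamber_pos[OF assms(2)] by (simp add: maeval_add_axis)
qed

text \<open>Coordinatewise larger points are reached by finitely many moves along the axes.\<close>

lemma add_axes_induct:
  fixes x y :: "real^'n::finite"
  assumes "x \<in> U" "\<And>x i t. x \<in> U \<Longrightarrow> 0 \<le> t \<Longrightarrow> x + t *\<^sub>R axis i 1 \<in> U" "\<And>i. x $ i \<le> y $ i"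
  shows "y \<in> U"
proof -
  have "x + (\<Sum>i\<in>A. (y $ i - x $ i) *\<^sub>R axis i 1) \<in> U" for A
  proof -
    have "finite A" by simp
    then show ?thesis
    proof (induction A)
      case (insert i A)
      then show ?case using assms(2)[OF insert.IH, of "y $ i - x $ i" i] assms(3)[of i]
        by (simp add: algebra_simps)
    qed (simp add: assms)
  qed
  moreover have "x + (\<Sum>i\<in>UNIV. (y $ i - x $ i) *\<^sub>R axis i 1) = y"
    by (simp add: vec_eq_iff axis_def if_distrib if_distribR cong: if_cong)
  ultimately show ?thesis by metis
qed

lemma chamber_up:
  assumes "gard c" "x \<in> chamber c" "\<And>i. x $ i \<le> y $ i"
  shows "y \<in> chamber c"
  using assms(2) chamber_add_axis[OF assms(1)] assms(3) by (rule add_axes_induct)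

text \<open>At a zero in the region, nonnegativity on both sides along each axis kills every partial
  derivative, so the zero propagates along the axes in the upward direction.  It eventually reaches a
  point with positive coordinates, where a nonzero \<open>h\<close> with nonnegative coefficients is positive.\<close>

lemma zero_on_upward_region:
  assumes "open U" and up: "\<And>x i t. x \<in> U \<Longrightarrow> 0 \<le> t \<Longrightarrow> x + t *\<^sub>R axis i 1 \<in> U"
    and nn: "\<And>x. x \<in> U \<Longrightarrow> 0 \<le> maeval h x" and "nonneg h" and x: "x \<in> U" "maeval h x = 0"
  shows "h = 0"
proof (rule ccontr)
  assume "h \<noteq> 0"
  define V where "V = {x \<in> U. maeval h x = 0}"
  have step: "x + t *\<^sub>R axis i 1 \<in> V" if "x \<in> V" "0 \<le> t" for x i t
  proof -
    obtain r where r: "r > 0" "ball x r \<subseteq> U"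
      using \<open>open U\<close> \<open>x \<in> V\<close> open_contains_ball unfolding V_def by blast
    have "x + (r/2) *\<^sub>R axis i 1 \<in> U" "x + (-(r/2)) *\<^sub>R axis i 1 \<in> U"
      using r by (auto intro!: subsetD[OF r(2)] simp: dist_norm)
    from nn[OF this(1)] nn[OF this(2)]
    have "0 \<le> r/2 * maeval (pd i h) x" "0 \<le> -(r/2) * maeval (pd i h) x"
      using \<open>x \<in> V\<close> unfolding maeval_add_axis V_def by auto
    then have "maeval (pd i h) x = 0" using r(1) by (simp add: zero_le_mult_iff mult_le_0_iff)
    then show ?thesis using that up by (simp add: V_def maeval_add_axis)
  qed
  have "(\<chi> i. max (x $ i) 1) \<in> V"
    by (rule add_axes_induct[of x V, OF _ step]) (use x in \<open>auto simp: V_def\<close>)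
  moreover have "0 < maeval h (\<chi> i. max (x $ i) 1)"
    using \<open>nonneg h\<close> \<open>h \<noteq> 0\<close> by (intro maeval_pos) (auto simp: less_max_iff_disj)
  ultimately show False by (simp add: V_def)
qed

lemma pd_pos_on_chamber:
  assumes "gard c" "pd i c \<noteq> 0" "x \<in> chamber c"
  shows "0 < maeval (pd i c) x"
proof -
  have "maeval (pd i c) x \<noteq> 0"
    using zero_on_upward_region[OF open_chamber[of c] chamber_add_axis[OF assms(1)], of "pd i c" x]
      assms by (auto simp: gard_def nonneg_pd)
  then show ?thesis using assms by (auto simp: gard_def less_le)
qed

text \<open>The derivative is positive on the connected set \<open>chamber c\<close>, which contains the all-ones vector.
  This inclusion is the main source of information on derivatives; for instance it yields the exchange
  property of the support.\<close>

lemma chamber_subset_chamber_pd: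
  assumes "gard c" "pd i c \<noteq> 0"
  shows "chamber c \<subseteq> chamber (pd i c)"
proof (cases "c = 0")
  case False
  have nn: "nonneg c" using assms by (simp add: gard_def)
  show ?thesis
    using chamber_connected[OF one_in_chamber[OF nonneg_pd[OF nn] assms(2)] connected_chamber
        one_in_chamber[OF nn False]] pd_pos_on_chamber[OF assms] by blast
qed (use assms in auto)

text \<open>The component of \<open>\<partial>\<^sub>i f\<close> is covered by the projection of the component of \<open>f\<close> along \<open>e\<^sub>i\<close>:
  where \<open>\<partial>\<^sub>i f > 0\<close>, the fibre over a point of the projection is the whole ray on which \<open>f\<close> is positive,
  which makes the projection relatively closed.  Along such a ray \<open>\<partial>\<^sub>j f\<close> is nonnegative, and its slope is
  \<open>\<partial>\<^sub>i \<partial>\<^sub>j f\<close>.\<close>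

lemma gard_pd:
  assumes "gard c"
  shows "gard (pd i c)"
proof (cases "pd i c = 0")
  case False
  then have c0: "c \<noteq> 0" by auto
  have nn: "nonneg c" using assms by (simp add: gard_def)
  define W where "W = {x. \<exists>u. x + u *\<^sub>R axis i 1 \<in> chamber c}"
  have "chamber (pd i c) \<subseteq> W"
  proof (rule chamber_subset_clopen)
    show "1 \<in> W" using one_in_chamber[OF nn c0] unfolding W_def by (auto intro: exI[of _ 0])
    have "W = (\<Union>u. (\<lambda>x. x + u *\<^sub>R axis i 1) -` chamber c)" by (auto simp: W_def)
    moreover have "open \<dots>"
      by (intro open_UN ballI continuous_open_vimage open_chamber continuous_intros)
    ultimately show "open W" by simp
  next
    fix X x assume X: "\<And>k. X k \<in> W" "X \<longlonglongrightarrow> x" and x: "0 < maeval (pd i c) x"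
    \<comment> \<open>the height over \<open>x\<close> at which \<open>f\<close> takes the value \<open>1\<close>\<close>
    define u where "u = (1 - maeval c x) / maeval (pd i c) x"
    have fu: "maeval c (x + u *\<^sub>R axis i 1) = 1"
      using x by (simp add: maeval_add_axis u_def)
    have l1: "(\<lambda>k. X k + u *\<^sub>R axis i 1) \<longlonglongrightarrow> x + u *\<^sub>R axis i 1" 
      using X(2) by (intro tendsto_intros)
    have "\<forall>\<^sub>F k in sequentially. 0 < maeval c (X k + u *\<^sub>R axis i 1)"
      by (rule order_tendstoD(1)[OF tendsto_maeval[OF tendsto_const l1]]) (simp add: fu)
    moreover have "\<forall>\<^sub>F k in sequentially. 0 < maeval (pd i c) (X k)"
      by (rule order_tendstoD(1)[OF tendsto_maeval[OF tendsto_const X(2)]]) (simp add: x)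
    ultimately have "\<forall>\<^sub>F k in sequentially. X k + u *\<^sub>R axis i 1 \<in> chamber c"
    proof eventually_elim
      case (elim k)
      obtain v where v: "X k + v *\<^sub>R axis i 1 \<in> chamber c" using X(1)[of k] by (auto simp: W_def)
      \<comment> \<open>go up to the larger of the two heights, then down to \<open>u\<close>, keeping \<open>f\<close> positive\<close>
      define w where "w = max u v"
      have w: "X k + w *\<^sub>R axis i 1 \<in> chamber c"
        using chamber_add_axis[OF assms v, of "w - v" i] by (simp add: w_def algebra_simps)
      show ?case
      proof (rule chamber_segment[OF w])
        fix t :: real assume t: "0 \<le> t" "t \<le> 1"
        define s where "s = (1 - t) * w + t * u - u"
        have "s = (1 - t) * (w - u)" by (simp add: s_def algebra_simps)
        then have s: "0 \<le> s" using t by (simp add: w_def)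
        have "X k + w *\<^sub>R axis i 1 + t *\<^sub>R (X k + u *\<^sub>R axis i 1 - (X k + w *\<^sub>R axis i 1)) 
            = (X k + u *\<^sub>R axis i 1) + s *\<^sub>R axis i 1" (is "?l = ?r")
          by (simp add: s_def algebra_simps)
        moreover have "0 < maeval c ?r"
          unfolding maeval_add_axis[of _ "X k + u *\<^sub>R axis i 1"] maeval_pd_add_axis_same
          using elim s by (intro add_pos_nonneg mult_nonneg_nonneg) auto
        ultimately show "0 < maeval c ?l" by (simp only:)
      qed
    qed
    then obtain N where N: "\<And>k. k \<ge> N \<Longrightarrow> X k + u *\<^sub>R axis i 1 \<in> chamber c"
      by (auto simp: eventually_sequentially)
    have "x + u *\<^sub>R axis i 1 \<in> chamber c"
      by (rule chamber_closed_in_pos[of "\<lambda>k. X (k + N) + u *\<^sub>R axis i 1"])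
        (use N fu LIMSEQ_ignore_initial_segment[OF l1, of N] in auto)
    then show "x \<in> W" by (auto simp: W_def)
  qed
  moreover have "0 \<le> maeval (pd j (pd i c)) x" if "x \<in> W" for x j
  proof (rule ccontr)
    assume neg: "\<not> ?thesis"
    obtain u where u: "x + u *\<^sub>R axis i 1 \<in> chamber c" using \<open>x \<in> W\<close> by (auto simp: W_def)
    \<comment> \<open>far out along \<open>e\<^sub>i\<close>, the sign of \<open>\<partial>\<^sub>j f\<close> is that of \<open>\<partial>\<^sub>i \<partial>\<^sub>j f\<close>\<close>
    define p q where "p = maeval (pd j c) (x + u *\<^sub>R axis i 1)" and "q = maeval (pd j (pd i c)) x"
    have "0 \<le> p + s * q" if "0 \<le> s" for s
    proof -
      have "0 \<le> maeval (pd j c) (x + u *\<^sub>R axis i 1 + s *\<^sub>R axis i 1)"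
        using chamber_add_axis[OF assms u that] assms by (simp add: gard_def)
      also have "\<dots> = p + s * q"
        unfolding maeval_add_axis[of _ "x + u *\<^sub>R axis i 1"] p_def q_def pd_commute[of j i c] by simp
      finally show ?thesis .
    qed
    moreover have "0 \<le> (\<bar>p\<bar> + 1) / (- q)"
      using neg by (intro divide_nonneg_pos) (auto simp: q_def)
    moreover have "(\<bar>p\<bar> + 1) / (- q) * q = - (\<bar>p\<bar> + 1)"
      using neg by (auto simp: q_def)
    ultimately have "0 \<le> p - (\<bar>p\<bar> + 1)" by fastforce
    then show False by linarith
  qed
  ultimately show ?thesis using nn by (auto simp: gard_def nonneg_pd)
qed (simp add: gard_def nonneg_def chamber_def)

lemma gard_zero [simp]: "gard 0"
  by (simp add: gard_def nonneg_def)

section \<open>The Rayleigh inequality\<close>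

text \<open>Restrict \<open>f\<close> to the plane through \<open>x\<close> spanned by \<open>e\<^sub>i, e\<^sub>j\<close>: it is
  \<open>d + s b + t e + s t a\<close>.  If \<open>d a > b e\<close>, then \<open>f\<close> stays positive on the path that first goes down to
  \<open>t = - b / a\<close> and from there, where \<open>f\<close> does not depend on \<open>s\<close>, down to \<open>s = - e / a - 1\<close>.  The path
  stays in the component but ends at a point where \<open>\<partial>\<^sub>j f = - a < 0\<close>.\<close>

lemma rayleigh_on_chamber:
  assumes "gard c" "x \<in> chamber c" "i \<noteq> j"
  shows "maeval c x * maeval (pd i (pd j c)) x \<le> maeval (pd i c) x * maeval (pd j c) x"
proof (rule ccontr)
  define d b e a where "d = maeval c x" and "b = maeval (pd i c) x" 
    and "e = maeval (pd j c) x" and "a = maeval (pd i (pd j c)) x"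
  assume "\<not> ?thesis"
  then have viol: "b * e < d * a" by (simp add: d_def b_def e_def a_def)
  have "0 \<le> b" "0 \<le> e" "0 < d"
    using assms by (auto simp: gard_def chamber_pos b_def e_def d_def)
  moreover from this have "0 \<le> b * e" by simp
  with viol have "0 < d * a" by linarith
  ultimately have a: "0 < a" by (simp add: zero_less_mult_iff)
  have bea: "b * e / a < d" using viol a by (simp add: field_simps)
  have f: "maeval c (x + s *\<^sub>R axis i 1 + t *\<^sub>R axis j 1) = d + s * b + t * e + s * t * a" for s t
    unfolding maeval_add_two_axes by (simp add: d_def b_def e_def a_def)
  \<comment> \<open>the corner of the path\<close>
  define y where "y = x + 0 *\<^sub>R axis i 1 + (- b / a) *\<^sub>R axis j 1"
  have "y \<in> chamber c"
  proof (rule chamber_segment[OF assms(2)])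
    fix u :: real assume u: "0 \<le> u" "u \<le> 1"
    have "u * (b * e / a) \<le> 1 * (b * e / a)"
      using u a \<open>0 \<le> b * e\<close> by (intro mult_right_mono) auto
    then have "0 < maeval c (x + 0 *\<^sub>R axis i 1 + (u * (- b / a)) *\<^sub>R axis j 1)"
      unfolding f using bea by (simp add: mult.commute mult.left_commute)
    then show "0 < maeval c (x + u *\<^sub>R (y - x))" by (simp add: y_def)
  qed
  moreover have "0 < maeval c (y + u *\<^sub>R (y + (- e / a - 1) *\<^sub>R axis i 1 - y))" for u
  proof -
    have "maeval c (y + u *\<^sub>R (y + (- e / a - 1) *\<^sub>R axis i 1 - y)) =
        maeval c (x + (u * (- e / a - 1)) *\<^sub>R axis i 1 + (- b / a) *\<^sub>R axis j 1)"
      by (rule arg_cong[where f = "maeval c"]) (simp add: y_def algebra_simps)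
    also have "\<dots> = d - b * e / a" unfolding f using a by (simp add: field_simps)
    finally show ?thesis using bea by simp
  qed
  ultimately have "y + (- e / a - 1) *\<^sub>R axis i 1 \<in> chamber c"
    by (rule chamber_segment)
  then have "0 \<le> maeval (pd j c) (y + (- e / a - 1) *\<^sub>R axis i 1)"
    using assms(1) by (simp add: gard_def)
  also have "y + (- e / a - 1) *\<^sub>R axis i 1 = x + (- e / a - 1) *\<^sub>R axis i 1 + (- b / a) *\<^sub>R axis j 1"
    by (simp add: y_def algebra_simps)
  also have "maeval (pd j c) \<dots> = e + (- e / a - 1) * a"
    unfolding maeval_add_two_axes by (simp add: e_def a_def)
  also have "\<dots> = - a" using a by (simp add: field_simps)
  finally show False using a by simp
qed

lemma rayleigh_closed_orthant:
  assumes "gard c" "\<And>k. 0 \<le> x $ k" "i \<noteq> j"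
  shows "maeval c x * maeval (pd i (pd j c)) x \<le> maeval (pd i c) x * maeval (pd j c) x"
proof (cases "c = 0")
  case False
  have X: "(\<lambda>n. x + (1 / real (Suc n)) *\<^sub>R 1) \<longlonglongrightarrow> x + 0 *\<^sub>R 1"
    by (intro tendsto_intros LIMSEQ_Suc lim_1_over_n)
  have pt: "x + (1 / real (Suc n)) *\<^sub>R 1 \<in> chamber c" for n
    using assms False gard_nonneg[OF assms(1)]
    by (intro nonneg_point_in_chamber maeval_pos) (auto simp: add_nonneg_pos)
  have "maeval c (x + 0 *\<^sub>R 1) * maeval (pd i (pd j c)) (x + 0 *\<^sub>R 1)
      \<le> maeval (pd i c) (x + 0 *\<^sub>R 1) * maeval (pd j c) (x + 0 *\<^sub>R 1)"
    using rayleigh_on_chamber[OF assms(1) pt assms(3)]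
    by (intro LIMSEQ_le[OF tendsto_mult[OF tendsto_maeval[OF tendsto_const X] tendsto_maeval[OF tendsto_const X]]
          tendsto_mult[OF tendsto_maeval[OF tendsto_const X] tendsto_maeval[OF tendsto_const X]]]) auto
  then show ?thesis by simp
qed simp

section \<open>Closedness of the class under limits\<close>

text \<open>A point of the component of the limit is joined to the all-ones vector by a path along which the
  limit polynomial is positive; by compactness the approximants eventually are positive along it as
  well.  The set \<open>W\<close> below expresses this locally, without paths: a ball around the point eventually lies
  in the components of the approximants.\<close>

lemma gard_limit:
  assumes C: "\<And>k. gard (C k)" "C \<longlonglongrightarrow> c"
  shows "gard c"
proof (cases "c = 0")
  case False
  have nn: "nonneg c"
    unfolding nonneg_def
  proof
    fix S show "0 \<le> c $ S"
      using C(1) by (intro LIMSEQ_le_const[OF tendsto_vec_nth[OF C(2), of S]])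
        (auto simp: gard_def nonneg_def)
  qed
  have ne: "\<forall>\<^sub>F k in sequentially. C k \<noteq> 0"
    using C(2) False by (rule tendsto_imp_eventually_ne)
  define W where "W = {x. \<exists>r>0. \<forall>\<^sub>F k in sequentially. ball x r \<subseteq> chamber (C k)}"
  have sub: "chamber c \<subseteq> W"
  proof (rule chamber_subset_clopen)
    have "\<forall>\<^sub>F k in sequentially. ball 1 1 \<subseteq> chamber (C k)"
      using ne
    proof eventually_elim
      case (elim k)
      have "0 < y $ i" if "y \<in> ball 1 1" for y :: "real^'a" and i
        using that component_le_norm_cart[of "1 - y" i] by (auto simp: dist_norm)
      then show ?case
        using C(1)[of k] elim
        by (auto intro!: nonneg_point_in_chamber maeval_pos simp: gard_def less_imp_le)
    qed
    then show "1 \<in> W" by (auto simp: W_def intro: exI[of _ 1])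
  next
    show "open W"
      unfolding open_contains_ball
    proof
      fix x assume "x \<in> W"
      then obtain r where r: "r > 0" "\<forall>\<^sub>F k in sequentially. ball x r \<subseteq> chamber (C k)"
        by (auto simp: W_def)
      have "y \<in> W" if "y \<in> ball x (r/2)" for y
      proof -
        have sub: "ball y (r/2) \<subseteq> ball x r"
        proof
          fix w assume "w \<in> ball y (r/2)"
          then show "w \<in> ball x r" using that dist_triangle[of x w y] by simp
        qed
        have "\<forall>\<^sub>F k in sequentially. ball y (r/2) \<subseteq> chamber (C k)"
          using r(2) by eventually_elim (use sub in blast)
        then show ?thesis using r(1) unfolding W_def by (auto intro!: exI[of _ "r/2"])
      qed
      then show "\<exists>e>0. ball x e \<subseteq> W" using r(1) by (intro exI[of _ "r/2"]) auto
    qed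
  next
    fix X x assume X: "\<And>k. X k \<in> W" "X \<longlonglongrightarrow> x" and x: "0 < maeval c x"
    have op: "open {p. 0 < maeval (fst p) (snd p)}"
      by (intro open_Collect_less continuous_intros)
    have mem: "(c, x) \<in> {p. 0 < maeval (fst p) (snd p)}" using x by simp
    obtain A B where AB: "open A" "open B" "c \<in> A" "x \<in> B" "A \<times> B \<subseteq> {p. 0 < maeval (fst p) (snd p)}"
      by (rule open_prod_elim[OF op mem]) auto
    obtain r where r: "r > 0" "ball x r \<subseteq> B" using AB open_contains_ball by blast
    obtain m where m: "X m \<in> ball x r"
      using X(2) r(1) by (auto simp: lim_sequentially dist_commute)
    obtain s where s: "s > 0" "\<forall>\<^sub>F k in sequentially. ball (X m) s \<subseteq> chamber (C k)"
      using X(1)[of m] by (auto simp: W_def)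
    have "\<forall>\<^sub>F k in sequentially. C k \<in> A"
      using C(2) AB(1,3) by (rule topological_tendstoD)
    with s(2) have "\<forall>\<^sub>F k in sequentially. ball x r \<subseteq> chamber (C k)"
    proof eventually_elim
      case (elim k)
      show ?case
        by (rule chamber_connected[of "X m"]) (use elim m s AB r in \<open>auto 4 4\<close>)
    qed
    then show "x \<in> W" using r(1) by (auto simp: W_def)
  qed
  have "0 \<le> maeval (pd i c) x" if xc: "x \<in> chamber c" for x i
  proof -
    obtain r where r: "r > 0" "\<forall>\<^sub>F k in sequentially. ball x r \<subseteq> chamber (C k)"
      using sub xc by (auto simp: W_def)
    have "\<forall>\<^sub>F k in sequentially. 0 \<le> maeval (pd i (C k)) x"
      using r(2) by eventually_elim (use C(1) r(1) in \<open>auto simp: gard_def subset_iff\<close>)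
    then show ?thesis
      by (intro tendsto_lowerbound[OF tendsto_maeval[OF tendsto_pd[OF C(2)] tendsto_const]]) auto
  qed
  with nn show ?thesis by (simp add: gard_def)
qed simp

section \<open>Symmetrizing two variables\<close>

definition swap_vars :: "'n::finite \<Rightarrow> 'n \<Rightarrow> real^('n set) \<Rightarrow> real^('n set)" where
  "swap_vars i j c = (\<chi> S. c $ (Transposition.transpose i j ` S))"

definition sym2 :: "'n::finite \<Rightarrow> 'n \<Rightarrow> real^('n set) \<Rightarrow> real^('n set)" where
  "sym2 i j c = (1/2) *\<^sub>R (c + swap_vars i j c)"

lemma maeval_swap_vars: "maeval (swap_vars i j c) x = maeval c (\<chi> k. x $ Transposition.transpose i j k)"
proof -
  have "maeval (swap_vars i j c) x = (\<Sum>S\<in>UNIV. c $ S * (\<Prod>k\<in>Transposition.transpose i j ` S. x $ k))"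
    unfolding maeval_def swap_vars_def
    by (rule sum.reindex_bij_witness[of _ "image (Transposition.transpose i j)" "image (Transposition.transpose i j)"])
      (auto simp: image_image)
  also have "\<dots> = maeval c (\<chi> k. x $ Transposition.transpose i j k)"
    unfolding maeval_def by (simp add: prod.reindex)
  finally show ?thesis .
qed

lemma pd_swap_vars: "l \<noteq> i \<Longrightarrow> l \<noteq> j \<Longrightarrow> pd l (swap_vars i j c) = swap_vars i j (pd l c)"
  by (auto simp: pd_def swap_vars_def vec_eq_iff Transposition.transpose_def)

lemma pd_sym2: "l \<noteq> i \<Longrightarrow> l \<noteq> j \<Longrightarrow> pd l (sym2 i j c) = sym2 i j (pd l c)"
  by (simp add: sym2_def pd_add pd_scaleR pd_swap_vars)

lemma pd_pd_pd_same [simp]: "pd i (pd j (pd i c)) = 0"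
  by (subst pd_commute) simp

definition diagpt :: "'n::finite \<Rightarrow> 'n \<Rightarrow> real^'n \<Rightarrow> real \<Rightarrow> real^'n" where
  "diagpt i j x t = (\<chi> k. if k = i \<or> k = j then t else x $ k)"

lemma diagpt_nth: "diagpt i j x t $ k = (if k = i \<or> k = j then t else x $ k)"
  by (simp add: diagpt_def)

lemma diagpt_expand:
  assumes "i \<noteq> j"
  shows "x = diagpt i j x 0 + x $ i *\<^sub>R axis i 1 + x $ j *\<^sub>R axis j 1"
    and "diagpt i j x t = diagpt i j x 0 + t *\<^sub>R axis i 1 + t *\<^sub>R axis j 1"
  using assms by (auto simp: vec_eq_iff diagpt_nth axis_def)

lemma maeval_swap_vars_pt:
  assumes "i \<noteq> j"
  shows "maeval (swap_vars i j c) (diagpt i j x 0 + u *\<^sub>R axis i 1 + v *\<^sub>R axis j 1)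
       = maeval c (diagpt i j x 0 + v *\<^sub>R axis i 1 + u *\<^sub>R axis j 1)"
  unfolding maeval_swap_vars using assms
  by (intro arg_cong[where f = "maeval c"]) (auto simp: vec_eq_iff diagpt_nth axis_def Transposition.transpose_def)

text \<open>With the other coordinates held at \<open>z\<close>, symmetrizing in \<open>x\<^sub>i, x\<^sub>j\<close> averages the two linear coefficients
  and keeps the constant and the mixed one.  In particular it does not change values on the diagonal
  \<open>x\<^sub>i = x\<^sub>j\<close>.\<close>

lemma maeval_sym2:
  fixes x :: "real^'n::finite"
  assumes "i \<noteq> j"
  defines "z \<equiv> diagpt i j x 0"
  shows "maeval (sym2 i j c) x = maeval c z
    + (maeval (pd i c) z + maeval (pd j c) z) / 2 * (x $ i + x $ j)
    + x $ i * x $ j * maeval (pd i (pd j c)) z"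
proof -
  have "maeval (sym2 i j c) x = maeval (sym2 i j c) (z + x $ i *\<^sub>R axis i 1 + x $ j *\<^sub>R axis j 1)"
    using diagpt_expand(1)[OF assms(1), of x] by (simp add: z_def)
  also have "\<dots> = (maeval c (z + x $ i *\<^sub>R axis i 1 + x $ j *\<^sub>R axis j 1)
                 + maeval c (z + x $ j *\<^sub>R axis i 1 + x $ i *\<^sub>R axis j 1)) / 2"
    unfolding sym2_def maeval_scaleR maeval_add z_def maeval_swap_vars_pt[OF assms(1)] by simp
  also have "\<dots> = maeval c z
    + (maeval (pd i c) z + maeval (pd j c) z) / 2 * (x $ i + x $ j)
    + x $ i * x $ j * maeval (pd i (pd j c)) z"
    unfolding maeval_add_two_axes by (simp add: algebra_simps add_divide_distrib)
  finally show ?thesis .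
qed

lemma maeval_diagpt:
  fixes x :: "real^'n::finite"
  assumes "i \<noteq> j"
  defines "z \<equiv> diagpt i j x 0"
  shows "maeval c (diagpt i j x t) = maeval c z
    + t * (maeval (pd i c) z + maeval (pd j c) z) + t\<^sup>2 * maeval (pd i (pd j c)) z"
    and "maeval (pd i c) (diagpt i j x t) = maeval (pd i c) z + t * maeval (pd i (pd j c)) z"
    and "maeval (pd j c) (diagpt i j x t) = maeval (pd j c) z + t * maeval (pd i (pd j c)) z"
    and "maeval (pd i (pd j c)) (diagpt i j x t) = maeval (pd i (pd j c)) z"
  unfolding z_def diagpt_expand(2)[OF assms(1), of x t] maeval_add_two_axes
  by (simp_all add: algebra_simps power2_eq_square pd_commute[of j i c])

lemma maeval_sym2_diag:
  assumes "i \<noteq> j" "x $ i = t" "x $ j = t"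
  shows "maeval (sym2 i j c) x = maeval c x"
proof -
  have "diagpt i j x t = x" using assms by (auto simp: vec_eq_iff diagpt_nth)
  with maeval_diagpt(1)[OF assms(1), of c x t] maeval_sym2[OF assms(1), of c x] assms show ?thesis
    by (simp add: power2_eq_square)
qed

lemma nonneg_sym2: "nonneg c \<Longrightarrow> nonneg (sym2 i j c)"
  by (simp add: nonneg_def sym2_def swap_vars_def)

lemma sym2_trivial:
  assumes "pd i c = 0" "pd j c = 0"
  shows "sym2 i j c = c"
proof -
  have z: "c $ S = 0" if "i \<in> S \<or> j \<in> S" for S
  proof -
    have "pd i c $ (S - {i}) = 0" "pd j c $ (S - {j}) = 0" using assms by simp_all
    then show ?thesis using that by (auto simp: pd_def insert_absorb)
  qed
  have "c $ (Transposition.transpose i j ` S) = c $ S" for S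
  proof (cases "i \<in> S \<or> j \<in> S")
    case True
    then have "i \<in> Transposition.transpose i j ` S \<or> j \<in> Transposition.transpose i j ` S"
      by (auto simp: image_iff Transposition.transpose_def)
    then show ?thesis using z True by metis
  next
    case False
    then have "Transposition.transpose i j ` S = S" by (auto simp: image_iff Transposition.transpose_def)
    then show ?thesis by simp
  qed
  then show ?thesis by (simp add: sym2_def swap_vars_def vec_eq_iff)
qed

lemma pd2_nonneg_on_chamber:
  assumes "gard c" "x \<in> chamber c"
  shows "0 \<le> maeval (pd i (pd j c)) x"
proof (cases "pd j c = 0")
  case False
  then show ?thesis
    using chamber_subset_chamber_pd[OF assms(1) False] gard_pd[OF assms(1), of j] assms(2)
    by (auto simp: gard_def)
qed simp

lemma pd2_pos_on_chamber:
  assumes "gard c" "x \<in> chamber c" "pd i (pd j c) \<noteq> 0"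
  shows "0 < maeval (pd i (pd j c)) x"
proof -
  have "pd j c \<noteq> 0" using assms(3) by auto
  then show ?thesis
    using pd_pos_on_chamber[OF gard_pd[OF assms(1)] assms(3)]
      chamber_subset_chamber_pd[OF assms(1)] assms(2) by blast
qed

text \<open>Here \<open>u v = q\<close> and \<open>(u + v) / 2 = m\<close> for a point \<open>(u, v)\<close> at which the symmetric bilinear form
  \<open>a u v + e (u + v)\<close> takes the value that it has at the diagonal point \<open>(t, t)\<close>.  A second form, with
  coefficients \<open>a'\<close> and \<open>e'\<close>, is then at least as large at \<open>(u, v)\<close> as at \<open>(t, t)\<close>.\<close>

lemma sym_bilinear_compare:
  fixes a e q m t a' e' :: real
  assumes "a * (q - t\<^sup>2) + 2 * e * (m - t) = 0" "t \<le> m" "0 < a" "a' * e \<le> a * e'"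
  shows "0 \<le> a' * (q - t\<^sup>2) + 2 * e' * (m - t)"
proof -
  have "a * (a' * (q - t\<^sup>2) + 2 * e' * (m - t)) = a' * (a * (q - t\<^sup>2)) + 2 * (a * e') * (m - t)"
    by (simp add: algebra_simps)
  also have "a * (q - t\<^sup>2) = - (2 * e * (m - t))" using assms(1) by simp
  also have "a' * - (2 * e * (m - t)) + 2 * (a * e') * (m - t) = 2 * (m - t) * (a * e' - a' * e)"
    by (simp add: algebra_simps)
  finally have "0 \<le> a * (a' * (q - t\<^sup>2) + 2 * e' * (m - t))"
    using assms by simp
  then show ?thesis using assms(3) by (simp add: zero_le_mult_iff)
qed

text \<open>In the same situation \<open>(a u + e) (a v + e) = (a t + e)\<^sup>2 > 0\<close>, and the sum of the two factors is
  positive as well, so both factors are positive.\<close>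

lemma sym_bilinear_factor_pos:
  fixes a e u v t :: real
  assumes "a * (u * v - t\<^sup>2) + 2 * e * ((u + v) / 2 - t) = 0" "t \<le> (u + v) / 2" "0 \<le> a" "0 < a * t + e"
  shows "0 < a * u + e"
proof (rule ccontr)
  assume neg: "\<not> ?thesis"
  have "(a * u + e) * (a * v + e) = (a * t + e)\<^sup>2 + a * (a * (u * v - t\<^sup>2) + 2 * e * ((u + v) / 2 - t))"
    by (simp add: algebra_simps power2_eq_square)
  then have "0 < (a * u + e) * (a * v + e)" using assms(1,4) by simp
  with neg have "a * v + e < 0" by (auto simp: zero_less_mult_iff)
  moreover have "a * t \<le> a * ((u + v) / 2)" using assms by (intro mult_left_mono) auto
  ultimately show False using neg assms(4) by (simp add: algebra_simps)
qed

lemma tendsto_diagpt [tendsto_intros]: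
  assumes "(f \<longlongrightarrow> x) F" "(g \<longlongrightarrow> t) F"
  shows "((\<lambda>k. diagpt i j (f k) (g k)) \<longlongrightarrow> diagpt i j x t) F"
  unfolding diagpt_def using assms by (intro vec_tendstoI) (auto intro!: tendsto_intros)

text \<open>A substitute for the coincidence theorem of Grace, Walsh and Szego.  A point \<open>x\<close> of the component of
  the symmetrized polynomial \<open>fs\<close> is matched with a point \<open>D x t\<close> that has equal \<open>i\<close>-th and \<open>j\<close>-th coordinates
  \<open>t \<le> (x\<^sub>i + x\<^sub>j) / 2\<close>, lies in the component of \<open>f\<close>, and satisfies \<open>f (D x t) = fs x\<close>.  Such points \<open>x\<close> form
  a set that is open and relatively closed where \<open>fs > 0\<close>: the matching \<open>t\<close> is bounded above by the mean of
  the two coordinates, and below because \<open>f\<close> would otherwise be positive on whole lines in directions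
  \<open>e\<^sub>i\<close> and \<open>e\<^sub>j\<close>.  For the other indices \<open>l\<close>, the Rayleigh inequalities of \<open>\<partial>\<^sub>i f\<close> and \<open>\<partial>\<^sub>j f\<close> give
  \<open>\<partial>\<^sub>l fs x \<ge> \<partial>\<^sub>l f (D x t) \<ge> 0\<close>.\<close>

lemma gard_sym2:
  fixes c :: "real^('n::finite set)"
  assumes "gard c" "i \<noteq> j"
  shows "gard (sym2 i j c)"
proof (cases "pd i c = 0 \<and> pd j c = 0")
  case True
  then show ?thesis using assms(1) by (simp add: sym2_trivial)
next
  case False
  then have c0: "c \<noteq> 0" by auto
  note nn = gard_nonneg[OF assms(1)]
  define D where "D = diagpt i j"
  define a where "a l x = maeval (pd i (pd j l)) (D x 0)" for l and x :: "real^'n"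
  define b where "b l x = maeval (pd i l) (D x 0) + maeval (pd j l) (D x 0)" for l x
  define m where "m x = (x $ i + x $ j) / 2" for x :: "real^'n"
  define fs where "fs = maeval (sym2 i j c)"
  have sym: "maeval (sym2 i j l) x = maeval l (D x t) + 
      (a l x * (x $ i * x $ j - t\<^sup>2) + b l x * (m x - t))" for l x t
    unfolding maeval_sym2[OF assms(2)] D_def maeval_diagpt(1)[OF assms(2), of _ x t] a_def b_def m_def
    by (simp add: algebra_simps add_divide_distrib)
  have D_le: "D x s $ k \<le> D y t $ k" if "\<And>k. x $ k \<le> y $ k" "s \<le> t" for x y s t k
    using that by (simp add: D_def diagpt_nth)
  have up: "D x t \<in> chamber c" if "D x s \<in> chamber c" "s \<le> t" for x s t
    using chamber_up[OF assms(1) that(1)] D_le[OF _ that(2)] by blast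
  have a_nn: "0 \<le> a c x" if "D x t \<in> chamber c" for x t
    using pd2_nonneg_on_chamber[OF assms(1) that, of i j] 
    by (simp add: a_def D_def maeval_diagpt(4)[OF assms(2), of c x t])
  have grad_pos: "0 < maeval (pd i c) y + maeval (pd j c) y" if "y \<in> chamber c" for y
    using that False assms(1) pd_pos_on_chamber[OF assms(1) _ that]
    by (auto simp: gard_def intro: add_pos_nonneg add_nonneg_pos)
  have bpos: "0 < b c x + 2 * t * a c x" if "D x t \<in> chamber c" for x t
    using grad_pos[OF that] unfolding D_def maeval_diagpt[OF assms(2), of c x t]
    by (simp add: a_def b_def D_def algebra_simps)
  have diff: "maeval c (D x t) - maeval c (D x s) = (t - s) * (b c x + 2 * s * a c x) + (t - s)\<^sup>2 * a c x" for x s t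
    unfolding D_def maeval_diagpt(1)[OF assms(2), of c x t] maeval_diagpt(1)[OF assms(2), of c x s]
    by (simp add: a_def b_def D_def algebra_simps power2_eq_square)
  have strict: "maeval c (D x s) < maeval c (D x t)" if "D x s \<in> chamber c" "s < t" for x s t
  proof -
    have "0 < (t - s) * (b c x + 2 * s * a c x)" "0 \<le> (t - s)\<^sup>2 * a c x"
      using that bpos[OF that(1)] a_nn[OF that(1)] by auto
    then show ?thesis using diff[of x t s] by linarith
  qed
  have contD: "continuous_on A (\<lambda>t. maeval c (D x t))" for A x
  proof (intro continuous_intros)
    show "continuous_on A (D x)"
      unfolding continuous_on_def D_def by (intro ballI tendsto_diagpt tendsto_const tendsto_ident_at)
  qed
  \<comment> \<open>\<open>x\<^sub>i x\<^sub>j\<close> is at most the square of the mean of \<open>x\<^sub>i\<close> and \<open>x\<^sub>j\<close>\<close>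
  have fs_le: "fs x \<le> maeval c (D x (m x))" if "D x t \<in> chamber c" for x t
  proof -
    have "x $ i * x $ j - (m x)\<^sup>2 = - ((x $ i - x $ j) / 2)\<^sup>2"
      by (simp add: m_def power2_eq_square field_simps)
    also have "\<dots> \<le> 0" by simp
    finally have "a c x * (x $ i * x $ j - (m x)\<^sup>2) \<le> 0" 
      using a_nn[OF that] by (intro mult_nonneg_nonpos) auto
    then show ?thesis using sym[of c x "m x"] by (simp add: fs_def)
  qed
  \<comment> \<open>strict inequalities, so that \<open>W\<close> is visibly open\<close>
  define W where "W = {x. \<exists>t<m x. D x t \<in> chamber c \<and> maeval c (D x t) < fs x}"
  have W_exact: "\<exists>t\<le>m x. D x t \<in> chamber c \<and> maeval c (D x t) = fs x" if xW: "x \<in> W" for x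
  proof -
    obtain t where t: "t < m x" "D x t \<in> chamber c" "maeval c (D x t) < fs x"
      using xW by (auto simp: W_def)
    obtain s where "t \<le> s" "s \<le> m x" "maeval c (D x s) = fs x"
      using IVT'[of "\<lambda>t. maeval c (D x t)" t "fs x" "m x", OF _ fs_le[OF t(2)] _ contD] t by auto
    then show ?thesis using up[OF t(2)] by blast
  qed
  \<comment> \<open>lowering \<open>t\<close> slightly makes the inequalities that define \<open>W\<close> strict\<close>
  have exact_W: "x \<in> W" if "t \<le> m x" "D x t \<in> chamber c" "maeval c (D x t) = fs x" for x t
  proof -
    have "isCont (\<lambda>t. D x t) t"
      unfolding D_def isCont_def by (intro tendsto_intros)
    then have "\<forall>\<^sub>F s in at t. D x s \<in> chamber c"
      using open_chamber that(2) unfolding isCont_def by (rule topological_tendstoD)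
    then have "\<forall>\<^sub>F s in at_left t. D x s \<in> chamber c"
      by (rule filter_leD[OF at_le, rotated]) simp
    moreover have "\<forall>\<^sub>F s in at_left t. s < t" by (simp add: eventually_at_filter)
    ultimately obtain s where "D x s \<in> chamber c" "s < t"
      using eventually_happens'[OF trivial_limit_at_left_real] eventually_conj by blast
    then show ?thesis using strict[of x s t] that unfolding W_def by (auto intro!: exI[of _ s])
  qed
  have "chamber (sym2 i j c) \<subseteq> W"
  proof (rule chamber_subset_clopen)
    have "D 1 1 = 1" by (simp add: D_def diagpt_def vec_eq_iff)
    then show "1 \<in> W"
      using exact_W[of 1 1] one_in_chamber[OF nn c0] maeval_sym2_diag[OF assms(2), of 1 1 c]
      by (simp add: m_def fs_def)
    have "W = (\<Union>t. {x. t < m x} \<inter> (\<lambda>x. D x t) -` chamber c \<inter> {x. maeval c (D x t) < fs x})"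
      by (auto simp: W_def)
    moreover have "open \<dots>"
    proof (intro open_UN ballI open_Int)
      fix t
      have Dc: "continuous_on UNIV (\<lambda>x. D x t)"
        unfolding continuous_on_def D_def by (intro ballI tendsto_diagpt tendsto_const tendsto_ident_at)
      show "open {x. t < m x}" 
        unfolding m_def by (intro open_Collect_less continuous_intros) auto
      show "open ((\<lambda>x. D x t) -` chamber c)"
        using open_chamber Dc by (rule open_vimage)
      show "open {x. maeval c (D x t) < fs x}"
        unfolding fs_def by (intro open_Collect_less continuous_intros Dc)
    qed
    ultimately show "open W" by simp
  next
    fix X x assume X: "\<And>k. X k \<in> W" "X \<longlonglongrightarrow> x" and x: "0 < maeval (sym2 i j c) x"
    obtain T where T: "\<And>k. T k \<le> m (X k)" "\<And>k. D (X k) (T k) \<in> chamber c" 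
        "\<And>k. maeval c (D (X k) (T k)) = fs (X k)"
      using W_exact[OF X(1)] by metis
    obtain R where R: "\<And>k. norm (X k) \<le> R"
      using convergent_imp_bounded[of X] X(2) by (auto simp: bounded_iff convergent_def)
    have XR: "\<bar>X k $ l\<bar> \<le> R" for k l
      using component_le_norm_cart[of "X k" l] R[of k] by linarith
    \<comment> \<open>otherwise \<open>f\<close> is positive on full lines through \<open>Y 0\<close>, so both derivatives vanish there\<close>
    obtain L where L: "\<And>k. L \<le> T k"
    proof (rule ccontr)
      assume "\<not> thesis"
      then have unb: "\<exists>k. T k < L" for L using that by (metis not_le)
      define Y where "Y = D (\<chi> l. R)"
      have Y: "Y t \<in> chamber c" for t
      proof -
        obtain k where "T k < t" using unb by blast
        then show ?thesis
          using chamber_up[OF assms(1) T(2)[of k], of "Y t"] D_le[of "X k" "\<chi> l. R" "T k" t] XR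
          unfolding Y_def by (simp add: abs_le_iff)
      qed
      have line: "Y 0 + s *\<^sub>R axis l 1 \<in> chamber c" if "l = i \<or> l = j" for s l
        by (rule chamber_up[OF assms(1) Y[of "- \<bar>s\<bar>"]])
          (use that in \<open>auto simp: Y_def D_def diagpt_nth axis_def\<close>)
      have "maeval (pd l c) (Y 0) = 0" if "l = i \<or> l = j" for l
      proof (rule ccontr)
        assume ne: "maeval (pd l c) (Y 0) \<noteq> 0"
        have "0 < maeval c (Y 0 + (- maeval c (Y 0) / maeval (pd l c) (Y 0)) *\<^sub>R axis l 1)"
          using line[OF that] by (intro chamber_pos)
        with ne show False unfolding maeval_add_axis by simp
      qed
      then show False using grad_pos[OF Y[of 0]] by simp
    qed
    have "T k \<in> {L..R}" for k
      using T(1)[of k] L[of k] XR[of k i] XR[of k j] by (auto simp: m_def)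
    then obtain t r where r: "strict_mono r" "(T \<circ> r) \<longlonglongrightarrow> t"
      using compact_Icc[of L R] unfolding compact_def by blast
    have Xr: "(\<lambda>k. X (r k)) \<longlonglongrightarrow> x" using LIMSEQ_subseq_LIMSEQ[OF X(2) r(1)] by (simp add: o_def)
    have Tr: "(\<lambda>k. T (r k)) \<longlonglongrightarrow> t" using r(2) by (simp add: o_def)
    have DD: "(\<lambda>k. D (X (r k)) (T (r k))) \<longlonglongrightarrow> D x t"
      unfolding D_def using Xr Tr by (intro tendsto_intros)
    have "(\<lambda>k. maeval c (D (X (r k)) (T (r k)))) \<longlonglongrightarrow> fs x"
      unfolding T(3) fs_def using Xr by (intro tendsto_intros)
    moreover have "(\<lambda>k. maeval c (D (X (r k)) (T (r k)))) \<longlonglongrightarrow> maeval c (D x t)"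
      using DD by (intro tendsto_intros)
    ultimately have val: "maeval c (D x t) = fs x" by (rule LIMSEQ_unique[symmetric])
    have "D x t \<in> chamber c"
      using T(2) DD by (rule chamber_closed_in_pos) (use val x in \<open>simp add: fs_def\<close>)
    moreover have "t \<le> m x"
      by (rule LIMSEQ_le[OF Tr, of "\<lambda>k. m (X (r k))"])
        (use T(1) Xr in \<open>auto simp: m_def intro!: tendsto_intros\<close>)
    ultimately show "x \<in> W" using val by (intro exact_W)
  qed
  moreover have "0 \<le> maeval (pd l (sym2 i j c)) x" if xW: "x \<in> W" for x l
  proof -
    obtain t where t: "t \<le> m x" "D x t \<in> chamber c" "maeval c (D x t) = fs x"
      using W_exact[OF xW] by blast
    have eq: "a c x * (x $ i * x $ j - t\<^sup>2) + b c x * (m x - t) = 0"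
      using sym[of c x t] t(3) by (simp add: fs_def)
    have anz: "0 < a c x" if "pd i (pd j c) \<noteq> 0"
      using pd2_pos_on_chamber[OF assms(1) t(2) that]
      by (simp add: a_def D_def maeval_diagpt(4)[OF assms(2), of c x t])
    consider "l = i" | "l = j" | "l \<noteq> i" "l \<noteq> j" by blast
    then show ?thesis
    proof cases
      case 3
      have "0 \<le> a (pd l c) x * (x $ i * x $ j - t\<^sup>2) + b (pd l c) x * (m x - t)"
      proof (cases "pd i (pd j c) = 0")
        case True
        then have "pd i (pd j (pd l c)) = 0"
          unfolding pd_commute[of j l c] pd_commute[of i l "pd j c"] by simp
        moreover have "m x = t"
          using eq bpos[OF t(2)] True by (simp add: a_def)
        ultimately show ?thesis by (simp add: a_def)
      next
        case False
        have ray: "a (pd l c) x * maeval (pd p c) (D x 0) \<le> a c x * maeval (pd p (pd l c)) (D x 0)"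
          if pq: "(p = i \<and> q = j) \<or> (p = j \<and> q = i)" for p q
        proof -
          have ne: "pd p c \<noteq> 0" using False pq pd_commute[of i j c] by auto
          have lq: "q \<noteq> l" using pq 3 by auto
          have "D x t \<in> chamber (pd p c)"
            using chamber_subset_chamber_pd[OF assms(1) ne] t(2) by blast
          from rayleigh_on_chamber[OF gard_pd[OF assms(1)] this lq]
          have *: "maeval (pd p c) (D x t) * maeval (pd q (pd l (pd p c))) (D x t)
              \<le> maeval (pd q (pd p c)) (D x t) * maeval (pd l (pd p c)) (D x t)" .
          have a1: "maeval (pd q (pd l (pd p c))) (D x t) = a (pd l c) x"
            using pq maeval_diagpt(4)[OF assms(2), of "pd l c" x t]
              pd_commute[of l p c] pd_commute[of i j "pd l c"]
            unfolding a_def D_def by auto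
          have a2: "maeval (pd q (pd p c)) (D x t) = a c x"
            using pq maeval_diagpt(4)[OF assms(2), of c x t] pd_commute[of i j c]
            unfolding a_def D_def by auto
          have b1: "maeval (pd p c) (D x t) = maeval (pd p c) (D x 0) + t * a c x"
            using pq maeval_diagpt(2,3)[OF assms(2), of c x t] unfolding a_def D_def by auto
          have b2: "maeval (pd l (pd p c)) (D x t) = maeval (pd p (pd l c)) (D x 0) + t * a (pd l c) x"
            using pq maeval_diagpt(2,3)[OF assms(2), of "pd l c" x t]
            unfolding a_def D_def pd_commute[of l p c] by auto
          show ?thesis using * unfolding a1 a2 b1 b2 by (simp add: algebra_simps)
        qed
        have "a (pd l c) x * (b c x / 2) \<le> a c x * (b (pd l c) x / 2)"
          using ray[of i j] ray[of j i] by (simp add: b_def algebra_simps)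
        then show ?thesis
          using sym_bilinear_compare[of "a c x" "x $ i * x $ j" t "b c x / 2" "m x" "a (pd l c) x" "b (pd l c) x / 2"]
            eq t(1) anz[OF False] by simp
      qed
      moreover have "0 \<le> maeval (pd l c) (D x t)" using assms(1) t(2) by (simp add: gard_def)
      ultimately show ?thesis using 3 sym[of "pd l c" x t] by (simp add: pd_sym2)
    next
      case 1
      have "0 < a c x * x $ j + b c x / 2"
        by (rule sym_bilinear_factor_pos[of _ _ "x $ i" t])
          (use eq t(1) a_nn[OF t(2)] bpos[OF t(2)] in \<open>auto simp: m_def algebra_simps\<close>)
      moreover have "maeval (pd i (sym2 i j c)) x = a c x * x $ j + b c x / 2"
      proof -
        have "maeval (sym2 i j c) (x + 1 *\<^sub>R axis i 1) - maeval (sym2 i j c) x = a c x * x $ j + b c x / 2"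
        proof -
          have "D (x + 1 *\<^sub>R axis i 1) 0 = D x 0"
            by (auto simp: D_def diagpt_def vec_eq_iff axis_def)
          then show ?thesis using assms(2)
            unfolding sym[of c _ 0] by (simp add: a_def b_def m_def axis_def algebra_simps add_divide_distrib)
        qed
        then show ?thesis unfolding maeval_add_axis by simp
      qed
      ultimately show ?thesis using 1 by simp
    next
      case 2
      have "0 < a c x * x $ i + b c x / 2"
        by (rule sym_bilinear_factor_pos[of _ _ "x $ j" t])
          (use eq t(1) a_nn[OF t(2)] bpos[OF t(2)] in \<open>auto simp: m_def algebra_simps\<close>)
      moreover have "maeval (pd j (sym2 i j c)) x = a c x * x $ i + b c x / 2"
      proof -
        have "maeval (sym2 i j c) (x + 1 *\<^sub>R axis j 1) - maeval (sym2 i j c) x = a c x * x $ i + b c x / 2"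
        proof -
          have "D (x + 1 *\<^sub>R axis j 1) 0 = D x 0"
            by (auto simp: D_def diagpt_def vec_eq_iff axis_def)
          then show ?thesis using assms(2)
            unfolding sym[of c _ 0] by (simp add: a_def b_def m_def axis_def algebra_simps add_divide_distrib)
        qed
        then show ?thesis unfolding maeval_add_axis by simp
      qed
      ultimately show ?thesis using 2 by simp
    qed
  qed
  ultimately show ?thesis
    using nonneg_sym2[OF nn] by (auto simp: gard_def)
qed

section \<open>Translations and scalings of the variables\<close>

text \<open>Since \<open>f\<close> is affine in \<open>x\<^sub>i\<close>, the vector \<open>c + s \<partial>\<^sub>i c\<close> represents the translate \<open>f (x + s e\<^sub>i)\<close>.\<close>

lemma gard_shift_axis:
  assumes "gard c" "0 \<le> s"
  shows "gard (c + s *\<^sub>R pd i c)"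
proof -
  have m: "maeval (c + s *\<^sub>R pd i c) x = maeval c (x + s *\<^sub>R axis i 1)" for x
    by (simp add: maeval_add maeval_scaleR maeval_add_axis)
  have p: "maeval (pd j (c + s *\<^sub>R pd i c)) x = maeval (pd j c) (x + s *\<^sub>R axis i 1)" for x j
    by (simp add: maeval_add maeval_scaleR maeval_add_axis pd_add pd_scaleR pd_commute[of j i])
  have nn: "nonneg (c + s *\<^sub>R pd i c)"
    using gard_nonneg[OF assms(1)] assms(2) by (simp add: nonneg_def pd_def)
  define W where "W = (\<lambda>x. x + s *\<^sub>R axis i 1) -` chamber c"
  have "chamber (c + s *\<^sub>R pd i c) \<subseteq> W" if "c \<noteq> 0"
  proof (rule chamber_subset_clopen)
    show "1 \<in> W"
      using chamber_add_axis[OF assms(1) one_in_chamber[OF gard_nonneg[OF assms(1)] that] assms(2)]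
      by (simp add: W_def)
    show "open W"
      unfolding W_def by (intro open_vimage open_chamber continuous_intros)
  next
    fix X x assume X: "\<And>k. X k \<in> W" "X \<longlonglongrightarrow> x" "0 < maeval (c + s *\<^sub>R pd i c) x"
    have "(\<lambda>k. X k + s *\<^sub>R axis i 1) \<longlonglongrightarrow> x + s *\<^sub>R axis i 1" using X(2) by (intro tendsto_intros)
    then show "x \<in> W"
      using chamber_closed_in_pos[of "\<lambda>k. X k + s *\<^sub>R axis i 1" c] X(1,3) by (simp add: W_def m)
  qed
  then show ?thesis using assms(1) nn p
    by (cases "c = 0") (auto simp: gard_def W_def)
qed

lemma gard_translate:
  assumes "gard c" "\<And>i. 0 \<le> b $ i"
  obtains c' where "gard c'" "\<And>x. maeval c' x = maeval c (x + b)"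
proof -
  have "\<exists>c'. gard c' \<and> (\<forall>x. maeval c' x = maeval c (x + (\<Sum>i\<in>A. b $ i *\<^sub>R axis i 1)))" for A
  proof -
    have "finite A" by simp
    then show ?thesis
    proof (induction A)
      case empty
      show ?case using assms(1) by auto
    next
      case (insert i A)
      then obtain c' where "gard c'" "\<And>x. maeval c' x = maeval c (x + (\<Sum>i\<in>A. b $ i *\<^sub>R axis i 1))"
        by blast
      then have "gard (c' + b $ i *\<^sub>R pd i c')"
        "maeval (c' + b $ i *\<^sub>R pd i c') x = maeval c (x + (\<Sum>i\<in>insert i A. b $ i *\<^sub>R axis i 1))" for x
        using assms(2)[of i] insert.hyps maeval_add_axis[of c' x "b $ i" i]
        by (auto simp: gard_shift_axis maeval_add maeval_scaleR add_ac)
      then show ?case by blast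
    qed
  qed
  from this[of UNIV] show ?thesis
    using that by (auto simp: basis_expansion scalar_mult_eq_scaleR[symmetric])
qed

definition scale_vars :: "real^'n::finite \<Rightarrow> real^('n set) \<Rightarrow> real^('n set)" where
  "scale_vars a c = (\<chi> S. c $ S * (\<Prod>i\<in>S. a $ i))"

lemma maeval_scale_vars: "maeval (scale_vars a c) x = maeval c (\<chi> i. a $ i * x $ i)"
  by (simp add: maeval_def scale_vars_def prod.distrib mult.assoc)

lemma pd_scale_vars: "pd i (scale_vars a c) = a $ i *\<^sub>R scale_vars a (pd i c)"
  by (auto simp: pd_def scale_vars_def vec_eq_iff)

lemma gard_scale_vars_pos:
  assumes "gard c" "\<And>i. 0 < a $ i"
  shows "gard (scale_vars a c)"
proof (cases "c = 0")
  case False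
  have nn: "nonneg (scale_vars a c)"
    using gard_nonneg[OF assms(1)] assms(2)
    by (simp add: nonneg_def scale_vars_def prod_nonneg less_imp_le)
  define W where "W = (\<lambda>x. \<chi> i. a $ i * x $ i) -` chamber c"
  have "chamber (scale_vars a c) \<subseteq> W"
  proof (rule chamber_subset_clopen)
    have "0 < maeval c a" using gard_nonneg[OF assms(1)] False assms(2) by (rule maeval_pos)
    then have "a \<in> chamber c"
      using gard_nonneg[OF assms(1)] assms(2) by (intro nonneg_point_in_chamber) (auto simp: less_imp_le)
    then show "1 \<in> W" by (simp add: W_def)
    show "open W"
      unfolding W_def by (intro open_vimage open_chamber continuous_intros)
  next
    fix X x assume X: "\<And>k. X k \<in> W" "X \<longlonglongrightarrow> x" "0 < maeval (scale_vars a c) x"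
    have "(\<lambda>k. \<chi> i. a $ i * X k $ i) \<longlonglongrightarrow> (\<chi> i. a $ i * x $ i)" 
      using X(2) by (intro vec_tendstoI) (auto intro!: tendsto_intros)
    then show "x \<in> W"
      using chamber_closed_in_pos[of "\<lambda>k. \<chi> i. a $ i * X k $ i" c] X(1,3)
      by (simp add: W_def maeval_scale_vars)
  qed
  then show ?thesis using assms nn
    by (auto simp: gard_def W_def pd_scale_vars maeval_scaleR maeval_scale_vars less_imp_le)
qed (simp add: scale_vars_def zero_vec_def[symmetric])

text \<open>Scalings by positive factors transport the component; zero factors are limits of positive ones.\<close>

lemma gard_scale_vars:
  assumes "gard c" "\<And>i. 0 \<le> a $ i"
  shows "gard (scale_vars a c)"
proof (rule gard_limit)
  let ?a = "\<lambda>n. \<chi> i. a $ i + 1 / real (Suc n)"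
  show "gard (scale_vars (?a n) c)" for n
    using assms by (intro gard_scale_vars_pos) (auto simp: add_nonneg_pos)
  show "(\<lambda>n. scale_vars (?a n) c) \<longlonglongrightarrow> scale_vars a c"
    unfolding scale_vars_def
  proof (intro vec_tendstoI)
    fix S
    have "(\<lambda>n. a $ i + 1 / real (Suc n)) \<longlonglongrightarrow> a $ i + 0" for i
      by (intro tendsto_intros LIMSEQ_Suc lim_1_over_n)
    then have "(\<lambda>n. c $ S * (\<Prod>i\<in>S. a $ i + 1 / real (Suc n))) \<longlonglongrightarrow> c $ S * (\<Prod>i\<in>S. a $ i)"
      by (intro tendsto_mult_left tendsto_prod) simp
    then show "(\<lambda>n. (\<chi> S. c $ S * (\<Prod>i\<in>S. ?a n $ i)) $ S) \<longlonglongrightarrow> (\<chi> S. c $ S * (\<Prod>i\<in>S. a $ i)) $ S"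
      by simp
  qed
qed

section \<open>Full symmetrization\<close>

text \<open>The univariate polynomial \<open>f (t, \<dots>, t)\<close>.\<close>

definition diagp :: "real^('n::finite set) \<Rightarrow> real poly" where
  "diagp c = (\<Sum>S\<in>UNIV. monom (c $ S) (card S))"

lemma poly_diagp: "poly (diagp c) t = maeval c (t *\<^sub>R 1)"
  by (simp add: diagp_def maeval_def poly_sum poly_monom)

lemma diagp_eqI:
  assumes "\<And>t. maeval c (t *\<^sub>R 1) = maeval d (t *\<^sub>R 1)"
  shows "diagp c = diagp d"
proof -
  have "poly (diagp c) = poly (diagp d)" by (rule ext) (simp add: poly_diagp assms)
  then show ?thesis by (simp add: poly_eq_poly_eq_iff)
qed

lemma diagp_swap_vars: "diagp (swap_vars i j c) = diagp c"
  by (rule diagp_eqI) (simp add: maeval_swap_vars scaleR_vec_def one_vec_def)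

lemma pderiv_diagp: "pderiv (diagp c) = (\<Sum>i\<in>UNIV. diagp (pd i c))"
proof -
  have "pderiv (diagp c) = (\<Sum>S\<in>UNIV. monom (real (card S) * c $ S) (card S - 1))"
    by (simp add: diagp_def higher_pderiv_sum[of 1, simplified] pderiv_monom)
  also have "\<dots> = (\<Sum>S\<in>UNIV. \<Sum>i\<in>UNIV. if i \<in> S then monom (c $ S) (card S - 1) else 0)"
    by (intro sum.cong refl) (simp add: sum.If_cases smult_monom[symmetric] of_nat_poly)
  also have "\<dots> = (\<Sum>i\<in>UNIV. \<Sum>S\<in>UNIV. if i \<in> S then monom (c $ S) (card S - 1) else 0)"
    by (rule sum.swap)
  also have "\<dots> = (\<Sum>i\<in>UNIV. diagp (pd i c))"
  proof (intro sum.cong refl)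
    fix i :: 'a
    show "(\<Sum>S\<in>UNIV. if i \<in> S then monom (c $ S) (card S - 1) else 0) = diagp (pd i c)"
      unfolding diagp_def sum_sets_split[of _ i] by (intro sum.cong) (auto simp: pd_def)
  qed
  finally show ?thesis .
qed

lemma norm_swap_vars: "norm (swap_vars i j c) = norm c"
proof -
  have "(\<Sum>S\<in>UNIV. (norm (c $ (Transposition.transpose i j ` S)))\<^sup>2) = (\<Sum>S\<in>UNIV. (norm (c $ S))\<^sup>2)"
    by (rule sum.reindex_bij_witness[of _ "image (Transposition.transpose i j)" "image (Transposition.transpose i j)"])
      (auto simp: image_image)
  then show ?thesis by (simp add: norm_vec_def L2_set_def swap_vars_def)
qed

text \<open>Among all polynomials of the class with the same diagonal, take one whose coefficient vector has
  the least Euclidean norm.  It exists because these vectors form a compact set: they are nonnegative,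
  the sum of their entries is prescribed, and the class is closed under limits.  Averaging with
  a transposed copy stays in the set and strictly decreases the norm unless both copies agree, by the
  parallelogram law.  So the minimizer is symmetric in all variables.\<close>

lemma symmetric_representative:
  fixes c :: "real^('n::finite set)"
  assumes "gard c"
  obtains F :: "real^('n set)" where "gard F" "diagp F = diagp c" "\<And>i j. swap_vars i j F = F"
proof -
  define K :: "(real^('n set)) set" where "K = {v. gard v \<and> (\<forall>t. maeval v (t *\<^sub>R 1) = maeval c (t *\<^sub>R 1))}"
  have "closed K"
    unfolding closed_sequential_limits K_def
  proof safe
    fix X v assume X: "\<forall>n. X n \<in> {v. gard v \<and> (\<forall>t. maeval v (t *\<^sub>R 1) = maeval c (t *\<^sub>R 1))}" "X \<longlonglongrightarrow> v"
    then show "gard v" using gard_limit[of X v] by simp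
    fix t :: real
    have "(\<lambda>n. maeval (X n) (t *\<^sub>R 1)) \<longlonglongrightarrow> maeval v (t *\<^sub>R 1)"
      using X(2) by (intro tendsto_intros)
    then show "maeval v (t *\<^sub>R 1) = maeval c (t *\<^sub>R 1)"
      using X(1) by (simp add: LIMSEQ_const_iff)
  qed
  moreover have "bounded K"
    unfolding bounded_iff
  proof (intro exI ballI)
    fix v assume v: "v \<in> K"
    have "norm v \<le> (\<Sum>S\<in>UNIV. \<bar>v $ S\<bar>)" by (rule norm_le_l1_cart)
    also have "\<dots> = maeval v (1 *\<^sub>R 1)"
    proof -
      have "nonneg v" using v by (simp add: K_def gard_nonneg)
      then show ?thesis by (simp add: nonneg_def maeval_def)
    qed
    also have "\<dots> = maeval c (1 *\<^sub>R 1)" using v unfolding K_def by blast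
    finally show "norm v \<le> maeval c (1 *\<^sub>R 1)" .
  qed
  ultimately have "compact K" by (simp add: compact_eq_bounded_closed)
  moreover have "c \<in> K" using assms by (simp add: K_def)
  ultimately obtain F where F: "F \<in> K" "\<And>v. v \<in> K \<Longrightarrow> norm F \<le> norm v"
    using continuous_attains_inf[of K norm, OF _ _ continuous_on_norm_id] by (metis empty_iff)
  have "swap_vars i j F = F" for i j
  proof (cases "i = j")
    case True
    then show ?thesis by (simp add: swap_vars_def)
  next
    case False
    have "maeval (sym2 i j F) (t *\<^sub>R 1) = maeval F (t *\<^sub>R 1)" for t
      using False by (intro maeval_sym2_diag[of i j _ t]) auto
    then have "sym2 i j F \<in> K" using F(1) False by (simp add: K_def gard_sym2)
    then have "norm F \<le> norm (sym2 i j F)" by (rule F(2))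
    also have "\<dots> = norm (F + swap_vars i j F) / 2" by (simp add: sym2_def)
    finally have "2 * norm F \<le> norm (F + swap_vars i j F)" by simp
    from power_mono[OF this, of 2] have "4 * (norm F)\<^sup>2 \<le> (norm (F + swap_vars i j F))\<^sup>2"
      by (simp add: power_mult_distrib)
    moreover have "(norm (F + swap_vars i j F))\<^sup>2 + (norm (F - swap_vars i j F))\<^sup>2
        = 2 * (norm F)\<^sup>2 + 2 * (norm (swap_vars i j F))\<^sup>2"
      unfolding power2_norm_eq_inner
      by (simp only: inner_add_left inner_add_right inner_diff_left inner_diff_right)
    ultimately have "(norm (F - swap_vars i j F))\<^sup>2 \<le> 0"
      unfolding norm_swap_vars by linarith
    then show ?thesis by simp
  qed
  then show ?thesis using F(1) by (intro that[of F]) (auto simp: K_def intro: diagp_eqI)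
qed

text \<open>The iterated partial derivative in all variables of \<open>P\<close>.\<close>

definition pds :: "'n::finite set \<Rightarrow> real^('n set) \<Rightarrow> real^('n set)" where
  "pds P c = (\<chi> S. if S \<inter> P = {} then c $ (P \<union> S) else 0)"

lemma pds_empty [simp]: "pds {} c = c"
  by (simp add: pds_def)

lemma pds_insert: "i \<notin> P \<Longrightarrow> pds (insert i P) c = pd i (pds P c)"
  by (auto simp: pds_def pd_def vec_eq_iff)

lemma pd_pds_mem: "i \<in> P \<Longrightarrow> pd i (pds P c) = 0"
  by (auto simp: pds_def pd_def vec_eq_iff)

lemma gard_pds: "gard c \<Longrightarrow> gard (pds P c)"
proof -
  assume c: "gard c"
  have "finite P" by simp
  then show ?thesis by (induction P) (use c in \<open>auto simp: pds_insert gard_pd\<close>)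
qed

lemma swap_vars_pds:
  assumes "i \<notin> P" "j \<notin> P"
  shows "swap_vars i j (pds P c) = pds P (swap_vars i j c)"
proof -
  have inv: "Transposition.transpose i j ` P = P"
    using assms by (auto simp: image_iff Transposition.transpose_def)
  have "Transposition.transpose i j ` S \<inter> P = {} \<longleftrightarrow> S \<inter> P = {}" for S
  proof -
    have "Transposition.transpose i j ` S \<inter> P = Transposition.transpose i j ` (S \<inter> P)"
      using inv by (simp add: image_Int)
    then show ?thesis by simp
  qed
  then show ?thesis
    by (auto simp: swap_vars_def pds_def vec_eq_iff image_Un inv)
qed

lemma pd_eq_swap_vars:
  assumes "swap_vars i j c = c"
  shows "pd j c = swap_vars i j (pd i c)"
proof -
  have *: "c $ (Transposition.transpose i j ` S) = c $ S" for S
    using assms by (simp add: swap_vars_def vec_eq_iff)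
  have "i \<in> Transposition.transpose i j ` S \<longleftrightarrow> j \<in> S" for S
    by (auto simp: image_iff Transposition.transpose_def)
  moreover have "insert i (Transposition.transpose i j ` S) = Transposition.transpose i j ` insert j S" for S
    by simp
  ultimately show ?thesis
    by (simp add: pd_def swap_vars_def vec_eq_iff * del: image_insert)
qed

text \<open>By symmetry all nonzero partial derivatives agree on the diagonal, so the derivative of the diagonal
  polynomial is a multiple of the diagonal of a single partial derivative, and no sums of different
  polynomials of the class appear.\<close>

lemma pderiv_diagp_symmetric:
  fixes F :: "real^('n::finite set)"
  assumes "\<And>i j. swap_vars i j F = F" "i \<notin> P"
  shows "pderiv (diagp (pds P F)) = smult (real (card (- P))) (diagp (pd i (pds P F)))"
proof -
  have "pderiv (diagp (pds P F)) = (\<Sum>l\<in>UNIV. if l \<in> P then 0 else diagp (pd i (pds P F)))"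
    unfolding pderiv_diagp
  proof (intro sum.cong refl)
    fix l
    show "diagp (pd l (pds P F)) = (if l \<in> P then 0 else diagp (pd i (pds P F)))"
    proof (cases "l \<in> P")
      case True
      then show ?thesis by (simp add: pd_pds_mem diagp_def)
    next
      case False
      then have "swap_vars i l (pds P F) = pds P F" using assms by (simp add: swap_vars_pds)
      then show ?thesis using pd_eq_swap_vars[of i l "pds P F"] False by (simp add: diagp_swap_vars)
    qed
  qed
  also have "\<dots> = smult (real (card (- P))) (diagp (pd i (pds P F)))"
    by (simp add: sum.If_cases of_nat_poly Compl_eq)
  finally show ?thesis .
qed

section \<open>A Newton inequality on the diagonal\<close>

text \<open>The function \<open>v = (m - 1) / m * h'\<^sup>2 / h''\<close> satisfies \<open>v' \<ge> h'\<close>: this is what the inequality assumed for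
  \<open>h'\<close> and \<open>m - 1\<close> says.  Hence \<open>v - h\<close> is nondecreasing to the right of the root \<open>r\<close>; it is at least \<open>- h\<close>, which tends
  to \<open>0\<close> at \<open>r\<close>.  So \<open>v \<ge> h\<close>, which is the inequality for \<open>h\<close> and \<open>m\<close>.\<close>

lemma newton_inequality_from_derivative:
  fixes h :: "real poly" and m :: real
  assumes m: "2 \<le> m" and root: "poly h r = 0"
    and pos: "\<And>t. r < t \<Longrightarrow> 0 < poly (pderiv h) t" "\<And>t. r < t \<Longrightarrow> 0 < poly (pderiv (pderiv h)) t"
    and ineq: "\<And>t. r < t \<Longrightarrow> (m - 1) * (poly (pderiv h) t * poly (pderiv (pderiv (pderiv h))) t)
        \<le> (m - 2) * (poly (pderiv (pderiv h)) t)\<^sup>2"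
    and t: "r < t"
  shows "m * (poly h t * poly (pderiv (pderiv h)) t) \<le> (m - 1) * (poly (pderiv h) t)\<^sup>2"
proof -
  define h0 h1 h2 h3 where "h0 = poly h" and "h1 = poly (pderiv h)" 
    and "h2 = poly (pderiv (pderiv h))" and "h3 = poly (pderiv (pderiv (pderiv h)))"
  note hs = h0_def h1_def h2_def h3_def
  define u where "u s = (m - 1) / m * ((h1 s)\<^sup>2 / h2 s) - h0 s" for s
  have du: "\<exists>y. (u has_real_derivative y) (at s) \<and> 0 \<le> y" if s: "r < s" for s
  proof (intro exI conjI)
    have p: "0 < h1 s" "0 < h2 s" using pos s by (auto simp: hs)
    have i: "(m - 1) * (h1 s * h3 s) \<le> (m - 2) * (h2 s)\<^sup>2" using ineq[OF s] by (simp add: hs)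
    show "(u has_real_derivative (m - 1) / m * ((2 * h1 s * h2 s * h2 s - (h1 s)\<^sup>2 * h3 s) / (h2 s)\<^sup>2) - h1 s) (at s)"
    proof -
      have d0: "(h0 has_real_derivative h1 s) (at s)" and d1: "(h1 has_real_derivative h2 s) (at s)"
        and d2: "(h2 has_real_derivative h3 s) (at s)"
        unfolding hs by (rule poly_DERIV)+
      have "((\<lambda>s. (h1 s)\<^sup>2 / h2 s) has_real_derivative
          (2 * h1 s * h2 s * h2 s - (h1 s)\<^sup>2 * h3 s) / (h2 s)\<^sup>2) (at s)"
        using p(2) by (auto intro!: derivative_eq_intros d1 d2 simp: power2_eq_square)
      then show ?thesis
        unfolding u_def by (intro DERIV_diff DERIV_cmult d0)
    qed
    have "h1 s * (m * (h2 s)\<^sup>2) \<le> h1 s * (2 * (m - 1) * (h2 s)\<^sup>2 - (m - 1) * (h1 s * h3 s))"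
      using i p by (intro mult_left_mono) (auto simp: algebra_simps)
    then have "h1 s \<le> (2 * (m - 1) * (h1 s) * (h2 s)\<^sup>2 - (m - 1) * ((h1 s)\<^sup>2 * h3 s)) / (m * (h2 s)\<^sup>2)"
      using m p by (simp add: pos_le_divide_eq power2_eq_square algebra_simps)
    also have "\<dots> = (m - 1) / m * ((2 * h1 s * h2 s * h2 s - (h1 s)\<^sup>2 * h3 s) / (h2 s)\<^sup>2)"
      using m p by (simp add: field_simps power2_eq_square)
    finally show "0 \<le> (m - 1) / m * ((2 * h1 s * h2 s * h2 s - (h1 s)\<^sup>2 * h3 s) / (h2 s)\<^sup>2) - h1 s"
      by simp
  qed
  have low: "- h0 s \<le> u t" if "r < s" "s < t" for s
  proof -
    have "0 \<le> (m - 1) / m * ((h1 s)\<^sup>2 / h2 s)"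
      using m pos(2)[OF that(1)] by (intro mult_nonneg_nonneg divide_nonneg_nonneg) (auto simp: hs less_imp_le)
    moreover have "u s \<le> u t"
      using that du by (intro DERIV_nonneg_imp_nondecreasing[of s t u]) auto
    ultimately show ?thesis by (simp add: u_def)
  qed
  have "((\<lambda>s. - h0 s) \<longlongrightarrow> - h0 r) (at_right r)"
    unfolding hs by (intro tendsto_intros)
  moreover have "\<forall>\<^sub>F s in at_right r. - h0 s \<le> u t"
    unfolding eventually_at_right_field using t low by blast
  ultimately have "- h0 r \<le> u t"
    by (rule tendsto_upperbound) simp
  then have "h0 t \<le> (m - 1) / m * ((h1 t)\<^sup>2 / h2 t)" using root by (simp add: u_def hs)
  then show ?thesis
    using m pos(2)[OF t] by (simp add: hs field_simps)
qed

text \<open>If the diagonal line lay entirely in the component, upward closure would make the component the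
  whole space; a multi-affine polynomial that is positive everywhere is constant, because it is affine
  along every axis.\<close>

lemma diagp_root_bounds_chamber:
  assumes "gard c" "0 < degree (diagp c)"
  obtains r where "poly (diagp c) r = 0" "\<And>t. t *\<^sub>R 1 \<in> chamber c \<longleftrightarrow> r < t"
proof -
  have nn: "nonneg c" using assms by (simp add: gard_def)
  have c0: "c \<noteq> 0" using assms(2) by (auto simp: diagp_def)
  define T where "T = {t. t *\<^sub>R 1 \<in> chamber c}"
  have up: "s \<in> T" if "t \<in> T" "t \<le> s" for s t
    using chamber_up[OF assms(1), of "t *\<^sub>R 1" "s *\<^sub>R 1"] that by (simp add: T_def)
  have "1 \<in> T" using one_in_chamber[OF nn c0] by (simp add: T_def)
  have bdd: "bdd_below T"
  proof (rule ccontr)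
    assume "\<not> bdd_below T"
    then have all: "t \<in> T" for t
      unfolding bdd_below_def using up by (meson linear)
    have any: "y \<in> chamber c" for y
    proof -
      have "\<exists>t. \<forall>i. t \<le> y $ i"
        by (intro exI[of _ "- norm y"]) (metis abs_le_D2 component_le_norm_cart minus_le_iff)
      then obtain t where "\<And>i. t \<le> y $ i" by blast
      then show ?thesis
        using chamber_up[OF assms(1), of "t *\<^sub>R 1" y] all[of t] by (simp add: T_def)
    qed
    have "pd i c = 0" for i
    proof (rule ccontr)
      assume "pd i c \<noteq> 0"
      then have "0 < maeval (pd i c) 1" by (rule pd_pos_on_chamber[OF assms(1) _ any])
      moreover have "0 < maeval c (1 + (- maeval c 1 / maeval (pd i c) 1) *\<^sub>R axis i 1)"
        using any by (rule chamber_pos)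
      ultimately show False unfolding maeval_add_axis by simp
    qed
    then have "pderiv (diagp c) = 0" unfolding pderiv_diagp by (simp add: diagp_def)
    then show False using assms(2) by (simp add: pderiv_eq_0_iff)
  qed
  define r where "r = Inf T"
  have open_T: "open T"
  proof -
    have "T = (\<lambda>t. t *\<^sub>R 1) -` chamber c" by (auto simp: T_def)
    then show ?thesis by (auto intro!: open_vimage open_chamber continuous_intros)
  qed
  have rT: "r \<notin> T"
  proof
    assume "r \<in> T"
    then obtain e where "e > 0" "ball r e \<subseteq> T" using open_T open_contains_ball by blast
    then have "r - e/2 \<in> T" by (auto simp: dist_real_def subset_iff)
    then have "r \<le> r - e/2" unfolding r_def using bdd by (rule cInf_lower)
    then show False using \<open>e > 0\<close> by simp
  qed
  have T_eq: "t \<in> T \<longleftrightarrow> r < t" for t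
  proof
    assume "t \<in> T"
    then have "r \<le> t" unfolding r_def using bdd by (rule cInf_lower)
    then show "r < t" using rT \<open>t \<in> T\<close> by (cases "r = t") auto
  next
    assume "r < t"
    then obtain s where "s \<in> T" "s < t"
      unfolding r_def using \<open>1 \<in> T\<close> bdd by (subst (asm) cInf_less_iff) auto
    then show "t \<in> T" using up by (meson less_imp_le)
  qed
  have lim: "(\<lambda>n. (r + 1 / real (Suc n)) *\<^sub>R 1) \<longlonglongrightarrow> (r + 0) *\<^sub>R (1 :: real^'a)"
    by (intro tendsto_intros LIMSEQ_Suc lim_1_over_n)
  have mem: "(r + 1 / real (Suc n)) *\<^sub>R 1 \<in> chamber c" for n
    using T_eq[of "r + 1 / real (Suc n)"] by (simp add: T_def)
  have "0 \<le> maeval c (r *\<^sub>R 1)"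
    by (rule LIMSEQ_le_const[OF tendsto_maeval[OF tendsto_const lim, of c, simplified]])
      (use chamber_pos[OF mem] in \<open>auto simp: less_imp_le\<close>)
  moreover have "\<not> 0 < maeval c (r *\<^sub>R 1)"
    using chamber_closed_in_pos[OF mem lim] rT by (auto simp: T_def)
  ultimately have "poly (diagp c) r = 0" by (simp add: poly_diagp)
  then show ?thesis using T_eq by (intro that[of r]) (auto simp: T_def)
qed

text \<open>Induction on the degree.  The derivative of \<open>h\<close> is, up to a positive factor, the diagonal of one more
  partial derivative, whose component is larger; so the inequality for \<open>h'\<close> is available on the whole
  interval to the right of the largest root of \<open>h\<close>.\<close>

lemma newton_symmetric:
  fixes F :: "real^('n::finite set)"
  assumes F: "gard F" "\<And>i j. swap_vars i j F = F"
  shows "t *\<^sub>R 1 \<in> chamber (pds P F) \<Longrightarrow> h = diagp (pds P F) \<Longrightarrow> degree h = m \<Longrightarrow> 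
    real m * (poly h t * poly (pderiv (pderiv h)) t) \<le> (real m - 1) * (poly (pderiv h) t)\<^sup>2"
proof (induction m arbitrary: P h t)
  case 0
  then have "pderiv h = 0" by (simp add: pderiv_eq_0_iff)
  then show ?case by simp
next
  case (Suc m)
  show ?case
  proof (cases "m = 0")
    case True
    then have "degree (pderiv h) = 0" using Suc.prems by (simp add: degree_pderiv)
    then have "pderiv (pderiv h) = 0" by (simp add: pderiv_eq_0_iff)
    then show ?thesis using True by simp
  next
    case False
    note G = gard_pds[OF F(1)]
    have key: "\<exists>i. i \<notin> Q \<and> pd i (pds Q F) \<noteq> 0" if "degree (diagp (pds Q F)) > 0" for Q
    proof (rule ccontr)
      assume "\<not> ?thesis"
      then have "pd i (pds Q F) = 0" for i by (cases "i \<in> Q") (auto simp: pd_pds_mem)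
      then have "pderiv (diagp (pds Q F)) = 0" unfolding pderiv_diagp by (simp add: diagp_def)
      then show False using that by (simp add: pderiv_eq_0_iff)
    qed
    obtain i where i: "i \<notin> P" "pd i (pds P F) \<noteq> 0" using key[of P] Suc.prems by auto
    define g where "g = diagp (pds (insert i P) F)"
    define a where "a = real (card (- P))"
    have a: "0 < a" using i(1) by (auto simp: a_def card_gt_0_iff)
    have h': "pderiv h = smult a g"
      using pderiv_diagp_symmetric[OF F(2) i(1)] Suc.prems(2) by (simp add: g_def a_def pds_insert i)
    have deg_g: "degree g = m"
      using Suc.prems(3) h' a degree_pderiv[of h] by simp
    obtain j where j: "j \<notin> insert i P" "pd j (pds (insert i P) F) \<noteq> 0"
      using key[of "insert i P"] deg_g False by (auto simp: g_def)
    define b where "b = real (card (- insert i P))"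
    have b: "0 < b" using j(1) by (auto simp: b_def card_gt_0_iff)
    have g': "pderiv g = smult b (diagp (pd j (pds (insert i P) F)))"
      using pderiv_diagp_symmetric[OF F(2) j(1)] by (simp add: g_def b_def)
    have sub: "chamber (pds P F) \<subseteq> chamber (pds (insert i P) F)"
      using chamber_subset_chamber_pd[OF G i(2)] i(1) by (simp add: pds_insert)
    obtain r where r: "poly h r = 0" "\<And>t. t *\<^sub>R 1 \<in> chamber (pds P F) \<longleftrightarrow> r < t"
      using diagp_root_bounds_chamber[OF G[of P]] Suc.prems(2,3) by auto
    have g_pos: "0 < poly g s" if "r < s" for s
      using sub r(2)[of s] that chamber_pos unfolding g_def poly_diagp by blast
    have g'_pos: "0 < poly (pderiv g) s" if "r < s" for s
      using sub r(2)[of s] that pd_pos_on_chamber[OF G j(2)] b unfolding g' by (auto simp: poly_diagp)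
    have IH: "real m * (poly g s * poly (pderiv (pderiv g)) s) \<le> (real m - 1) * (poly (pderiv g) s)\<^sup>2"
      if "r < s" for s
      using Suc.IH[OF _ g_def deg_g, of s] sub r(2)[of s] that by blast
    show ?thesis
    proof (rule newton_inequality_from_derivative[where r = r])
      show "r < t" using Suc.prems(1) r(2) by simp
      show "0 < poly (pderiv h) s" "0 < poly (pderiv (pderiv h)) s" if "r < s" for s
        using g_pos[OF that] g'_pos[OF that] a by (simp_all add: h' pderiv_smult)
      show "(real (Suc m) - 1) * (poly (pderiv h) s * poly (pderiv (pderiv (pderiv h))) s)
         \<le> (real (Suc m) - 2) * (poly (pderiv (pderiv h)) s)\<^sup>2" if "r < s" for s
        using mult_left_mono[OF IH[OF that], of "a\<^sup>2"]
        by (simp add: h' pderiv_smult power2_eq_square algebra_simps)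
    qed (use r False in auto)
  qed
qed

section \<open>Ultra-log-concavity on the diagonal\<close>

lemma newton_symmetric_at_zero:
  fixes F :: "real^('n::finite set)"
  assumes F: "gard F" "\<And>i j. swap_vars i j F = F" and h_def: "h = diagp (pds P F)"
  shows "real (degree h) * (poly h 0 * poly (pderiv (pderiv h)) 0) \<le> (real (degree h) - 1) * (poly (pderiv h) 0)\<^sup>2"
proof (cases "pds P F = 0")
  case True
  then show ?thesis by (simp add: h_def diagp_def)
next
  case False
  have pos: "t *\<^sub>R 1 \<in> chamber (pds P F)" if "0 < t" for t
    using that gard_nonneg[OF gard_pds[OF F(1)]] False
    by (intro nonneg_point_in_chamber maeval_pos) auto
  have "\<forall>\<^sub>F t in at_right 0. real (degree h) * (poly h t * poly (pderiv (pderiv h)) t)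
      \<le> (real (degree h) - 1) * (poly (pderiv h) t)\<^sup>2"
    unfolding eventually_at_right_field
    using newton_symmetric[OF F pos h_def refl] by (intro exI[of _ 1]) auto
  then show ?thesis
    by (intro tendsto_le[of "at_right (0::real)"]) (auto intro!: tendsto_intros)
qed

lemma higher_pderiv_diagp_symmetric:
  fixes F :: "real^('n::finite set)"
  assumes F: "\<And>i j. swap_vars i j F = F"
  shows "\<exists>a>0. (pderiv ^^ card P) (diagp F) = smult a (diagp (pds P F))"
proof -
  have "finite P" by simp
  then show ?thesis
  proof (induction P)
    case empty
    show ?case by (intro exI[of _ 1]) simp
  next
    case (insert i P)
    then obtain a where a: "a > 0" "(pderiv ^^ card P) (diagp F) = smult a (diagp (pds P F))" by blast
    have "0 < card (- P)" using insert.hyps by (auto simp: card_gt_0_iff)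
    with a show ?case
      using pderiv_diagp_symmetric[OF F insert.hyps(2)] insert.hyps
      by (intro exI[of _ "a * card (- P)"]) (simp add: pderiv_smult pds_insert)
  qed
qed

lemma poly_higher_pderiv_0: "poly ((pderiv ^^ k) p) 0 = fact k * coeff p k"
  for p :: "real poly"
  by (simp add: poly_0_coeff_0 coeff_higher_pderiv pochhammer_fact)

lemma degree_diagp_le: "degree (diagp c) \<le> CARD('n)" for c :: "real^('n::finite set)"
  unfolding diagp_def
proof (intro degree_sum_le)
  show "degree (monom (c $ S) (card S)) \<le> CARD('n)" for S :: "'n set"
    using degree_monom_le card_mono[of UNIV S] by (rule order_trans) auto
qed simp

lemma coeff_diagp_nonneg: "nonneg c \<Longrightarrow> 0 \<le> coeff (diagp c) k"
  unfolding diagp_def nonneg_def by (auto simp: coeff_sum intro!: sum_nonneg)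

text \<open>Both statements are obtained at \<open>t = 0\<close> for the \<open>k\<close>-th derivative of the diagonal.  For the second one,
  a positive value at the origin puts the origin into the component, where all nonzero partial
  derivatives are positive.\<close>

lemma diagp_newton:
  fixes c :: "real^('n::finite set)"
  assumes "gard c"
  defines "p \<equiv> diagp c"
  assumes k: "k \<le> degree p"
  shows "real (degree p - k) * ((fact k * coeff p k) * (fact (k + 2) * coeff p (k + 2)))
      \<le> (real (degree p - k) - 1) * (fact (k + 1) * coeff p (k + 1))\<^sup>2"
    and "k < degree p \<Longrightarrow> 0 < coeff p k \<Longrightarrow> 0 < coeff p (Suc k)"
proof -
  obtain F :: "real^('n set)" where F: "gard F" "diagp F = p" "\<And>i j. swap_vars i j F = F"
    using symmetric_representative[OF assms(1)] by (auto simp: p_def)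
  have "k \<le> CARD('n)" using k degree_diagp_le[of c] by (simp add: p_def)
  then obtain P :: "'n set" where P: "card P = k" by (rule obtain_subset_with_card_n) auto
  define h where "h = diagp (pds P F)"
  obtain a where a: "a > 0" "(pderiv ^^ k) p = smult a h"
    using higher_pderiv_diagp_symmetric[OF F(3), of P] by (auto simp: F(2) P h_def)
  have deg: "degree h = degree p - k"
    using a degree_higher_pderiv[of k p] by simp
  have v: "a * poly ((pderiv ^^ l) h) 0 = fact (k + l) * coeff p (k + l)" for l
  proof -
    have "(pderiv ^^ (k + l)) p = smult a ((pderiv ^^ l) h)"
      by (simp add: add.commute[of k l] funpow_add a(2) higher_pderiv_smult)
    then show ?thesis using poly_higher_pderiv_0[of "k + l" p] by simp
  qed
  have "a\<^sup>2 * (real (degree h) * (poly h 0 * poly (pderiv (pderiv h)) 0))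
      \<le> a\<^sup>2 * ((real (degree h) - 1) * (poly (pderiv h) 0)\<^sup>2)"
    by (intro mult_left_mono newton_symmetric_at_zero[OF F(1,3) h_def]) auto
  then have "real (degree h) * ((a * poly h 0) * (a * poly (pderiv (pderiv h)) 0))
      \<le> (real (degree h) - 1) * (a * poly (pderiv h) 0)\<^sup>2"
    by (simp add: power2_eq_square mult_ac)
  then show "real (degree p - k) * ((fact k * coeff p k) * (fact (k + 2) * coeff p (k + 2)))
      \<le> (real (degree p - k) - 1) * (fact (k + 1) * coeff p (k + 1))\<^sup>2"
    using v[of 0] v[of 1] v[of 2] by (simp add: deg numeral_2_eq_2)
  assume kd: "k < degree p" and pos: "0 < coeff p k"
  have "0 < a * poly h 0" using v[of 0] pos by simp
  then have "0 < maeval (pds P F) (0 *\<^sub>R 1)"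
    using a by (simp add: h_def poly_diagp zero_less_mult_iff)
  then have mem: "0 \<in> chamber (pds P F)"
    using gard_nonneg[OF gard_pds[OF F(1)]] by (intro nonneg_point_in_chamber) auto
  have "\<exists>i. pd i (pds P F) \<noteq> 0"
  proof (rule ccontr)
    assume "\<not> ?thesis"
    then have "pderiv h = 0" unfolding pderiv_diagp h_def by (simp add: diagp_def)
    then show False using deg kd by (simp add: pderiv_eq_0_iff)
  qed
  then obtain i where i: "pd i (pds P F) \<noteq> 0" by blast
  then have "i \<notin> P" using pd_pds_mem by blast
  have "0 < poly (diagp (pd i (pds P F))) 0"
    using pd_pos_on_chamber[OF gard_pds[OF F(1)] i mem] by (simp add: poly_diagp)
  moreover have "0 < card (- P)" using \<open>i \<notin> P\<close> by (auto simp: card_gt_0_iff)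
  ultimately have "0 < poly (pderiv h) 0"
    unfolding h_def using pderiv_diagp_symmetric[OF F(3) \<open>i \<notin> P\<close>] by simp
  then have "0 < a * poly ((pderiv ^^ 1) h) 0" using a by simp
  then have "0 < fact (k + 1) * coeff p (k + 1)" unfolding v .
  then show "0 < coeff p (Suc k)" by (simp add: zero_less_mult_iff del: fact_Suc)
qed

lemma diagp_ultra_log_concave:
  assumes "gard c"
  shows "ultra_log_concave_seq (degree (diagp c)) (coeff (diagp c))"
proof -
  define p d where "p = diagp c" and "d = degree p"
  note newton = diagp_newton(1)[OF assms, folded p_def, folded d_def]
  note step = diagp_newton(2)[OF assms, folded p_def, folded d_def]
  have nn: "0 \<le> coeff p k" for k
    unfolding p_def using gard_nonneg[OF assms] by (rule coeff_diagp_nonneg)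
  have gap: "0 < coeff p l" if "0 < coeff p k" "k \<le> l" "l \<le> d" for k l
    using that(2,3) by (induction l rule: dec_induct) (use that(1) step in auto)
  have main: "coeff p k / real (d choose k) * (coeff p (k + 2) / real (d choose (k + 2)))
      \<le> (coeff p (k + 1) / real (d choose (k + 1)))\<^sup>2" if k: "k + 2 \<le> d" for k
  proof -
    obtain e where e: "d = k + 2 + e" using k le_Suc_ex by blast
    define X Y Z where "X = fact k * coeff p k" and "Y = fact (k + 1) * coeff p (k + 1)" 
      and "Z = fact (k + 2) * coeff p (k + 2)"
    have N: "(real e + 2) * (X * Z) \<le> (real e + 1) * Y\<^sup>2"
      using newton[of k] e by (simp add: X_def Y_def Z_def algebra_simps)
    have b: "coeff p l / real (d choose l) = (fact l * coeff p l) * fact (d - l) / fact d" if "l \<le> d" for l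
      by (simp add: binomial_fact[OF that])
    have q: "coeff p k / real (d choose k) = X * fact (e + 2) / fact d"
      "coeff p (k + 1) / real (d choose (k + 1)) = Y * fact (e + 1) / fact d"
      "coeff p (k + 2) / real (d choose (k + 2)) = Z * fact e / fact d"
      using b[of k] b[of "k + 1"] b[of "k + 2"] by (simp_all only: X_def Y_def Z_def) (simp_all add: e)
    have "fact (e + 2) = (real e + 2) * (real e + 1) * fact e" 
      and f1: "fact (e + 1) = (real e + 1) * (fact e :: real)"
      by (simp_all add: numeral_2_eq_2 algebra_simps)
    then have "(X * fact (e + 2)) * (Z * fact e) = ((real e + 1) * (fact e)\<^sup>2) * ((real e + 2) * (X * Z))"
      by (simp add: power2_eq_square mult_ac)
    also have "\<dots> \<le> ((real e + 1) * (fact e)\<^sup>2) * ((real e + 1) * Y\<^sup>2)"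
      using N by (intro mult_left_mono) auto
    also have "\<dots> = (Y * fact (e + 1))\<^sup>2"
      unfolding f1 by (simp add: power2_eq_square mult_ac)
    finally show ?thesis
      unfolding q by (simp add: power2_eq_square divide_simps)
  qed
  show ?thesis
    unfolding p_def[symmetric] d_def[symmetric] ultra_log_concave_seq_def log_concave_seq_def no_internal_zeros_def
  proof (intro conjI allI impI)
    show "0 \<le> coeff p k / real (d choose k)" for k using nn by simp
    show "0 < coeff p r2 / real (d choose r2)"
      if "r1 < r2 \<and> r2 < r3 \<and> r3 \<le> d \<and> 0 < coeff p r1 / real (d choose r1) \<and> 0 < coeff p r3 / real (d choose r3)"
      for r1 r2 r3
      using that gap[of r1 r2] by (simp add: zero_less_divide_iff)
    show "coeff p (k - 1) / real (d choose (k - 1)) * (coeff p (k + 1) / real (d choose (k + 1)))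
         \<le> (coeff p k / real (d choose k))\<^sup>2" if "0 < k \<and> k < d" for k
      using main[of "k - 1"] that by (simp add: numeral_2_eq_2)
  qed
qed

section \<open>Log-concavity of homogeneous polynomials\<close>

definition hom_deg :: "nat \<Rightarrow> real^('n::finite set) \<Rightarrow> bool" where
  "hom_deg d c \<longleftrightarrow> (\<forall>S. c $ S \<noteq> 0 \<longrightarrow> card S = d)"

lemma maeval_hom: "hom_deg d c \<Longrightarrow> maeval c (r *\<^sub>R x) = r ^ d * maeval c x"
  unfolding maeval_def sum_distrib_left
  by (intro sum.cong refl) (auto simp: prod.distrib hom_deg_def)

text \<open>Compare both end points with \<open>L k\<close> through the slope \<open>D\<close> just before \<open>k\<close>.\<close>

lemma concave_seq_chord:
  fixes L :: "nat \<Rightarrow> real"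
  assumes conc: "\<And>k. k + 2 \<le> d \<Longrightarrow> L k + L (k + 2) \<le> 2 * L (k + 1)" and k: "k \<le> d"
  shows "real (d - k) * L 0 + real k * L d \<le> real d * L k"
proof (cases k)
  case (Suc m)
  define D where "D = L k - L m"
  have slope: "L (j + 1) - L j \<le> L (i + 1) - L i" if "i \<le> j" "j < d" for i j
    using that
  proof (induction j rule: dec_induct)
    case (step n)
    then show ?case using conc[of n] by simp
  qed simp
  have "real l * D \<le> L l - L 0" if "l \<le> k" for l
    using that
  proof (induction l)
    case (Suc l)
    then show ?case using slope[of l m] k \<open>k = Suc m\<close> by (simp add: D_def algebra_simps)
  qed simp
  from this[of k] have 1: "real k * D \<le> L k - L 0" by simp
  have "L (k + l) - L k \<le> real l * D" if "k + l \<le> d" for l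
    using that
  proof (induction l)
    case (Suc l)
    then show ?case using slope[of m "k + l"] \<open>k = Suc m\<close> by (simp add: D_def algebra_simps)
  qed simp
  from this[of "d - k"] k have 2: "L d - L k \<le> real (d - k) * D" by simp
  have "real k * (L d - L k) \<le> real k * (real (d - k) * D)" using 2 by (intro mult_left_mono) auto
  also have "\<dots> = real (d - k) * (real k * D)" by simp
  also have "\<dots> \<le> real (d - k) * (L k - L 0)" using 1 by (intro mult_left_mono) auto
  finally show ?thesis using k by (simp add: of_nat_diff algebra_simps)
qed simp

text \<open>The polynomial is the diagonal of a translated and scaled copy of \<open>c\<close>.  Homogeneity fixes its degree:
  each product over \<open>S\<close> contributes a polynomial of degree exactly \<open>d\<close> with leading coefficient the product of
  the \<open>y\<^sub>i\<close>.\<close>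

lemma line_polynomial_ulc:
  fixes c :: "real^('n::finite set)"
  assumes "gard c" "hom_deg d c" "c \<noteq> 0" "\<And>i. 0 < x $ i" "\<And>i. 0 < y $ i"
  obtains p where "\<And>t. poly p t = maeval c (x + t *\<^sub>R y)" "degree p = d" "coeff p d = maeval c y"
    "ultra_log_concave_seq d (coeff p)"
proof -
  obtain c1 where c1: "gard c1" "\<And>z. maeval c1 z = maeval c (z + x)"
    using gard_translate[OF assms(1), of x] assms(4) by (metis less_imp_le)
  define p where "p = diagp (scale_vars y c1)"
  have pt: "poly p t = maeval c (x + t *\<^sub>R y)" for t
  proof -
    have "(\<chi> i. y $ i * (t *\<^sub>R 1) $ i) + x = x + t *\<^sub>R y" by (simp add: vec_eq_iff mult_ac)
    then show ?thesis unfolding p_def poly_diagp maeval_scale_vars c1 by (simp only:)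
  qed
  define q where "q = (\<Sum>S\<in>UNIV. smult (c $ S) (\<Prod>i\<in>S. [:x $ i, y $ i:]))"
  have "poly q t = poly p t" for t
    unfolding pt q_def maeval_def by (simp add: poly_sum poly_prod)
  then have "p = q" by (simp add: poly_eq_poly_eq_iff[symmetric] fun_eq_iff)
  have degS: "degree (\<Prod>i\<in>S. [:x $ i, y $ i:]) = card S" for S
    using assms(5) by (subst degree_prod_eq_sum_degree) (auto simp: less_imp_neq[symmetric])
  have leadS: "coeff (\<Prod>i\<in>S. [:x $ i, y $ i:]) (card S) = (\<Prod>i\<in>S. y $ i)" for S
    using lead_coeff_prod[of "\<lambda>i. [:x $ i, y $ i:]" S] assms(5) degS
    by (simp add: less_imp_neq[symmetric])
  have cd: "coeff q d = maeval c y"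
    unfolding q_def maeval_def coeff_sum coeff_smult
    using assms(2) leadS by (intro sum.cong) (auto simp: hom_deg_def)
  have "degree q \<le> d"
    unfolding q_def using assms(2) degS
    by (intro degree_sum_le) (auto simp: hom_deg_def intro: order_trans[OF degree_smult_le])
  moreover have "0 < coeff q d"
    unfolding cd using gard_nonneg[OF assms(1)] assms by (intro maeval_pos) auto
  ultimately have "degree q = d" by (metis le_antisym le_degree less_numeral_extra(3))
  moreover have "ultra_log_concave_seq (degree p) (coeff p)"
    unfolding p_def using c1(1) assms(5)
    by (intro diagp_ultra_log_concave gard_scale_vars) (auto simp: less_imp_le)
  ultimately show ?thesis using that[of p] pt cd \<open>p = q\<close> by simp
qed

text \<open>Put \<open>b\<^sub>k = a\<^sub>k / (d choose k)\<close> for the coefficients of \<open>t \<mapsto> f (x + t y)\<close>.  Log-concavity gives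
  \<open>b\<^sub>k \<ge> A\<^bsup>d-k\<^esup> B\<^sup>k\<close> with \<open>A\<^sup>d = f x\<close> and \<open>B\<^sup>d = f y\<close>, and by homogeneity and the binomial theorem
  \<open>f ((1 - s) x + s y) \<ge> ((1 - s) A + s B)\<^sup>d\<close>.  Concavity of the logarithm finishes the proof.\<close>

lemma hom_log_concave:
  fixes c :: "real^('n::finite set)"
  assumes "gard c" "hom_deg d c" "c \<noteq> 0" and x: "\<And>i. 0 < x $ i" and y: "\<And>i. 0 < y $ i"
    and s: "0 < s" "s < 1"
  shows "(1 - s) * ln (maeval c x) + s * ln (maeval c y) \<le> ln (maeval c ((1 - s) *\<^sub>R x + s *\<^sub>R y))"
proof -
  have pos: "0 < maeval c x" "0 < maeval c y"
    using gard_nonneg[OF assms(1)] assms by (auto intro: maeval_pos)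
  show ?thesis
  proof (cases "d = 0")
    case True
    have "maeval c z = maeval c x" for z
      using maeval_hom[OF assms(2), of 0 z] maeval_hom[OF assms(2), of 0 x] True by simp
    from this[of y] this[of "(1 - s) *\<^sub>R x + s *\<^sub>R y"] show ?thesis
      by (simp only:) (simp add: algebra_simps)
  next
    case False
    obtain p where p: "\<And>t. poly p t = maeval c (x + t *\<^sub>R y)" "degree p = d" "coeff p d = maeval c y"
      and ulc: "ultra_log_concave_seq d (coeff p)"
      using line_polynomial_ulc[OF assms(1-3) x y] by blast
    have c0: "coeff p 0 = maeval c x" using p(1)[of 0] by (simp add: poly_0_coeff_0)
    define b where "b k = coeff p k / real (d choose k)" for k
    have b0: "b 0 = maeval c x" and bd: "b d = maeval c y" by (simp_all add: b_def c0 p(3))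
    have lc: "log_concave_seq d b" using ulc by (simp add: ultra_log_concave_seq_def b_def[abs_def])
    then have lc3: "b (k - 1) * b (k + 1) \<le> (b k)\<^sup>2" if "0 < k" "k < d" for k
      using that unfolding log_concave_seq_def by blast
    have bpos: "0 < b k" if kd: "k \<le> d" for k
    proof -
      consider "k = 0" | "k = d" | "0 < k" "k < d" using kd by linarith
      then show ?thesis
      proof cases
        case 3
        then show ?thesis
          using lc pos b0 bd unfolding log_concave_seq_def no_internal_zeros_def by (metis le_refl)
      qed (use pos b0 bd in auto)
    qed
    define L where "L k = ln (b k)" for k
    have "L k + L (k + 2) \<le> 2 * L (k + 1)" if "k + 2 \<le> d" for k
    proof -
      have "b k * b (k + 2) \<le> (b (k + 1))\<^sup>2"
        using lc3[of "k + 1"] that by (simp add: numeral_2_eq_2)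
      then have "ln (b k * b (k + 2)) \<le> ln ((b (k + 1))\<^sup>2)"
        using bpos[of k] bpos[of "k+2"] that by (intro ln_mono) auto
      then show ?thesis using bpos[of k] bpos[of "k+1"] bpos[of "k+2"] that
        by (simp add: L_def ln_mult ln_realpow)
    qed
    then have chord: "real (d - k) * L 0 + real k * L d \<le> real d * L k" if "k \<le> d" for k
      using concave_seq_chord[of d L k] that by blast
    define A B where "A = exp (L 0 / d)" and "B = exp (L d / d)"
    have AB: "A ^ (d - k) * B ^ k \<le> b k" if "k \<le> d" for k
    proof -
      have "A ^ (d - k) * B ^ k = exp ((real (d - k) * L 0 + real k * L d) / d)"
        by (simp add: A_def B_def exp_of_nat_mult[symmetric] exp_add[symmetric] add_divide_distrib)
      also have "\<dots> \<le> exp (L k)"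
        using chord[OF that] False by (simp add: divide_le_eq mult.commute)
      also have "\<dots> = b k" using bpos[OF that] by (simp add: L_def)
      finally show ?thesis .
    qed
    have "(1 - s) * (s / (1 - s)) = s" using s by simp
    then have "(1 - s) *\<^sub>R x + s *\<^sub>R y = (1 - s) *\<^sub>R (x + (s / (1 - s)) *\<^sub>R y)"
      by (simp only: scaleR_add_right scaleR_scaleR)
    then have "maeval c ((1 - s) *\<^sub>R x + s *\<^sub>R y) = (1 - s) ^ d * poly p (s / (1 - s))"
      by (simp only: maeval_hom[OF assms(2)] p(1))
    also have "\<dots> = (\<Sum>k\<le>d. coeff p k * (s ^ k * (1 - s) ^ (d - k)))"
      unfolding poly_altdef p(2) sum_distrib_left
    proof (intro sum.cong refl)
      fix k assume "k \<in> {..d}"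
      then have "(1 - s) ^ d = (1 - s) ^ k * (1 - s) ^ (d - k)" by (simp add: power_add[symmetric])
      then show "(1 - s) ^ d * (coeff p k * (s / (1 - s)) ^ k) = coeff p k * (s ^ k * (1 - s) ^ (d - k))"
        using s by (simp add: power_divide)
    qed
    also have "\<dots> \<ge> (\<Sum>k\<le>d. real (d choose k) * (s * B) ^ k * ((1 - s) * A) ^ (d - k))"
    proof (intro sum_mono)
      fix k assume k: "k \<in> {..d}"
      have "real (d choose k) * (s * B) ^ k * ((1 - s) * A) ^ (d - k)
          = (real (d choose k) * (s ^ k * (1 - s) ^ (d - k))) * (A ^ (d - k) * B ^ k)"
        by (simp add: power_mult_distrib)
      also have "\<dots> \<le> (real (d choose k) * (s ^ k * (1 - s) ^ (d - k))) * b k"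
        using AB[of k] k s by (intro mult_left_mono) auto
      also have "\<dots> = coeff p k * (s ^ k * (1 - s) ^ (d - k))"
        using k by (simp add: b_def)
      finally show "real (d choose k) * (s * B) ^ k * ((1 - s) * A) ^ (d - k)
          \<le> coeff p k * (s ^ k * (1 - s) ^ (d - k))" .
    qed
    finally have "(s * B + (1 - s) * A) ^ d \<le> maeval c ((1 - s) *\<^sub>R x + s *\<^sub>R y)"
      by (simp add: binomial_ring)
    moreover have mix: "0 < s * B + (1 - s) * A" using s by (simp add: A_def B_def add_pos_pos)
    ultimately have 1: "d * ln (s * B + (1 - s) * A) \<le> ln (maeval c ((1 - s) *\<^sub>R x + s *\<^sub>R y))"
      by (subst ln_realpow[symmetric]) (auto intro!: ln_mono)
    have "(1 - s) * ln A + s * ln B \<le> ln ((1 - s) *\<^sub>R A + s *\<^sub>R B)"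
      using s by (intro concave_onD[OF ln_concave]) (auto simp: A_def B_def)
    then have "d * ((1 - s) * ln A + s * ln B) \<le> d * ln (s * B + (1 - s) * A)"
      by (intro mult_left_mono) (auto simp: add.commute)
    moreover have "d * ((1 - s) * ln A + s * ln B) = (1 - s) * ln (maeval c x) + s * ln (maeval c y)"
      using False by (simp add: A_def B_def L_def b0 bd field_simps)
    ultimately show ?thesis using 1 by linarith
  qed
qed

section \<open>The exchange property of the support\<close>

lemma chamber_subset_chamber_pds:
  assumes "gard c"
  shows "pds P c \<noteq> 0 \<Longrightarrow> chamber c \<subseteq> chamber (pds P c)"
proof -
  have "finite P" by simp
  then show "pds P c \<noteq> 0 \<Longrightarrow> ?thesis"
  proof (induction P)
    case (insert i P)
    then have ne: "pd i (pds P c) \<noteq> 0" by (simp add: pds_insert)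
    then have "pds P c \<noteq> 0" by auto
    then have "chamber c \<subseteq> chamber (pds P c)" by (rule insert.IH)
    also have "\<dots> \<subseteq> chamber (pd i (pds P c))"
      by (rule chamber_subset_chamber_pd[OF gard_pds[OF assms] ne])
    finally show ?case using insert.hyps by (simp add: pds_insert)
  qed simp
qed

text \<open>With \<open>R = S - {i}\<close>, the derivative \<open>\<partial>\<^sub>R f\<close> is a nonzero linear form whose coefficient at \<open>x\<^sub>j\<close> is the one of
  \<open>f\<close> at \<open>R \<union> {j}\<close>.  It is positive on the component of \<open>f\<close>.  The indicator vector of \<open>T\<close> lies in that component,
  so some \<open>j\<close> in \<open>T\<close> has a nonzero coefficient.\<close>

lemma support_exchange:
  assumes c: "gard c" "hom_deg d c" and S: "c $ S \<noteq> 0" and T: "c $ T \<noteq> 0" and i: "i \<in> S" "i \<notin> T"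
  shows "\<exists>j\<in>T - S. c $ (insert j (S - {i})) \<noteq> 0"
proof -
  define R where "R = S - {i}"
  define x :: "real^'a" where "x = (\<chi> k. if k \<in> T then 1 else 0)"
  have nn: "0 \<le> c $ U" for U using gard_nonneg[OF c(1)] by (simp add: nonneg_def)
  have "0 < maeval c x"
    unfolding maeval_def
  proof (rule sum_pos2[where i = T])
    show "0 < c $ T * (\<Prod>k\<in>T. x $ k)" using T nn[of T] by (simp add: x_def less_le)
    show "0 \<le> c $ U * (\<Prod>k\<in>U. x $ k)" for U
      using nn by (intro mult_nonneg_nonneg prod_nonneg) (auto simp: x_def)
  qed auto
  then have xc: "x \<in> chamber c" using gard_nonneg[OF c(1)] by (intro nonneg_point_in_chamber) (auto simp: x_def)
  have "pds R c \<noteq> 0"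
  proof -
    have "pds R c $ {i} = c $ S" using i(1) by (simp add: pds_def R_def insert_absorb)
    then show ?thesis using S by auto
  qed
  then have "x \<in> chamber (pds R c)" using chamber_subset_chamber_pds[OF c(1)] xc by blast
  then have "maeval (pds R c) x \<noteq> 0" by (metis chamber_pos less_irrefl)
  then obtain U where U: "pds R c $ U * (\<Prod>k\<in>U. x $ k) \<noteq> 0"
    unfolding maeval_def by (rule sum.not_neutral_contains_not_neutral)
  have "U \<subseteq> T"
  proof
    fix k assume "k \<in> U"
    then show "k \<in> T" using U by (cases "k \<in> T") (auto simp: x_def prod_zero_iff)
  qed
  moreover have UR: "U \<inter> R = {}" "c $ (R \<union> U) \<noteq> 0" using U by (auto simp: pds_def split: if_splits)
  have "card (R \<union> U) = d" "card S = d" using UR S c(2) by (auto simp: hom_deg_def)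
  moreover have "card (R \<union> U) = card R + card U" using UR by (intro card_Un_disjoint) auto
  moreover have "card S = Suc (card R)"
    unfolding R_def using i(1) by (intro card.remove) auto
  ultimately have "card U = 1" by simp
  then obtain j where "U = {j}" by (auto simp: card_1_singleton_iff)
  then show ?thesis
    using \<open>U \<subseteq> T\<close> UR i by (intro bexI[of _ j]) (auto simp: R_def)
qed

section \<open>Negative association\<close>

text \<open>The integral of \<open>F\<close> against the measure with weights \<open>c\<close>, which need not have total mass one.
  Avoiding normalization keeps conditioning on null events harmless.\<close>

definition tot :: "real^('n::finite set) \<Rightarrow> ('n set \<Rightarrow> real) \<Rightarrow> real" where
  "tot c F = (\<Sum>S\<in>UNIV. c $ S * F S)"

text \<open>Restriction of the weights to the event that \<open>i\<close> belongs to the random set; likewise \<open>con_out\<close>, to the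
  complementary event.\<close>

definition con_in :: "'n::finite \<Rightarrow> real^('n set) \<Rightarrow> real^('n set)" where
  "con_in i c = (\<chi> S. if i \<in> S then c $ S else 0)"

definition con_out :: "'n::finite \<Rightarrow> real^('n set) \<Rightarrow> real^('n set)" where
  "con_out i c = (\<chi> S. if i \<in> S then 0 else c $ S)"

abbreviation "mass c \<equiv> tot c (\<lambda>_. 1)"

lemma tot_split: "tot c F = tot (con_in i c) F + tot (con_out i c) F"
  unfolding tot_def sum.distrib[symmetric] by (intro sum.cong) (auto simp: con_in_def con_out_def)

lemma tot_con_in: "tot (con_in i c) F = tot c (\<lambda>S. if i \<in> S then F S else 0)"
  unfolding tot_def by (intro sum.cong) (auto simp: con_in_def)

lemma mass_nonneg: "nonneg c \<Longrightarrow> 0 \<le> mass c"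
  unfolding tot_def nonneg_def by (intro sum_nonneg) auto

lemma mass_zero: "nonneg c \<Longrightarrow> mass c = 0 \<Longrightarrow> c = 0"
  unfolding tot_def nonneg_def by (auto simp: sum_nonneg_eq_0_iff vec_eq_iff)

lemma tot_zero [simp]: "tot 0 F = 0"
  by (simp add: tot_def)

definition cyl :: "real^('n::finite set) \<Rightarrow> 'n set \<Rightarrow> 'n set \<Rightarrow> real" where
  "cyl c P Q = tot c (\<lambda>S. of_bool (P \<subseteq> S \<and> S \<inter> Q = {}))"

text \<open>Pairwise negative correlation under every conditioning: \<open>P\<close> are the coordinates conditioned to be
  present, \<open>Q\<close> those conditioned to be absent.\<close>

definition pairwise_nc :: "real^('n::finite set) \<Rightarrow> bool" where
  "pairwise_nc c \<longleftrightarrow> nonneg c \<and> (\<forall>P Q i j. i \<noteq> j \<longrightarrow>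
     cyl c (insert i (insert j P)) Q * cyl c P Q \<le> cyl c (insert i P) Q * cyl c (insert j P) Q)"

lemma pairwise_ncD:
  assumes "pairwise_nc c"
  shows "nonneg c" and "i \<noteq> j \<Longrightarrow>
     cyl c (insert i (insert j P)) Q * cyl c P Q \<le> cyl c (insert i P) Q * cyl c (insert j P) Q"
  using assms by (simp_all add: pairwise_nc_def)

lemma nonneg_con: "nonneg c \<Longrightarrow> nonneg (con_in i c)" "nonneg c \<Longrightarrow> nonneg (con_out i c)"
  by (auto simp: nonneg_def con_in_def con_out_def)

lemma pairwise_nc_con_in:
  assumes "pairwise_nc c"
  shows "pairwise_nc (con_in k c)"
  unfolding pairwise_nc_def
proof (intro conjI allI impI)
  have cyl: "cyl (con_in k c) P Q = cyl c (insert k P) Q" for P Q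
    unfolding cyl_def tot_con_in by (rule arg_cong[where f = "tot c"]) auto
  fix P Q and i j :: 'a assume "i \<noteq> j"
  have comm: "insert k (insert l R) = insert l (insert k R)" for l R by (rule insert_commute)
  show "cyl (con_in k c) (insert i (insert j P)) Q * cyl (con_in k c) P Q
      \<le> cyl (con_in k c) (insert i P) Q * cyl (con_in k c) (insert j P) Q"
    unfolding cyl comm[of i] comm[of j] by (rule pairwise_ncD(2)[OF assms \<open>i \<noteq> j\<close>])
qed (use pairwise_ncD(1)[OF assms] nonneg_con in blast)

lemma pairwise_nc_con_out:
  assumes "pairwise_nc c"
  shows "pairwise_nc (con_out k c)"
  unfolding pairwise_nc_def
proof (intro conjI allI impI)
  have cyl: "cyl (con_out k c) P Q = cyl c P (insert k Q)" for P Q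
    unfolding cyl_def tot_def by (intro sum.cong) (auto simp: con_out_def)
  fix P Q and i j :: 'a assume "i \<noteq> j"
  show "cyl (con_out k c) (insert i (insert j P)) Q * cyl (con_out k c) P Q
      \<le> cyl (con_out k c) (insert i P) Q * cyl (con_out k c) (insert j P) Q"
    unfolding cyl by (rule pairwise_ncD(2)[OF assms \<open>i \<noteq> j\<close>])
qed (use pairwise_ncD(1)[OF assms] nonneg_con in blast)

lemma hom_deg_con: "hom_deg d c \<Longrightarrow> hom_deg d (con_in i c)" "hom_deg d c \<Longrightarrow> hom_deg d (con_out i c)"
  by (auto simp: hom_deg_def con_in_def con_out_def)

lemma pairwise_nc_basic:
  assumes "pairwise_nc c" "i \<noteq> j"
  shows "mass (con_in i (con_in j c)) * mass (con_out i (con_out j c))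
       \<le> mass (con_in i (con_out j c)) * mass (con_out i (con_in j c))"
proof -
  define a b e f where "a = mass (con_in i (con_in j c))" and "b = mass (con_in i (con_out j c))"
    and "e = mass (con_out i (con_in j c))" and "f = mass (con_out i (con_out j c))"
  note defs = a_def b_def e_def f_def
  have t: "cyl c (insert i (insert j {})) {} = a" "cyl c (insert i {}) {} = a + b"
    "cyl c (insert j {}) {} = a + e" "cyl c {} {} = a + b + e + f"
    unfolding defs cyl_def tot_def sum.distrib[symmetric]
    by (intro sum.cong; auto simp: con_in_def con_out_def)+
  have "a * (a + b + e + f) \<le> (a + b) * (a + e)"
    using pairwise_ncD(2)[OF assms, of "{}" "{}"] unfolding t .
  then show ?thesis unfolding defs[symmetric] by (simp add: algebra_simps)
qed

text \<open>The number of elements of the random set is the constant \<open>d\<close>, so the covariances of \<open>F\<close> with the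
  coordinates add up to the covariance of \<open>F\<close> with a constant.\<close>

lemma sum_covariance_zero:
  assumes "hom_deg d c"
  shows "(\<Sum>i\<in>UNIV. tot (con_in i c) F * mass c - tot c F * mass (con_in i c)) = 0"
proof -
  have *: "(\<Sum>i\<in>UNIV. tot (con_in i c) G) = d * tot c G" for G
  proof -
    have "(\<Sum>i\<in>UNIV. tot (con_in i c) G) = (\<Sum>S\<in>UNIV. \<Sum>i\<in>UNIV. if i \<in> S then c $ S * G S else 0)"
      unfolding tot_def by (subst sum.swap) (auto simp: con_in_def intro!: sum.cong)
    also have "\<dots> = (\<Sum>S\<in>UNIV. d * (c $ S * G S))"
      using assms by (intro sum.cong refl) (auto simp: sum.If_cases hom_deg_def)
    finally show ?thesis by (simp add: tot_def sum_distrib_left)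
  qed
  show ?thesis
    unfolding sum_subtractf sum_distrib_right[symmetric] sum_distrib_left[symmetric] * by simp
qed

text \<open>The coordinates outside \<open>N\<close> are almost surely constant.  Induction on \<open>N\<close> rather than on the set of
  nonconstant coordinates lets one condition on any coordinate in \<open>N\<close>.\<close>

definition decided :: "'n::finite set \<Rightarrow> real^('n set) \<Rightarrow> bool" where
  "decided N c \<longleftrightarrow> (\<forall>i. i \<notin> N \<longrightarrow> con_in i c = 0 \<or> con_out i c = 0)"

lemma con_in_zero_iff: "con_in i c = 0 \<longleftrightarrow> (\<forall>S. i \<in> S \<longrightarrow> c $ S = 0)"
  by (auto simp: con_in_def vec_eq_iff)

lemma con_out_zero_iff: "con_out i c = 0 \<longleftrightarrow> (\<forall>S. i \<notin> S \<longrightarrow> c $ S = 0)"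
  by (auto simp: con_out_def vec_eq_iff)

lemma decided_con:
  assumes "decided N c"
  shows "decided (N - {i}) (con_in i c)" "decided (N - {i}) (con_out i c)"
proof -
  have nth: "con_in i c $ S = (if i \<in> S then c $ S else 0)" "con_out i c $ S = (if i \<in> S then 0 else c $ S)" for S
    by (simp_all add: con_in_def con_out_def)
  have dec: "(\<forall>S. j \<in> S \<longrightarrow> c $ S = 0) \<or> (\<forall>S. j \<notin> S \<longrightarrow> c $ S = 0)" if "j \<notin> N" for j
    using assms that by (simp add: decided_def con_in_zero_iff con_out_zero_iff)
  show "decided (N - {i}) (con_in i c)"
    unfolding decided_def con_in_zero_iff con_out_zero_iff nth
  proof (intro allI impI)
    fix j assume "j \<notin> N - {i}"
    then show "(\<forall>S. j \<in> S \<longrightarrow> (if i \<in> S then c $ S else 0) = 0) \<or> (\<forall>S. j \<notin> S \<longrightarrow> (if i \<in> S then c $ S else 0) = 0)"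
      using dec[of j] by (cases "j = i") auto
  qed
  show "decided (N - {i}) (con_out i c)"
    unfolding decided_def con_in_zero_iff con_out_zero_iff nth
  proof (intro allI impI)
    fix j assume "j \<notin> N - {i}"
    then show "(\<forall>S. j \<in> S \<longrightarrow> (if i \<in> S then 0 else c $ S) = 0) \<or> (\<forall>S. j \<notin> S \<longrightarrow> (if i \<in> S then 0 else c $ S) = 0)"
      using dec[of j] by (cases "j = i") auto
  qed
qed

lemma decided_agree:
  assumes "decided N c" "c $ S \<noteq> 0" "c $ T \<noteq> 0"
  shows "S - N = T - N"
proof -
  have "i \<in> S \<longleftrightarrow> i \<in> T" if "i \<notin> N" for i
  proof -
    have "con_in i c = 0 \<or> con_out i c = 0" using assms(1) that by (auto simp: decided_def)
    then show ?thesis using assms(2,3) unfolding con_in_zero_iff con_out_zero_iff by blast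
  qed
  then show ?thesis by auto
qed

lemma decided_cov_zero:
  assumes "con_in i c = 0 \<or> con_out i c = 0"
  shows "tot (con_in i c) F * mass c - tot c F * mass (con_in i c) = 0"
  using assms tot_split[of c F i] tot_split[of c "\<lambda>_. 1" i] by auto

lemma con_commute: "con_in i (con_in j c) = con_in j (con_in i c)" "con_in i (con_out j c) = con_out j (con_in i c)"
    "con_out i (con_out j c) = con_out j (con_out i c)"
  by (auto simp: con_in_def con_out_def vec_eq_iff)

text \<open>Comparison of two weighted averages: \<open>(a + b) / (za + zb)\<close> averages \<open>a / za \<ge> b / zb\<close>, the other one
  averages values that are at least as large, and puts relatively more weight on the larger side.  The
  inequality is multiplied out so that vanishing weights are covered.\<close>

lemma weighted_average_le:
  fixes a b a' b' za zb za' zb' :: real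
  assumes "0 < za" "0 \<le> zb" "0 \<le> za'" "0 \<le> zb'"
    and nc: "za * zb' \<le> zb * za'" and ia: "a * za' \<le> a' * za" and ib: "b * zb' \<le> b' * zb"
    and cov: "b * za \<le> a * zb" and zb: "zb = 0 \<Longrightarrow> b = 0" and zb': "zb' = 0 \<Longrightarrow> b' = 0"
  shows "(a + b) * (za' + zb') \<le> (a' + b') * (za + zb)"
proof (cases "zb = 0")
  case True
  then have "za * zb' \<le> 0" using nc by simp
  then have "zb' = 0" using assms(1,4) by (simp add: mult_le_0_iff)
  then show ?thesis using True zb zb' ia by simp
next
  case False
  then have "0 < zb" using assms(2) by simp
  define A B where "A = a / za" and "B = b / zb"
  have AB: "a = A * za" "b = B * zb" using assms(1) False by (auto simp: A_def B_def)
  have "A * za' \<le> a'" using ia assms(1) by (simp add: AB mult.commute mult.left_commute)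
  moreover have "B * zb' \<le> b'" using ib \<open>0 < zb\<close> by (simp add: AB mult.commute mult.left_commute)
  ultimately have "(A * za' + B * zb') * (za + zb) \<le> (a' + b') * (za + zb)"
    using assms(1,2) by (intro mult_right_mono) auto
  moreover have "B \<le> A"
  proof -
    have "B * (za * zb) \<le> A * (za * zb)" using cov by (simp add: AB mult_ac)
    then show ?thesis using assms(1) \<open>0 < zb\<close> by (meson mult_pos_pos mult_le_cancel_right_pos)
  qed
  then have "0 \<le> (A - B) * (zb * za' - za * zb')" using nc by simp
  moreover have "(A * za' + B * zb') * (za + zb) - (a + b) * (za' + zb') = (A - B) * (zb * za' - za * zb')"
    by (simp add: AB algebra_simps)
  ultimately show ?thesis by linarith
qed

text \<open>Under the condition that \<open>e\<close> is present, the covariances of \<open>F\<close> with the coordinates sum to zero, so some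
  coordinate \<open>i\<close> that is present with positive probability has nonnegative covariance with \<open>F\<close>.  Condition on
  whether \<open>i\<close> is present: the two conditional comparisons hold by induction, and by pairwise negative
  correlation the presence of \<open>e\<close> makes \<open>i\<close> less likely, which lowers the average of \<open>F\<close>.
  If no undecided \<open>i\<close> other than \<open>e\<close> can be present together with \<open>e\<close>, the values of \<open>F\<close> are compared directly.\<close>

lemma monotone_vs_single:
  fixes c :: "real^('n::finite set)"
  assumes "pairwise_nc c" "hom_deg d c" "mono F" "\<And>S. F (insert e S) = F (S - {e})" "decided N c"
  shows "tot (con_in e c) F * mass (con_out e c) \<le> tot (con_out e c) F * mass (con_in e c)"
proof -
  have "finite N" by simp
  then show ?thesis using assms(1,2,5)
  proof (induction "card N" arbitrary: N c rule: less_induct)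
    case less
    note nn = pairwise_ncD(1)[OF less.prems(2)]
    define c1 where "c1 = con_in e c"
    define c0 where "c0 = con_out e c"
    have nn1: "nonneg c1" and nn0: "nonneg c0" using nn by (simp_all add: c1_def c0_def nonneg_con)
    have dec1: "decided N c1" unfolding c1_def
      using decided_con(1)[OF less.prems(4), of e] by (auto simp: decided_def)
    show ?case
    proof (cases "\<exists>i\<in>N - {e}. 0 < mass (con_in i c1)")
      case False
      \<comment> \<open>given that \<open>e\<close> is present, no other undecided coordinate is ever present\<close>
      have out: "S \<inter> N \<subseteq> {e}" if "c1 $ S \<noteq> 0" for S
      proof (rule ccontr)
        assume "\<not> ?thesis"
        then obtain i where i: "i \<in> N - {e}" "i \<in> S" by blast
        then have "con_in i c1 \<noteq> 0" using that by (auto simp: con_in_def vec_eq_iff)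
        then have "mass (con_in i c1) \<noteq> 0" using mass_zero nonneg_con(1)[OF nn1] by blast
        then show False using False i mass_nonneg[OF nonneg_con(1)[OF nn1, of i]] by force
      qed
      have le: "F S \<le> F T" if "c1 $ S \<noteq> 0" "c0 $ T \<noteq> 0" for S T
      proof -
        have "S - N = T - N"
          using that less.prems(4) by (intro decided_agree[of N c]) (auto simp: c1_def c0_def con_in_def con_out_def split: if_splits)
        then have "S - {e} \<subseteq> T" using out[OF that(1)] by blast
        \<comment> \<open>\<open>F\<close> ignores \<open>e\<close>, and \<open>S\<close> without \<open>e\<close> is contained in every \<open>T\<close> of the other support\<close>
        then have "F (S - {e}) \<le> F T" using assms(3) by (auto dest: monoD)
        moreover have "e \<in> S" using that by (auto simp: c1_def con_in_def split: if_splits)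
        ultimately show ?thesis using assms(4)[of S] by (simp add: insert_absorb)
      qed
      have "tot c1 F * mass c0 = (\<Sum>S\<in>UNIV. \<Sum>T\<in>UNIV. c1 $ S * c0 $ T * F S)"
        unfolding tot_def sum_product by (intro sum.cong) auto
      also have "\<dots> \<le> (\<Sum>S\<in>UNIV. \<Sum>T\<in>UNIV. c1 $ S * c0 $ T * F T)"
      proof (intro sum_mono)
        fix S T
        show "c1 $ S * c0 $ T * F S \<le> c1 $ S * c0 $ T * F T"
        proof (cases "c1 $ S = 0 \<or> c0 $ T = 0")
          case False
          then show ?thesis using le nn1 nn0 by (intro mult_left_mono) (auto simp: nonneg_def)
        qed auto
      qed
      also have "\<dots> = tot c0 F * mass c1"
        unfolding tot_def sum_product by (subst sum.swap) (intro sum.cong; simp)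
      finally show ?thesis by (simp add: c1_def c0_def)
    next
      case True
      define I where "I = {i \<in> N - {e}. 0 < mass (con_in i c1)}"
      define cov where "cov i = tot (con_in i c1) F * mass c1 - tot c1 F * mass (con_in i c1)" for i
      have "cov i = 0" if "i \<notin> I" for i
      proof (cases "i \<in> N - {e}")
        case True
        then have "mass (con_in i c1) = 0"
          using that mass_nonneg[OF nonneg_con(1)[OF nn1, of i]] by (auto simp: I_def)
        then have "con_in i c1 = 0" using mass_zero nonneg_con(1)[OF nn1] by blast
        then show ?thesis unfolding cov_def by (intro decided_cov_zero) simp
      next
        case False
        have "con_in i c1 = 0 \<or> con_out i c1 = 0"
        proof (cases "i = e")
          case True
          then show ?thesis by (auto simp: c1_def con_in_def con_out_def vec_eq_iff)
        next
          case ie: False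
          then show ?thesis using dec1 False by (auto simp: decided_def)
        qed
        then show ?thesis unfolding cov_def by (rule decided_cov_zero)
      qed
      then have "(\<Sum>i\<in>I. cov i) = (\<Sum>i\<in>UNIV. cov i)"
        by (intro sum.mono_neutral_left) auto
      also have "\<dots> = 0"
        unfolding cov_def using less.prems(3) by (intro sum_covariance_zero[of d]) (simp add: c1_def hom_deg_con)
      finally have s0: "(\<Sum>i\<in>I. cov i) = 0" .
      have "\<exists>i\<in>I. 0 \<le> cov i"
      proof (rule ccontr)
        assume "\<not> ?thesis"
        then have "(\<Sum>i\<in>I. cov i) < (\<Sum>i\<in>I. 0)"
          using True by (intro sum_strict_mono) (auto simp: I_def)
        then show False using s0 by simp
      qed
      then obtain i where i: "i \<in> N" "i \<noteq> e" "0 < mass (con_in i c1)" "0 \<le> cov i" by (auto simp: I_def)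
      have card: "card (N - {i}) < card N" using i(1) by (intro card_Diff1_less) auto
      have IH: "tot (con_in e c') F * mass (con_out e c') \<le> tot (con_out e c') F * mass (con_in e c')"
        if "c' = con_in i c \<or> c' = con_out i c" for c'
        using that less.hyps[OF card, of c'] less.prems
        by (auto simp: pairwise_nc_con_in pairwise_nc_con_out hom_deg_con decided_con)
      define a b a' b' where "a = tot (con_in i c1) F" and "b = tot (con_out i c1) F"
        and "a' = tot (con_in i c0) F" and "b' = tot (con_out i c0) F"
      define za zb za' zb' where "za = mass (con_in i c1)" and "zb = mass (con_out i c1)"
        and "za' = mass (con_in i c0)" and "zb' = mass (con_out i c0)"
      have sp: "tot c1 F = a + b" "tot c0 F = a' + b'" "mass c1 = za + zb" "mass c0 = za' + zb'"
        unfolding a_def b_def a'_def b'_def za_def zb_def za'_def zb'_def by (rule tot_split)+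
      have "(a + b) * (za' + zb') \<le> (a' + b') * (za + zb)"
      proof (rule weighted_average_le)
        show "0 < za" using i by (simp add: za_def)
        show "0 \<le> zb" "0 \<le> za'" "0 \<le> zb'"
          unfolding zb_def za'_def zb'_def using nn1 nn0 by (auto intro!: mass_nonneg nonneg_con)
        show "za * zb' \<le> zb * za'"
          using pairwise_nc_basic[OF less.prems(2), of i e] i(2)
          by (simp add: za_def zb_def za'_def zb'_def c1_def c0_def mult.commute)
        show "a * za' \<le> a' * za"
          using IH[of "con_in i c"] by (simp add: a_def za_def a'_def za'_def c1_def c0_def con_commute)
        show "b * zb' \<le> b' * zb"
          using IH[of "con_out i c"] con_commute(2)[of e i c] con_commute(3)[of e i c]
          by (simp add: b_def zb_def b'_def zb'_def c1_def c0_def)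
        show "b * za \<le> a * zb"
          using i(4) unfolding cov_def sp a_def[symmetric] za_def[symmetric] by (simp add: algebra_simps)
        show "b = 0" if "zb = 0"
          using that mass_zero[OF nonneg_con(2)[OF nn1, of i]] by (simp add: zb_def b_def)
        show "b' = 0" if "zb' = 0"
          using that mass_zero[OF nonneg_con(2)[OF nn0, of i]] by (simp add: zb'_def b'_def)
      qed
      then show ?thesis unfolding sp[symmetric] by (simp add: c1_def c0_def)
    qed
  qed
qed

text \<open>The law of total covariance for a two-valued variable, multiplied out: the conditional covariances
  are nonpositive by the first two hypotheses on products, and the conditional means of the two
  functions move in opposite directions.\<close>

lemma covariance_recombine:
  fixes h1 h0 f1 f0 g1 g0 z1 z0 :: real
  assumes "0 \<le> z1" "0 \<le> z0" "h1 * z1 \<le> f1 * g1" "h0 * z0 \<le> f0 * g0"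
    "f1 * z0 \<le> f0 * z1" "g0 * z1 \<le> g1 * z0"
    "z1 = 0 \<Longrightarrow> h1 = 0 \<and> f1 = 0 \<and> g1 = 0" "z0 = 0 \<Longrightarrow> h0 = 0 \<and> f0 = 0 \<and> g0 = 0"
  shows "(h1 + h0) * (z1 + z0) \<le> (f1 + f0) * (g1 + g0)"
proof (cases "z1 = 0 \<or> z0 = 0")
  case True
  then show ?thesis using assms by auto
next
  case False
  then have z: "0 < z1" "0 < z0" using assms by auto
  define p1 p0 q1 q0 where "p1 = f1 / z1" and "p0 = f0 / z0" and "q1 = g1 / z1" and "q0 = g0 / z0"
  have e: "f1 = p1 * z1" "f0 = p0 * z0" "g1 = q1 * z1" "g0 = q0 * z0"
    using z by (auto simp: p1_def p0_def q1_def q0_def)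
  have "h1 \<le> p1 * q1 * z1" "h0 \<le> p0 * q0 * z0"
  proof -
    have "h1 * z1 \<le> (p1 * q1 * z1) * z1" "h0 * z0 \<le> (p0 * q0 * z0) * z0"
      using assms(3,4) by (simp_all add: e mult_ac)
    then show "h1 \<le> p1 * q1 * z1" "h0 \<le> p0 * q0 * z0" using z by (simp_all add: mult_le_cancel_right_pos)
  qed
  then have "(h1 + h0) * (z1 + z0) \<le> (p1 * q1 * z1 + p0 * q0 * z0) * (z1 + z0)"
    using z by (intro mult_right_mono) auto
  moreover have "p1 \<le> p0" "q0 \<le> q1"
  proof -
    have "p1 * (z1 * z0) \<le> p0 * (z1 * z0)" "q0 * (z1 * z0) \<le> q1 * (z1 * z0)"
      using assms(5,6) by (simp_all add: e mult_ac)
    then show "p1 \<le> p0" "q0 \<le> q1" using z by (meson mult_pos_pos mult_le_cancel_right_pos)+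
  qed
  then have "0 \<le> (z1 * z0) * ((p0 - p1) * (q1 - q0))" using z by simp
  moreover have "(f1 + f0) * (g1 + g0) - (p1 * q1 * z1 + p0 * q0 * z0) * (z1 + z0) = (z1 * z0) * ((p0 - p1) * (q1 - q0))"
    by (simp add: e algebra_simps)
  ultimately show ?thesis by linarith
qed

lemma depends_onD: "depends_on A F \<Longrightarrow> S \<inter> A = T \<inter> A \<Longrightarrow> F S = F T"
  unfolding depends_on_def by blast

text \<open>The argument of Feder and Mihail.  The covariances of \<open>G\<close> with all coordinates sum to zero, and those
  with coordinates outside \<open>B\<close> are nonpositive by the previous comparison.  So, unless all
  of \<open>B\<close> is decided, some undecided \<open>i\<close> in \<open>B\<close> has nonnegative covariance with \<open>G\<close>, while its covariance with \<open>F\<close> is nonpositive.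
  Conditioning on \<open>i\<close> completes the induction.\<close>

lemma feder_mihail:
  fixes c :: "real^('n::finite set)"
  assumes "pairwise_nc c" "hom_deg d c" "mono F" "mono G" "A \<inter> B = {}" "depends_on A F" "depends_on B G"
  shows "tot c (\<lambda>S. F S * G S) * mass c \<le> tot c F * tot c G"
proof -
  have "decided UNIV c" by (simp add: decided_def)
  moreover have "tot c (\<lambda>S. F S * G S) * mass c \<le> tot c F * tot c G" if "decided N c" for N
    using that assms(1,2)
  proof (induction "card N" arbitrary: N c rule: less_induct)
    case less
    note nn = pairwise_ncD(1)[OF less.prems(2)]
    define cov where "cov i = tot (con_in i c) G * mass c - tot c G * mass (con_in i c)" for i
    show ?case
    proof (cases "N \<inter> B = {}")
      case True
      \<comment> \<open>all coordinates that \<open>G\<close> depends on are decided\<close>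
      have "G S = G T" if "c $ S \<noteq> 0" "c $ T \<noteq> 0" for S T
      proof -
        have "S \<inter> B = T \<inter> B" using decided_agree[OF less.prems(1) that] True by blast
        then show ?thesis by (rule depends_onD[OF assms(7)])
      qed
      then obtain g where g: "\<And>S. c $ S \<noteq> 0 \<Longrightarrow> G S = g"
        by (metis (full_types))
      have "c $ S * (F S * G S) = g * (c $ S * F S)" "c $ S * G S = g * (c $ S * 1)" for S
        using g[of S] by (cases "c $ S = 0"; simp)+
      then have "tot c (\<lambda>S. F S * G S) = g * tot c F" "tot c G = g * mass c"
        unfolding tot_def sum_distrib_left by (simp_all only:)
      then show ?thesis by simp
    next
      case False
      have "cov i \<le> 0" if "i \<notin> N \<inter> B" for i
      proof (cases "i \<in> N")
        case False
        then have "con_in i c = 0 \<or> con_out i c = 0" using less.prems(1) by (auto simp: decided_def)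
        then have "cov i = 0" unfolding cov_def by (rule decided_cov_zero)
        then show ?thesis by simp
      next
        case True
        then have "i \<notin> B" using that by simp
        then have "G (insert i S) = G (S - {i})" for S
          by (intro depends_onD[OF assms(7)]) auto
        then have "tot (con_in i c) G * mass (con_out i c) \<le> tot (con_out i c) G * mass (con_in i c)"
          using less.prems assms(4) by (intro monotone_vs_single[of c d G i N])
        then show ?thesis
          unfolding cov_def tot_split[of c G i] tot_split[of c "\<lambda>_. 1" i] by (simp add: algebra_simps)
      qed
      then have "(\<Sum>i\<in>UNIV. cov i) \<le> (\<Sum>i\<in>N \<inter> B. cov i)"
        using sum_mono2[of UNIV "N \<inter> B" "\<lambda>i. - cov i"] by (simp add: sum_negf)
      moreover have "(\<Sum>i\<in>UNIV. cov i) = 0"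
        unfolding cov_def using less.prems(3) by (rule sum_covariance_zero)
      ultimately have s: "0 \<le> (\<Sum>i\<in>N \<inter> B. cov i)" by simp
      have "\<exists>i\<in>N \<inter> B. 0 \<le> cov i"
      proof (rule ccontr)
        assume "\<not> ?thesis"
        then have "(\<Sum>i\<in>N \<inter> B. cov i) < (\<Sum>i\<in>N \<inter> B. 0)"
          using False by (intro sum_strict_mono) (auto simp: not_le)
        then show False using s by simp
      qed
      then obtain i where i: "i \<in> N" "i \<in> B" "0 \<le> cov i" by auto
      have card: "card (N - {i}) < card N" using i(1) by (intro card_Diff1_less) auto
      have IH: "tot c' (\<lambda>S. F S * G S) * mass c' \<le> tot c' F * tot c' G"
        if "c' = con_in i c \<or> c' = con_out i c" for c'
        using that less.hyps[OF card, of c'] less.prems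
        by (auto simp: pairwise_nc_con_in pairwise_nc_con_out hom_deg_con decided_con)
      have "F (insert i S) = F (S - {i})" for S
        using assms(5) i(2) by (intro depends_onD[OF assms(6)]) auto
      then have Fi: "tot (con_in i c) F * mass (con_out i c) \<le> tot (con_out i c) F * mass (con_in i c)"
        using less.prems assms(3) by (intro monotone_vs_single[of c d F i N])
      have Gi: "tot (con_out i c) G * mass (con_in i c) \<le> tot (con_in i c) G * mass (con_out i c)"
        using i(3) unfolding cov_def tot_split[of c G i] tot_split[of c "\<lambda>_. 1" i] by (simp add: algebra_simps)
      show ?thesis
        unfolding tot_split[of c F i] tot_split[of c G i] tot_split[of c "\<lambda>_. 1" i] tot_split[of c "\<lambda>S. F S * G S" i]
      proof (rule covariance_recombine)
        show "tot (con_in i c) (\<lambda>S. F S * G S) = 0 \<and> tot (con_in i c) F = 0 \<and> tot (con_in i c) G = 0" if "mass (con_in i c) = 0"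
          using mass_zero[OF nonneg_con(1)[OF nn] that] by simp
        show "tot (con_out i c) (\<lambda>S. F S * G S) = 0 \<and> tot (con_out i c) F = 0 \<and> tot (con_out i c) G = 0" if "mass (con_out i c) = 0"
          using mass_zero[OF nonneg_con(2)[OF nn] that] by simp
      qed (use nn IH Fi Gi in \<open>auto intro!: mass_nonneg nonneg_con\<close>)
    qed
  qed
  ultimately show ?thesis by blast
qed

text \<open>Conditioning on \<open>P\<close> being present amounts to differentiating in the variables of \<open>P\<close>, and on \<open>Q\<close> being
  absent to setting the variables of \<open>Q\<close> to zero.  So this is the Rayleigh inequality for the derivatives,
  at points of the closed orthant with coordinates in \<open>{0, 1}\<close>.\<close>

lemma gard_pairwise_nc:
  fixes c :: "real^('n::finite set)"
  assumes "gard c"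
  shows "pairwise_nc c"
proof -
  have nn: "nonneg c" using assms by (rule gard_nonneg)
  define Z where "Z = cyl c"
  have Z0: "0 \<le> Z P Q" for P Q
    unfolding Z_def cyl_def tot_def using nn by (intro sum_nonneg) (auto simp: nonneg_def)
  define v :: "'n set \<Rightarrow> real^'n" where "v Q = (\<chi> k. of_bool (k \<notin> Q))" for Q
  have Zev: "Z P Q = maeval (pds P c) (v Q)" if "P \<inter> Q = {}" for P Q
  proof -
    have "maeval (pds P c) (v Q) = (\<Sum>S | S \<inter> P = {} \<and> S \<inter> Q = {}. c $ (P \<union> S))"
      unfolding maeval_def
    proof (rule sum.mono_neutral_cong_right)
      fix S assume "S \<in> {S. S \<inter> P = {} \<and> S \<inter> Q = {}}"
      then have "(\<Prod>k\<in>S. v Q $ k) = 1" by (intro prod.neutral) (auto simp: v_def)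
      then show "pds P c $ S * (\<Prod>k\<in>S. v Q $ k) = c $ (P \<union> S)"
        using \<open>S \<in> _\<close> by (simp add: pds_def)
    qed (auto simp: pds_def prod_zero_iff v_def)
    also have "\<dots> = (\<Sum>S | P \<subseteq> S \<and> S \<inter> Q = {}. c $ S)"
      using that by (intro sum.reindex_bij_witness[of _ "\<lambda>S. S - P" "\<lambda>S. P \<union> S"]) auto
    also have "\<dots> = Z P Q"
      unfolding Z_def cyl_def tot_def by (rule sum.mono_neutral_cong_left) auto
    finally show ?thesis by simp
  qed
  have main: "Z (insert i (insert j P)) Q * Z P Q \<le> Z (insert i P) Q * Z (insert j P) Q" if ij: "i \<noteq> j" for i j P Q
  proof -
    consider "P \<inter> Q \<noteq> {} \<or> i \<in> Q \<or> j \<in> Q" | "P \<inter> Q = {}" "i \<notin> Q" "j \<notin> Q" "i \<in> P \<or> j \<in> P" 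
      | "P \<inter> Q = {}" "i \<notin> Q" "j \<notin> Q" "i \<notin> P" "j \<notin> P" by blast
    then show ?thesis
    proof cases
      case 1
      then have "Z (insert i (insert j P)) Q = 0"
        unfolding Z_def cyl_def tot_def by (intro sum.neutral) auto
      then show ?thesis using Z0 by simp
    next
      case 2
      then show ?thesis by (auto simp: insert_absorb insert_commute mult.commute)
    next
      case 3
      have "maeval (pds P c) (v Q) * maeval (pd i (pd j (pds P c))) (v Q)
          \<le> maeval (pd i (pds P c)) (v Q) * maeval (pd j (pds P c)) (v Q)"
        by (intro rayleigh_closed_orthant gard_pds assms ij) (simp add: v_def)
      then show ?thesis using 3 ij by (simp add: Zev pds_insert mult.commute)
    qed
  qed
  show ?thesis
    unfolding pairwise_nc_def Z_def[symmetric] using nn main by simp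
qed

section \<open>Passing between polynomials and coefficient vectors\<close>

definition coeff_vec :: "'n::finite rpoly \<Rightarrow> real^('n set)" where
  "coeff_vec f = (\<chi> S. Poly_Mapping.lookup f (exp_of_set S))"

lemma inj_exp_of_set: "inj (exp_of_set :: 'n::finite set \<Rightarrow> _)"
proof (rule injI)
  fix S T :: "'n set" assume eq: "exp_of_set S = exp_of_set T"
  have "i \<in> S \<longleftrightarrow> i \<in> T" for i
    using arg_cong[OF eq, of "\<lambda>m. Poly_Mapping.lookup m i"] by (simp add: lookup_exp_of_set split: if_splits)
  then show "S = T" by blast
qed

lemma multi_affine_keysE:
  assumes "multi_affine f" "m \<in> Poly_Mapping.keys f"
  obtains S where "m = exp_of_set S"
proof -
  have "Poly_Mapping.lookup m i \<le> 1" for i using assms by (auto simp: multi_affine_def)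
  then have "m = exp_of_set {i. Poly_Mapping.lookup m i = 1}"
    by (intro poly_mapping_eqI) (auto simp: lookup_exp_of_set le_Suc_eq)
  then show ?thesis by (rule that)
qed

lemma peval_coeff_vec:
  fixes x :: "'a::real_field^'n::finite"
  assumes "multi_affine f"
  shows "peval f x = (\<Sum>S\<in>UNIV. of_real (coeff_vec f $ S) * (\<Prod>i\<in>S. x $ i))"
proof -
  have mono: "(\<Prod>i\<in>UNIV. x $ i ^ Poly_Mapping.lookup (exp_of_set S) i) = (\<Prod>i\<in>S. x $ i)" for S
    by (rule prod.mono_neutral_cong_right) (auto simp: lookup_exp_of_set)
  have "(\<Sum>S\<in>UNIV. of_real (coeff_vec f $ S) * (\<Prod>i\<in>S. x $ i))
      = (\<Sum>m\<in>range exp_of_set. of_real (Poly_Mapping.lookup f m) * (\<Prod>i\<in>UNIV. x $ i ^ Poly_Mapping.lookup m i))"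
    by (subst sum.reindex[OF inj_exp_of_set]) (simp only: o_def mono coeff_vec_def vec_lambda_beta)
  also have "\<dots> = peval f x"
    unfolding peval_def
  proof (rule sum.mono_neutral_right)
    show "Poly_Mapping.keys f \<subseteq> range exp_of_set"
      using multi_affine_keysE[OF assms] by blast
  qed (auto simp: in_keys_iff)
  finally show ?thesis by simp
qed

lemma peval_eq_maeval: "multi_affine f \<Longrightarrow> peval f x = maeval (coeff_vec f) x"
  by (simp add: peval_coeff_vec maeval_def)

lemma nonneg_coeff_vec: "nonneg_coeffs f \<Longrightarrow> nonneg (coeff_vec f)"
  by (simp add: nonneg_coeffs_def nonneg_def coeff_vec_def)

lemma coeff_vec_eq_0_iff:
  assumes "multi_affine f"
  shows "coeff_vec f = 0 \<longleftrightarrow> f = 0"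
proof
  assume z: "coeff_vec f = 0"
  have "m \<notin> Poly_Mapping.keys f" for m
  proof
    assume m: "m \<in> Poly_Mapping.keys f"
    then obtain S where "m = exp_of_set S" using multi_affine_keysE[OF assms] by blast
    then have "coeff_vec f $ S \<noteq> 0" using m by (simp add: coeff_vec_def in_keys_iff)
    then show False using z by simp
  qed
  then have "Poly_Mapping.keys f = {}" by blast
  then show "f = 0" by simp
qed (simp add: coeff_vec_def vec_eq_iff)

lemma multi_affine_mderiv:
  assumes "multi_affine f"
  shows "multi_affine (mderiv i f)"
  unfolding multi_affine_def
proof (intro ballI allI)
  fix m k assume "m \<in> Poly_Mapping.keys (mderiv i f)"
  then have "m + Poly_Mapping.single i 1 \<in> Poly_Mapping.keys f"
    by (auto simp: in_keys_iff lookup_mderiv)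
  then have "Poly_Mapping.lookup (m + Poly_Mapping.single i 1) k \<le> 1"
    using assms by (auto simp: multi_affine_def)
  then show "Poly_Mapping.lookup m k \<le> 1" by (simp add: lookup_add)
qed

lemma homogeneous_mderiv:
  assumes "homogeneous d f"
  shows "homogeneous (d - 1) (mderiv i f)"
  unfolding homogeneous_def
proof
  fix m assume "m \<in> Poly_Mapping.keys (mderiv i f)"
  then have "m + Poly_Mapping.single i 1 \<in> Poly_Mapping.keys f"
    by (auto simp: in_keys_iff lookup_mderiv)
  then have "total_deg (m + Poly_Mapping.single i 1) = d" using assms by (auto simp: homogeneous_def)
  moreover have "total_deg (m + Poly_Mapping.single i 1) = total_deg m + 1"
    by (simp add: total_deg_def lookup_add sum.distrib lookup_single when_def)
  ultimately show "total_deg m = d - 1" by simp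
qed

lemma coeff_vec_mderiv:
  assumes "multi_affine f"
  shows "coeff_vec (mderiv i f) = pd i (coeff_vec f)"
proof -
  have "coeff_vec (mderiv i f) $ S = pd i (coeff_vec f) $ S" for S
  proof (cases "i \<in> S")
    case True
    have "exp_of_set S + Poly_Mapping.single i 1 \<notin> Poly_Mapping.keys f"
    proof
      assume "exp_of_set S + Poly_Mapping.single i 1 \<in> Poly_Mapping.keys f"
      then have "Poly_Mapping.lookup (exp_of_set S + Poly_Mapping.single i 1) i \<le> 1"
        using assms by (auto simp: multi_affine_def)
      then show False using True by (simp add: lookup_add lookup_exp_of_set)
    qed
    then show ?thesis using True by (simp add: coeff_vec_def lookup_mderiv pd_def in_keys_iff)
  next
    case False
    then have "exp_of_set S + Poly_Mapping.single i 1 = exp_of_set (insert i S)"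
      by (intro poly_mapping_eqI) (auto simp: lookup_add lookup_exp_of_set lookup_single when_def)
    then show ?thesis using False by (simp add: coeff_vec_def lookup_mderiv pd_def lookup_exp_of_set)
  qed
  then show ?thesis by (simp add: vec_eq_iff)
qed

lemma hom_deg_coeff_vec:
  assumes "homogeneous d f"
  shows "hom_deg d (coeff_vec f)"
proof -
  have deg: "total_deg (exp_of_set S) = card S" for S :: "'a set"
    by (simp add: total_deg_def lookup_exp_of_set sum.If_cases)
  show ?thesis
    unfolding hom_deg_def
  proof (intro allI impI)
    fix S assume "coeff_vec f $ S \<noteq> 0"
    then have "exp_of_set S \<in> Poly_Mapping.keys f" by (simp add: coeff_vec_def in_keys_iff)
    then have "total_deg (exp_of_set S) = d" using assms unfolding homogeneous_def by blast
    then show "card S = d" by (simp add: deg)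
  qed
qed

lemma closure_pos_orthant: "closure pos_orthant = {x :: real^'n::finite. \<forall>i. 0 \<le> x $ i}"
proof
  have "closed {x :: real^'n. \<forall>i. 0 \<le> x $ i}"
    by (intro closed_Collect_all closed_Collect_le continuous_intros)
  then show "closure pos_orthant \<subseteq> {x :: real^'n. \<forall>i. 0 \<le> x $ i}"
    by (rule closure_minimal[rotated]) (auto simp: pos_orthant_def less_imp_le)
  show "{x :: real^'n. \<forall>i. 0 \<le> x $ i} \<subseteq> closure pos_orthant"
  proof
    fix x :: "real^'n" assume x: "x \<in> {x. \<forall>i. 0 \<le> x $ i}"
    have "(\<lambda>n. x + (1 / real (Suc n)) *\<^sub>R 1) \<longlonglongrightarrow> x + 0 *\<^sub>R 1"
      by (intro tendsto_intros LIMSEQ_Suc lim_1_over_n)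
    moreover have "x + (1 / real (Suc n)) *\<^sub>R 1 \<in> pos_orthant" for n
      using x by (auto simp: pos_orthant_def add_nonneg_pos)
    ultimately show "x \<in> closure pos_orthant"
      unfolding closure_sequential by (intro exI[of _ "\<lambda>n. x + (1 / real (Suc n)) *\<^sub>R 1"]) simp
  qed
qed

text \<open>The component that passes the positive ray test contains a point with all coordinates at least one,
  so it is the component of the all-ones vector.\<close>

lemma garding_imp_gard:
  fixes f :: "'n::finite rpoly"
  assumes "garding f" "nonneg_coeffs f"
  shows "gard (coeff_vec f)"
proof (cases "f = 0")
  case True
  then have "coeff_vec f = 0" by (simp add: coeff_vec_def vec_eq_iff)
  then show ?thesis by simp
next
  case False
  have ma: "multi_affine f" using assms(1) by (simp add: garding_def)
  define c where "c = coeff_vec f"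
  have nn: "nonneg c" and c0: "c \<noteq> 0"
    using nonneg_coeff_vec[OF assms(2)] coeff_vec_eq_0_iff[OF ma] False by (auto simp: c_def)
  obtain C where C: "C \<in> components {x. 0 < maeval c x}" and prt: "passes_PRT C"
    using assms(1) False by (auto simp: garding_def peval_eq_maeval[OF ma] c_def)
  have up: "x + y \<in> C" if "x \<in> C" "\<And>i. 0 \<le> y $ i" for x y
    using prt that by (auto simp: passes_PRT_def closure_pos_orthant)
  obtain x where x: "x \<in> C" using in_components_nonempty[OF C] by blast
  define z where "z = x + (\<chi> i. max 0 (1 - x $ i))"
  have z_ge: "1 \<le> z $ i" for i by (simp add: z_def)
  have zC: "z \<in> C" unfolding z_def by (rule up[OF x]) simp
  have "0 < maeval c z" using in_components_subset[OF C] zC by blast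
  then have "z \<in> chamber c"
    using nn z_ge by (intro nonneg_point_in_chamber) (auto intro: order_trans[OF zero_le_one])
  then have "chamber c = connected_component_set {x. 0 < maeval c x} z"
    unfolding chamber_def by (rule connected_component_eq[symmetric])
  moreover have "C = connected_component_set {x. 0 < maeval c x} z"
  proof -
    obtain w where "C = connected_component_set {x. 0 < maeval c x} w"
      using C by (auto simp: components_def)
    then show ?thesis using zC connected_component_eq by blast
  qed
  ultimately have CC: "C = chamber c" by simp
  have "0 \<le> maeval (pd i c) x" if xC: "x \<in> chamber c" for x i
  proof (rule ccontr)
    assume neg: "\<not> ?thesis"
    define t where "t = maeval c x / (- maeval (pd i c) x)"
    have "0 \<le> t" unfolding t_def using chamber_pos[OF xC] neg by (intro divide_nonneg_nonneg) auto
    then have "x + t *\<^sub>R axis i 1 \<in> chamber c"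
      using up[of x "t *\<^sub>R axis i 1"] xC by (auto simp: CC axis_def)
    then have "0 < maeval c x + t * maeval (pd i c) x"
      using chamber_pos maeval_add_axis by metis
    moreover have "t * maeval (pd i c) x = - maeval c x" using neg by (simp add: t_def)
    ultimately show False by simp
  qed
  then show ?thesis using nn by (simp add: gard_def c_def)
qed

lemma ray_poly_eq_diagp:
  assumes "multi_affine f"
  shows "ray_poly f a = diagp (scale_vars a (coeff_vec f))"
proof -
  have "poly (ray_poly f a) t = poly (diagp (scale_vars a (coeff_vec f))) t" for t
  proof -
    have "(\<chi> i. a $ i * (t *\<^sub>R 1) $ i) = t *\<^sub>R a" by (simp add: vec_eq_iff)
    then show ?thesis by (simp add: poly_ray_poly peval_eq_maeval[OF assms] poly_diagp maeval_scale_vars)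
  qed
  then show ?thesis by (simp add: poly_eq_poly_eq_iff[symmetric] fun_eq_iff)
qed

section \<open>Real stable quadratics and Lorentzian polynomials\<close>

text \<open>For \<open>z = x + \<i> y\<close> this is the expansion of a quadratic form, with the polar form written as
  \<open>q (x + y) - q x - q y\<close>.\<close>

lemma complex_quadratic:
  fixes f :: "'n::finite rpoly" and z :: "complex^'n"
  assumes f: "multi_affine f" "hom_deg 2 (coeff_vec f)"
  defines "x \<equiv> \<chi> i. Re (z $ i)" and "y \<equiv> \<chi> i. Im (z $ i)"
  defines "q \<equiv> maeval (coeff_vec f)"
  shows "Re (peval f z) = q x - q y" and "Im (peval f z) = q (x + y) - q x - q y"
proof -
  let ?c = "coeff_vec f"
  have two: "\<exists>i j. i \<noteq> j \<and> S = {i, j}" if "?c $ S \<noteq> 0" for S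
    using f(2) that unfolding hom_deg_def card_2_iff by blast
  have "?c $ S * Re (\<Prod>i\<in>S. z $ i) = ?c $ S * (\<Prod>i\<in>S. x $ i) - ?c $ S * (\<Prod>i\<in>S. y $ i)" for S
  proof (cases "?c $ S = 0")
    case False
    then obtain i j where "i \<noteq> j" "S = {i, j}" using two by blast
    then show ?thesis by (simp add: x_def y_def algebra_simps)
  qed simp
  then show "Re (peval f z) = q x - q y"
    unfolding peval_coeff_vec[OF f(1)] q_def maeval_def sum_subtractf[symmetric] by (simp add: Re_sum)
  have "?c $ S * Im (\<Prod>i\<in>S. z $ i)
      = ?c $ S * (\<Prod>i\<in>S. (x + y) $ i) - ?c $ S * (\<Prod>i\<in>S. x $ i) - ?c $ S * (\<Prod>i\<in>S. y $ i)" for S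
  proof (cases "?c $ S = 0")
    case False
    then obtain i j where "i \<noteq> j" "S = {i, j}" using two by blast
    then show ?thesis by (simp add: x_def y_def algebra_simps)
  qed simp
  then show "Im (peval f z) = q (x + y) - q x - q y"
    unfolding peval_coeff_vec[OF f(1)] q_def maeval_def sum_subtractf[symmetric] by (simp add: Im_sum)
qed

text \<open>If \<open>q (x + \<i> y) = 0\<close> with \<open>y\<close> in the open orthant, then \<open>q x = q y > 0\<close> and the polar form vanishes, so
  \<open>q (x + t y) = q x + t\<^sup>2 q y > 0\<close> for all real \<open>t\<close>.  This line enters the positive orthant for large \<open>t\<close>, hence
  lies in the component; for very negative \<open>t\<close> it lies below the origin, so the origin is in the
  component too, although \<open>q 0 = 0\<close>.\<close>

lemma quadratic_real_stable:
  fixes f :: "'n::finite rpoly"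
  assumes f: "multi_affine f" "gard (coeff_vec f)" "homogeneous 2 f"
  shows "real_stable f"
proof (cases "f = 0")
  case False
  define c where "c = coeff_vec f"
  have hom: "hom_deg 2 c" using hom_deg_coeff_vec[OF f(3)] by (simp add: c_def)
  have nn: "nonneg c" and g: "gard c" using f(2) by (auto simp: gard_nonneg c_def)
  have c0: "c \<noteq> 0" using False f(1) by (simp add: c_def coeff_vec_eq_0_iff)
  have "peval f z \<noteq> 0" if im: "\<And>i. 0 < Im (z $ i)" for z :: "complex^'n"
  proof
    assume zero: "peval f z = 0"
    define x y where "x = (\<chi> i. Re (z $ i))" and "y = (\<chi> i. Im (z $ i))"
    have eq: "maeval c x = maeval c y" "maeval c (x + y) = maeval c x + maeval c y"
      using complex_quadratic[OF f(1) hom[unfolded c_def], of z] zero by (simp_all add: x_def y_def c_def)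
    have py: "0 < maeval c y" using nn c0 im by (intro maeval_pos) (auto simp: y_def)
    have yi: "0 < y $ i" for i using im by (simp add: y_def)
    have line: "maeval c (x + t *\<^sub>R y) = maeval c x + t\<^sup>2 * maeval c y" for t
    proof -
      have two: "\<exists>i j. i \<noteq> j \<and> S = {i, j}" if "c $ S \<noteq> 0" for S
        using hom that unfolding hom_deg_def card_2_iff by blast
      have "c $ S * (\<Prod>i\<in>S. (x + t *\<^sub>R y) $ i) = c $ S * (\<Prod>i\<in>S. x $ i) + t\<^sup>2 * (c $ S * (\<Prod>i\<in>S. y $ i))
          + t * (c $ S * (\<Prod>i\<in>S. (x + y) $ i) - c $ S * (\<Prod>i\<in>S. x $ i) - c $ S * (\<Prod>i\<in>S. y $ i))" for S
      proof (cases "c $ S = 0")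
        case False
        then obtain i j where "i \<noteq> j" "S = {i, j}" using two by blast
        then show ?thesis by (simp add: algebra_simps power2_eq_square)
      qed simp
      then have "maeval c (x + t *\<^sub>R y) = maeval c x + t\<^sup>2 * maeval c y
          + t * (maeval c (x + y) - maeval c x - maeval c y)"
        unfolding maeval_def sum_distrib_left sum_subtractf[symmetric] sum.distrib[symmetric] by (simp only:)
      then show ?thesis using eq by simp
    qed
    have pos: "0 < maeval c (x + t *\<^sub>R y)" for t
      unfolding line using eq py by (simp add: add_pos_nonneg)
    define M where "M = (\<Sum>j\<in>UNIV. \<bar>x $ j\<bar> / y $ j)"
    have M: "\<bar>x $ i\<bar> \<le> M * y $ i" for i
    proof -
      have "\<bar>x $ i\<bar> / y $ i \<le> M"
        unfolding M_def using yi by (intro member_le_sum) (auto simp: less_imp_le)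
      then show ?thesis using yi by (simp add: pos_divide_le_eq)
    qed
    have t1: "0 \<le> x $ i + M * y $ i" and t2: "x $ i + (- M) * y $ i \<le> 0" for i
      using M[of i] by linarith+
    have "x + M *\<^sub>R y \<in> chamber c"
      using nn t1 pos by (intro nonneg_point_in_chamber) auto
    moreover have "0 < maeval c (x + M *\<^sub>R y + u *\<^sub>R (x + (- M) *\<^sub>R y - (x + M *\<^sub>R y)))" for u
    proof -
      have "x + M *\<^sub>R y + u *\<^sub>R (x + (- M) *\<^sub>R y - (x + M *\<^sub>R y)) = x + (M + u * (- M - M)) *\<^sub>R y"
        by (simp add: vec_eq_iff algebra_simps)
      then show ?thesis using pos[of "M + u * (- M - M)"] by (simp only:)
    qed
    ultimately have "x + (- M) *\<^sub>R y \<in> chamber c" by (rule chamber_segment)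
    then have "0 \<in> chamber c" using chamber_up[OF g, of "x + (- M) *\<^sub>R y" 0] t2 by simp
    then have "0 < maeval c 0" by (rule chamber_pos)
    moreover have "maeval c (0 *\<^sub>R 1) = 0" using maeval_hom[OF hom, of 0 1] by simp
    ultimately show False by simp
  qed
  then show ?thesis by (auto simp: real_stable_def)
qed (simp add: real_stable_def)

definition gard_hom :: "nat \<Rightarrow> 'n::finite rpoly \<Rightarrow> bool" where
  "gard_hom d f \<longleftrightarrow> multi_affine f \<and> gard (coeff_vec f) \<and> homogeneous d f"

lemma gard_hom_mderiv_pow: "gard_hom d f \<Longrightarrow> gard_hom (d - k) ((mderiv i ^^ k) f)"
proof (induction k)
  case (Suc k)
  then have "gard_hom (d - k - 1) (mderiv i ((mderiv i ^^ k) f))"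
    using homogeneous_mderiv[of "d - k"] by (auto simp: gard_hom_def multi_affine_mderiv coeff_vec_mderiv gard_pd)
  then show ?case by (simp add: diff_diff_add)
qed simp

lemma gard_hom_fold:
  "gard_hom d f \<Longrightarrow> gard_hom (d - sum_list (map (Poly_Mapping.lookup \<alpha>) xs))
     (fold (\<lambda>i. mderiv i ^^ Poly_Mapping.lookup \<alpha> i) xs f)"
proof (induction xs arbitrary: d f)
  case (Cons i xs)
  from Cons.IH[OF gard_hom_mderiv_pow[OF Cons.prems]] show ?case by (simp add: diff_diff_add)
qed simp

lemma gard_hom_mderivs:
  assumes "gard_hom d f"
  shows "gard_hom (d - total_deg \<alpha>) (mderivs \<alpha> f)"
proof -
  have "sum_list (map (Poly_Mapping.lookup \<alpha>) (sorted_list_of_set UNIV)) = total_deg \<alpha>"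
    unfolding total_deg_def by (subst sum.distinct_set_conv_list[symmetric]) auto
  then show ?thesis using gard_hom_fold[OF assms, of \<alpha> "sorted_list_of_set UNIV"] by (simp add: mderivs_def)
qed

lemma gard_hom_M_convex:
  assumes "gard_hom d f"
  shows "M_convex (Poly_Mapping.keys f)"
  unfolding M_convex_def
proof (intro ballI allI impI)
  fix \<alpha> \<beta> i assume ab: "\<alpha> \<in> Poly_Mapping.keys f" "\<beta> \<in> Poly_Mapping.keys f"
    and i: "Poly_Mapping.lookup \<beta> i < Poly_Mapping.lookup \<alpha> i"
  have f: "multi_affine f" "gard (coeff_vec f)" "hom_deg d (coeff_vec f)"
    using assms hom_deg_coeff_vec by (auto simp: gard_hom_def)
  obtain S T where ST: "\<alpha> = exp_of_set S" "\<beta> = exp_of_set T"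
    using multi_affine_keysE[OF f(1)] ab by metis
  have "i \<in> S" "i \<notin> T" using i by (auto simp: ST lookup_exp_of_set split: if_splits)
  moreover have "coeff_vec f $ S \<noteq> 0" "coeff_vec f $ T \<noteq> 0"
    using ab by (auto simp: ST coeff_vec_def in_keys_iff)
  ultimately obtain j where j: "j \<in> T - S" "coeff_vec f $ (insert j (S - {i})) \<noteq> 0"
    using support_exchange[OF f(2,3)] by blast
  have "\<alpha> - Poly_Mapping.single i 1 + Poly_Mapping.single j 1 = exp_of_set (insert j (S - {i}))"
    using j \<open>i \<in> S\<close> by (intro poly_mapping_eqI)
      (auto simp: ST lookup_add lookup_minus lookup_exp_of_set lookup_single when_def)
  then show "\<exists>j. Poly_Mapping.lookup \<alpha> j < Poly_Mapping.lookup \<beta> j \<and>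
      \<alpha> - Poly_Mapping.single i 1 + Poly_Mapping.single j 1 \<in> Poly_Mapping.keys f"
    using j by (intro exI[of _ j]) (auto simp: ST lookup_exp_of_set coeff_vec_def in_keys_iff)
qed

lemma gard_hom_concave:
  assumes "gard_hom d f" "f \<noteq> 0"
  shows "concave_on pos_orthant (\<lambda>x. ln (peval f x))"
proof -
  have f: "multi_affine f" "gard (coeff_vec f)" "hom_deg d (coeff_vec f)"
    using assms hom_deg_coeff_vec by (auto simp: gard_hom_def)
  have c0: "coeff_vec f \<noteq> 0" using f(1) assms(2) by (simp add: coeff_vec_eq_0_iff)
  show ?thesis
    unfolding concave_on_iff
  proof (intro conjI ballI allI impI)
    show "convex (pos_orthant :: (real^'a) set)"
      unfolding convex_alt pos_orthant_def
    proof safe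
      fix x y :: "real^'a" and u :: real and i
      assume *: "\<forall>i. 0 < x $ i" "\<forall>i. 0 < y $ i" "0 \<le> u" "u \<le> 1"
      have "0 < (1 - u) * x $ i + u * y $ i"
      proof (cases "u = 0")
        case False
        with * show ?thesis by (intro add_nonneg_pos mult_nonneg_nonneg mult_pos_pos) (auto simp: less_imp_le)
      qed (use * in simp)
      then show "0 < ((1 - u) *\<^sub>R x + u *\<^sub>R y) $ i" by simp
    qed
    fix x y :: "real^'a" and u v :: real
    assume xy: "x \<in> pos_orthant" "y \<in> pos_orthant" "0 \<le> u" "0 \<le> v" "u + v = 1"
    consider "v = 0" "u = 1" | "v = 1" "u = 0" | "0 < v" "v < 1" "u = 1 - v" using xy by linarith
    then show "u * ln (peval f x) + v * ln (peval f y) \<le> ln (peval f (u *\<^sub>R x + v *\<^sub>R y))"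
    proof cases
      case 3
      then show ?thesis
        using hom_log_concave[OF f(2,3) c0, of x y v] xy(1,2) unfolding \<open>u = 1 - v\<close>
        by (simp add: pos_orthant_def peval_eq_maeval[OF f(1)])
    qed simp_all
  qed
qed

lemma gard_hom_negatively_associated:
  fixes f :: "'n::finite rpoly"
  assumes "gard_hom d f" "f \<noteq> 0" "nonneg_coeffs f"
  shows "negatively_associated (assoc_pmf f)"
proof -
  have f: "multi_affine f" "gard (coeff_vec f)" "hom_deg d (coeff_vec f)"
    using assms hom_deg_coeff_vec by (auto simp: gard_hom_def)
  define c where "c = coeff_vec f"
  have c0: "c \<noteq> 0" using f(1) assms(2) by (simp add: c_def coeff_vec_eq_0_iff)
  have Z: "peval f (\<chi> i. 1) = mass c"
    by (simp add: peval_eq_maeval[OF f(1)] maeval_def tot_def c_def)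
  have Zpos: "0 < mass c"
    using mass_nonneg[of c] mass_zero[of c] c0 gard_nonneg[OF f(2)] by (force simp: c_def less_le)
  have ex: "measure_pmf.expectation (assoc_pmf f) H = tot c H / mass c" for H
  proof -
    have "measure_pmf.expectation (assoc_pmf f) H = (\<Sum>S\<in>UNIV. H S * pmf (assoc_pmf f) S)"
      by (rule integral_measure_pmf_real) auto
    also have "\<dots> = tot c H / mass c"
      unfolding pmf_assoc_pmf[OF f(1) assms(3,2)] Z tot_def sum_divide_distrib
      by (intro sum.cong) (auto simp: c_def coeff_vec_def)
    finally show ?thesis .
  qed
  show ?thesis
    unfolding negatively_associated_def ex
  proof (intro allI impI)
    fix F G :: "'n set \<Rightarrow> real" and A B
    assume "mono F \<and> mono G \<and> A \<inter> B = {} \<and> depends_on A F \<and> depends_on B G"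
    then have "tot c (\<lambda>S. F S * G S) * mass c \<le> tot c F * tot c G"
      using gard_pairwise_nc[OF f(2)] f(3) by (intro feder_mihail[of c d F G A B]) (auto simp: c_def)
    then show "tot c (\<lambda>S. F S * G S) / mass c \<le> tot c F / mass c * (tot c G / mass c)"
      using Zpos by (simp add: field_simps)
  qed
qed

theorem theorem1p2:
  fixes f :: "'n::{finite,linorder} rpoly"
  assumes "garding f" and "nonneg_coeffs f"
  shows
    "(rayleigh f \<and>
      (\<forall>x \<in> closure pos_orthant. \<forall>i j. i \<noteq> j \<longrightarrow>
         peval (mderiv i f) x * peval (mderiv j f) x
           \<ge> peval f x * peval (mderiv i (mderiv j f)) x))
     \<and>
     (\<forall>a \<in> closure pos_orthant. ray_poly f a \<noteq> 0 \<longrightarrow>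
        ultra_log_concave_seq (degree (ray_poly f a)) (coeff (ray_poly f a)))
     \<and>
     (\<forall>d. homogeneous d f \<longrightarrow>
        lorentzian d f \<and>
        (f \<noteq> 0 \<longrightarrow>
           concave_on pos_orthant (\<lambda>x. ln (peval f x)) \<and>
           negatively_associated (assoc_pmf f)))"
proof -
  have ma: "multi_affine f" using assms(1) by (simp add: garding_def)
  have g: "gard (coeff_vec f)" using assms by (rule garding_imp_gard)
  have ray: "peval f x * peval (mderiv i (mderiv j f)) x \<le> peval (mderiv i f) x * peval (mderiv j f) x"
    if "x \<in> closure pos_orthant" "i \<noteq> j" for x i j
    using rayleigh_closed_orthant[OF g _ that(2), of x] that(1)
    by (simp add: closure_pos_orthant peval_eq_maeval coeff_vec_mderiv multi_affine_mderiv ma)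
  have "peval f x * peval (mderiv i (mderiv j f)) x - peval (mderiv i f) x * peval (mderiv j f) x \<le> 0"
    if "x \<in> pos_orthant" "i < j" for x i j
    using ray[of x i j] that closure_subset[of pos_orthant] by auto
  then have "rayleigh f" using ma assms(2) by (simp add: rayleigh_def)
  moreover have "ultra_log_concave_seq (degree (ray_poly f a)) (coeff (ray_poly f a))"
    if "a \<in> closure pos_orthant" for a
    using diagp_ultra_log_concave[OF gard_scale_vars[OF g, of a]] that
    by (simp add: ray_poly_eq_diagp[OF ma] closure_pos_orthant)
  moreover have "lorentzian d f" if "homogeneous d f" for d
  proof -
    have gh: "gard_hom d f" using ma g that by (simp add: gard_hom_def)
    have "real_stable (mderivs \<alpha> f)" if "2 \<le> d" "total_deg \<alpha> = d - 2" for \<alpha>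
    proof -
      have "d - total_deg \<alpha> = 2" using that by simp
      then have "gard_hom 2 (mderivs \<alpha> f)" using gard_hom_mderivs[OF gh, of \<alpha>] by simp
      then show ?thesis by (intro quadratic_real_stable) (auto simp: gard_hom_def)
    qed
    then show ?thesis
      using that assms(2) gard_hom_M_convex[OF gh] by (simp add: lorentzian_def)
  qed
  moreover have "concave_on pos_orthant (\<lambda>x. ln (peval f x)) \<and> negatively_associated (assoc_pmf f)"
    if "homogeneous d f" "f \<noteq> 0" for d
    using that ma g assms(2) gard_hom_concave[of d f] gard_hom_negatively_associated[of d f]
    by (simp add: gard_hom_def)
  ultimately show ?thesis using ray by blast
qed

end
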